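(* Let $-\frac12<\tau<0$, $\lambda\in\mathbb{C}$, and let $\alpha,\rho,\beta,\sigma\in\mathbb{C}$ be generic. Define $$\psi_\lambda(x)=\int_{\mathcal{C}_x}\frac{G_{2\tau}\bigl(\frac1{2\tau}+\beta+\sigma-i\lambda+x+z\bigr)G_{2\tau}\bigl(\frac1{2\tau}-1+\sigma-i\lambda-x-z\bigr)}{G_{2\tau}\bigl(-\frac1{2\tau}+\beta+\sigma+i\lambda-x-z\bigr)G_{2\tau}\bigl(-\frac1{2\tau}+1+\sigma+i\lambda+x+z\bigr)}\cdot\frac{G_{2\tau}\bigl(-\frac1{2\tau}-1+\alpha+\rho+i\lambda-z\bigr)G_{2\tau}\bigl(-\frac1{2\tau}+\rho+i\lambda+z\bigr)}{G_{2\tau}\bigl(-\frac1{2\tau}+1+\alpha+\rho-i\lambda+z\bigr)G_{2\tau}\bigl(-\frac1{2\tau}+\rho-i\lambda-z\bigr)}\,dz .$$ Then $\psi_\lambda$ satisfies $$B(x)\psi_\lambda(x+2)+C(x)\psi_\lambda(x)+D(x)\psi_\lambda(x-2)=E(\lambda;\beta)\,\psi_\lambda(x),$$ with eigenvalue $E(\lambda;\beta)=-1-q^{2-2\beta}+q^{1-\beta}(q^{2i\lambda}+q^{-2i\lambda})$. Here genericity means: the parameters $\alpha,\rho,\beta,\sigma$ (together with $\lambda$ and $x$) are such that the eight singular half lines described in the context lie on eight different horizontal lines, and $q^{2x}\notin\{1,q^2,q^{-2}\}$; the identity holds for every such $x$.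
   Context: $q=\exp(2\pi i\tau)$ (so $|q|=1$, $q\neq\pm1$), $q^u=\exp(2\pi i\tau u)$ for $u\in\mathbb{C}$. Hyperbolic gamma function: for $\tau<0$ and $|\mathrm{Re}(z)|<1-\tau^{-1}$ put $\gamma_\tau(z)=\frac1{2i}\int_0^\infty\frac{dy}{y}\Bigl(\frac zy-\frac{\sinh(\tau yz)}{\sinh(y)\sinh(\tau y)}\Bigr)$ and $G_\tau(z)=\exp(i\gamma_\tau(z))$; $G_\tau$ satisfies $G_\tau(z+2)=2\cos(\pi(z+1)\tau/2)G_\tau(z)$ and is extended by this to a meromorphic function on $\mathbb{C}$. $G_{2\tau}$ is this function with $\tau$ replaced by $2\tau$. Singular half lines (containing all singularities in $z$ of the integrand): the four leftward half lines $-1-\beta-\sigma+i\lambda-x+\mathbb{R}_{\le0}$, $-1+\beta+\sigma+i\lambda-x+\mathbb{R}_{\le0}$, $-1+\frac1\tau-\rho-i\lambda+\mathbb{R}_{\le0}$, $-1+\rho-i\lambda+\mathbb{R}_{\le0}$, and the four rightward half lines $-\sigma-i\lambda-x+\mathbb{R}_{\ge0}$, $\sigma-i\lambda-x+\mathbb{R}_{\ge0}$, $-\alpha-\rho+i\lambda+\mathbb{R}_{\ge0}$, $-\frac1\tau+\alpha+\rho+i\lambda+\mathbb{R}_{\ge0}$. A contour $\mathcal{C}$ is a deformation of $i\mathbb{R}$ if it meets each line $\{z\mid\mathrm{Im}(z)=c\}$, $c\in\mathbb{R}$, in exactly one point $z_c(\mathcal{C})$, and $z_c(\mathcal{C})=ic$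 for $|c|$ large. It is oriented from $-i\infty$ to $i\infty$. $\mathcal{C}_x$ is any deformation of $i\mathbb{R}$ separating the four leftward from the four rightward singular half lines; under the genericity assumption such a contour exists, the integral converges absolutely and does not depend on the choice. Set $(a,b,c,d)=(1+\rho+\sigma,\,1-\rho+\sigma,\,1+\alpha+\rho-\beta-\sigma,\,1-\alpha-\rho-\beta-\sigma)$ and $$A(x)=\frac{(1-q^{a+x})(1-q^{b+x})(1-q^{c+x})(1-q^{d+x})}{(1-q^{2x})(1-q^{2+2x})},\qquad C(x)=-A(x)-A(-x),$$ $$B(x)=q^{-\beta}\frac{(1-q^{a+x})(1-q^{2-a+x})(1-q^{b+x})(1-q^{2-b+x})}{(1-q^{2x})(1-q^{2+2x})},$$ $$D(x)=q^{-\beta}\frac{(1-q^{c-x})(1-q^{2-c-x})(1-q^{d-x})(1-q^{2-d-x})}{(1-q^{-2x})(1-q^{2-2x})}.$$ *)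

theory Defs
  imports "HOL-Analysis.Analysis"
begin

text \<open>\<open>qpow \<tau> u\<close> is $q^u$ for $q = \exp(2\pi i\tau)$, with the branch fixed by \<open>\<tau>\<close>.\<close>

definition qpow :: "real \<Rightarrow> complex \<Rightarrow> complex" where
  "qpow \<tau> u = exp (2 * of_real pi * \<i> * of_real \<tau> * u)"

definition hyp_gamma_exponent :: "real \<Rightarrow> complex \<Rightarrow> complex" where
  "hyp_gamma_exponent \<tau> z =
     1 / (2 * \<i>) *
     (LBINT y:{0<..}. 1 / of_real y *
        (z / of_real y - sinh (of_real (\<tau> * y) * z) / of_real (sinh y * sinh (\<tau> * y))))"

text \<open>
  The hyperbolic gamma function, for \<open>\<tau> < 0\<close>. On the strip \<open>\<bar>Re z\<bar> < 1 - 1/\<tau>\<close> the number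
  \<open>n\<close> below is \<open>0\<close> and the value is \<open>exp (\<i> * hyp_gamma_exponent \<tau> z)\<close>. Elsewhere \<open>z\<close> is moved
  into the strip, whose width exceeds \<open>2\<close>, by the least number \<open>n\<close> of steps of length \<open>2\<close>, and
  the equation $G_\tau(z+2) = 2\cos(\pi(z+1)\tau/2)\,G_\tau(z)$ is iterated \<open>n\<close> times. The poles
  of the meromorphic extension are the zeros of the product in the denominator; the function
  has the value \<open>0\<close> there.
\<close>

definition hyp_gamma :: "real \<Rightarrow> complex \<Rightarrow> complex" where
  "hyp_gamma \<tau> z =
     (if 0 \<le> Re z then
        (let n = (LEAST n::nat. Re z - 2 * real n < 1 - 1 / \<tau>); w = z - 2 * of_nat n
         in exp (\<i> * hyp_gamma_exponent \<tau> w) *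
            (\<Prod>k<n. 2 * cos (of_real pi * (w + 2 * of_nat k + 1) * of_real \<tau> / 2)))
      else
        (let n = (LEAST n::nat. - (1 - 1 / \<tau>) < Re z + 2 * real n); w = z + 2 * of_nat n
         in exp (\<i> * hyp_gamma_exponent \<tau> w) /
            (\<Prod>k<n. 2 * cos (of_real pi * (z + 2 * of_nat k + 1) * of_real \<tau> / 2))))"

definition left_ray :: "complex \<Rightarrow> complex set" where
  "left_ray p = (\<lambda>t. p + of_real t) ` {..0}"

definition right_ray :: "complex \<Rightarrow> complex set" where
  "right_ray p = (\<lambda>t. p + of_real t) ` {0..}"

text \<open>Initial points of the singular half lines; the spectral parameter is called \<open>lam\<close>.\<close>

definition left_points ::
    "real \<Rightarrow> complex \<Rightarrow> complex \<Rightarrow> complex \<Rightarrow> complex \<Rightarrow> complex \<Rightarrow> complex \<Rightarrow> complex list" where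
  "left_points \<tau> \<alpha> \<rho> \<beta> \<sigma> lam x =
     [-1 - \<beta> - \<sigma> + \<i> * lam - x,
      -1 + \<beta> + \<sigma> + \<i> * lam - x,
      -1 + 1 / of_real \<tau> - \<rho> - \<i> * lam,
      -1 + \<rho> - \<i> * lam]"

definition right_points ::
    "real \<Rightarrow> complex \<Rightarrow> complex \<Rightarrow> complex \<Rightarrow> complex \<Rightarrow> complex \<Rightarrow> complex \<Rightarrow> complex list" where
  "right_points \<tau> \<alpha> \<rho> \<beta> \<sigma> lam x =
     [- \<sigma> - \<i> * lam - x,
      \<sigma> - \<i> * lam - x,
      - \<alpha> - \<rho> + \<i> * lam,
      - 1 / of_real \<tau> + \<alpha> + \<rho> + \<i> * lam]"

definition generic_params ::
    "real \<Rightarrow> complex \<Rightarrow> complex \<Rightarrow> complex \<Rightarrow> complex \<Rightarrow> complex \<Rightarrow> complex \<Rightarrow> bool" where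
  "generic_params \<tau> \<alpha> \<rho> \<beta> \<sigma> lam x \<longleftrightarrow>
     distinct (map Im (left_points \<tau> \<alpha> \<rho> \<beta> \<sigma> lam x @ right_points \<tau> \<alpha> \<rho> \<beta> \<sigma> lam x)) \<and>
     qpow \<tau> (2 * x) \<notin> {1, qpow \<tau> 2, qpow \<tau> (-2)}"

text \<open>
  A contour is given by a piecewise continuously differentiable parametrisation \<open>g\<close> over the
  real line. It meets every horizontal line exactly once and runs from $-i\infty$ to
  $i\infty$ iff \<open>Im \<circ> g\<close> is a strictly increasing bijection.
\<close>

definition deformation_of_imag_axis :: "(real \<Rightarrow> complex) \<Rightarrow> bool" where
  "deformation_of_imag_axis g \<longleftrightarrow>
     g piecewise_C1_differentiable_on UNIV \<and>
     strict_mono (Im \<circ> g) \<and> surj (Im \<circ> g) \<and>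
     (\<exists>M. \<forall>t. \<bar>Im (g t)\<bar> > M \<longrightarrow> g t = \<i> * of_real (Im (g t)))"

text \<open>The points of \<open>L\<close> lie to the left, and those of \<open>R\<close> to the right, of the contour.\<close>

definition separates :: "(real \<Rightarrow> complex) \<Rightarrow> complex set \<Rightarrow> complex set \<Rightarrow> bool" where
  "separates g L R \<longleftrightarrow>
     (\<forall>z\<in>L. \<forall>t. Im (g t) = Im z \<longrightarrow> Re z < Re (g t)) \<and>
     (\<forall>z\<in>R. \<forall>t. Im (g t) = Im z \<longrightarrow> Re (g t) < Re z)"

definition admissible_contour ::
    "real \<Rightarrow> complex \<Rightarrow> complex \<Rightarrow> complex \<Rightarrow> complex \<Rightarrow> complex \<Rightarrow> complex \<Rightarrow>
     (real \<Rightarrow> complex) \<Rightarrow> bool" where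
  "admissible_contour \<tau> \<alpha> \<rho> \<beta> \<sigma> lam x g \<longleftrightarrow>
     deformation_of_imag_axis g \<and>
     separates g (\<Union>p\<in>set (left_points \<tau> \<alpha> \<rho> \<beta> \<sigma> lam x). left_ray p)
                 (\<Union>p\<in>set (right_points \<tau> \<alpha> \<rho> \<beta> \<sigma> lam x). right_ray p)"

text \<open>
  The analogue of \<open>has_contour_integral\<close> for contours parametrised by the whole real line.
\<close>

definition has_line_integral ::
    "(complex \<Rightarrow> complex) \<Rightarrow> complex \<Rightarrow> (real \<Rightarrow> complex) \<Rightarrow> bool" where
  "has_line_integral f I g \<longleftrightarrow>
     ((\<lambda>t. f (g t) * vector_derivative g (at t)) has_integral I) UNIV"

definition psi_integrand ::
    "real \<Rightarrow> complex \<Rightarrow> complex \<Rightarrow> complex \<Rightarrow> complex \<Rightarrow> complex \<Rightarrow> complex \<Rightarrow> complex \<Rightarrow> complex"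
  where
  "psi_integrand \<tau> \<alpha> \<rho> \<beta> \<sigma> lam x z =
     (let G = hyp_gamma (2 * \<tau>); h = 1 / (2 * of_real \<tau>)
      in (G (h + \<beta> + \<sigma> - \<i> * lam + x + z) * G (h - 1 + \<sigma> - \<i> * lam - x - z)) /
         (G (- h + \<beta> + \<sigma> + \<i> * lam - x - z) * G (- h + 1 + \<sigma> + \<i> * lam + x + z)) *
         ((G (- h - 1 + \<alpha> + \<rho> + \<i> * lam - z) * G (- h + \<rho> + \<i> * lam + z)) /
          (G (- h + 1 + \<alpha> + \<rho> - \<i> * lam + z) * G (- h + \<rho> - \<i> * lam - z))))"

text \<open>
  The common value of the integral over all admissible contours.
\<close>

definition psi ::
    "real \<Rightarrow> complex \<Rightarrow> complex \<Rightarrow> complex \<Rightarrow> complex \<Rightarrow> complex \<Rightarrow> complex \<Rightarrow> complex" where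
  "psi \<tau> \<alpha> \<rho> \<beta> \<sigma> lam x =
     (THE I. \<forall>g. admissible_contour \<tau> \<alpha> \<rho> \<beta> \<sigma> lam x g \<longrightarrow>
        has_line_integral (psi_integrand \<tau> \<alpha> \<rho> \<beta> \<sigma> lam x) I g)"

definition coeff_A ::
    "real \<Rightarrow> complex \<Rightarrow> complex \<Rightarrow> complex \<Rightarrow> complex \<Rightarrow> complex \<Rightarrow> complex" where
  "coeff_A \<tau> \<alpha> \<rho> \<beta> \<sigma> x =
     (let q = qpow \<tau>; a = 1 + \<rho> + \<sigma>; b = 1 - \<rho> + \<sigma>;
          c = 1 + \<alpha> + \<rho> - \<beta> - \<sigma>; d = 1 - \<alpha> - \<rho> - \<beta> - \<sigma>
      in ((1 - q (a + x)) * (1 - q (b + x)) * (1 - q (c + x)) * (1 - q (d + x))) /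
         ((1 - q (2 * x)) * (1 - q (2 + 2 * x))))"

definition coeff_C ::
    "real \<Rightarrow> complex \<Rightarrow> complex \<Rightarrow> complex \<Rightarrow> complex \<Rightarrow> complex \<Rightarrow> complex" where
  "coeff_C \<tau> \<alpha> \<rho> \<beta> \<sigma> x = - coeff_A \<tau> \<alpha> \<rho> \<beta> \<sigma> x - coeff_A \<tau> \<alpha> \<rho> \<beta> \<sigma> (- x)"

definition coeff_B :: "real \<Rightarrow> complex \<Rightarrow> complex \<Rightarrow> complex \<Rightarrow> complex \<Rightarrow> complex" where
  "coeff_B \<tau> \<rho> \<beta> \<sigma> x =
     (let q = qpow \<tau>; a = 1 + \<rho> + \<sigma>; b = 1 - \<rho> + \<sigma>
      in q (- \<beta>) *
         ((1 - q (a + x)) * (1 - q (2 - a + x)) * (1 - q (b + x)) * (1 - q (2 - b + x))) /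
         ((1 - q (2 * x)) * (1 - q (2 + 2 * x))))"

definition coeff_D ::
    "real \<Rightarrow> complex \<Rightarrow> complex \<Rightarrow> complex \<Rightarrow> complex \<Rightarrow> complex \<Rightarrow> complex" where
  "coeff_D \<tau> \<alpha> \<rho> \<beta> \<sigma> x =
     (let q = qpow \<tau>; c = 1 + \<alpha> + \<rho> - \<beta> - \<sigma>; d = 1 - \<alpha> - \<rho> - \<beta> - \<sigma>
      in q (- \<beta>) *
         ((1 - q (c - x)) * (1 - q (2 - c - x)) * (1 - q (d - x)) * (1 - q (2 - d - x))) /
         ((1 - q (- 2 * x)) * (1 - q (2 - 2 * x))))"

definition eigenvalue :: "real \<Rightarrow> complex \<Rightarrow> complex \<Rightarrow> complex" where
  "eigenvalue \<tau> lam \<beta> =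
     - 1 - qpow \<tau> (2 - 2 * \<beta>) +
     qpow \<tau> (1 - \<beta>) * (qpow \<tau> (2 * \<i> * lam) + qpow \<tau> (- 2 * \<i> * lam))"

end

theory Submission
  imports Defs "HOL-Complex_Analysis.Complex_Analysis" "HOL-Real_Asymp.Real_Asymp"
    "HOL-Probability.Sinc_Integral"
begin

text \<open>
  Creative telescoping. Write $\Gamma(w) = G_{2\tau}(w - 1 + 1/(2\tau))$ (\<open>hgam\<close> below), so that
  $\Gamma(w+2) = -2\sin(\pi\tau w)\,\Gamma(w)$ and all poles of $\Gamma$ lie in
  $(-\infty, 0]$. By the reflection $G(-z) = 1/G(z)$ the integrand is
  $\prod_j \Gamma(z - l_j)\,\Gamma(r_j - z)$, where $l_j$, $r_j$ are the initial points of the singular half lines. Under $x \mapsto x \pm 2$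
  and $z \mapsto z + 2$ it is multiplied by products of sines, and the left hand side minus the
  right hand side of the difference equation, taken under the integral sign, equals
  $F(z+2) - F(z)$, where $F$ is a Laurent polynomial $k_1 q^z + k_0 + k_2 q^{-z}$ times a product of
  the same shape with some of the half lines moved by $2$. One contour can be chosen with a margin
  of $2$ on both sides, so that $F$ is holomorphic between it and its translate by $2$.

  The complement of the half lines is contractible, so holomorphic functions on it have primitives,
  and all contour integrals are differences of limits of a primitive at $\pm i\infty$. Exponential
  decay comes from the estimate of $\log|G(s+it)| - s\log|G(1+it)|$ for $|s| \le 1$ by its value at
  $t = 0$, in which $|G(1+it)|^2$ is known from the functional equation. The latter reduces to
  $\int_0^\infty (1/y - \cosh(ay)/\sinh(y))\,dy/y = \log(2\cos(\pi a/2))$, whose derivative in $a$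
  is a partial fraction expansion and whose constant is fixed by $y \mapsto 2y$ at $a = 0$.
\<close>

subsection \<open>Differentiation under the integral sign\<close>

text \<open>Two balances make the method work; put \<open>k = - 2 * \<tau>\<close>, a positive real.
  Growth: in a product of four left and four right factors the multiples of Re z in the exponent
  cancel, and the initial points enter only through the difference of their sums, which is
  \<open>4 + 4 / k\<close> whatever the parameters are. Such products decay like exp (- pi (k + 1)
  |Im z|), uniformly on vertical strips. Since |q^z| is exp (pi k Im z), a Laurent polynomial of
  degree one in q^z still leaves exp (- pi |Im z|): this is the room in which the certificate lives.
  Algebra: the integrands at x, x + 2, x - 2 and the products in F(z), F(z + 2) are all sine
  multiples of one product, with half lines starting at L1 + 2, L2 + 2, L3, L4 and R1 - 2, R2 - 2,
  R3, R4, so that the claim becomes a rational identity in q^z. Contours are only piecewise smooth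
  and otherwise arbitrary, so none is ever moved: if P is a primitive of F, then P(z + 2) - P(z) is
  a primitive of F(z + 2) - F(z) along one fixed contour, and it vanishes at both ends.\<close>

lemma has_field_derivative_lebesgue_integral:
  fixes f :: "complex \<Rightarrow> 'b \<Rightarrow> complex" and g :: "'b \<Rightarrow> real"
  assumes r: "r > 0"
    and hol: "\<And>y. (\<lambda>w. f w y) holomorphic_on ball z r"
    and meas: "\<And>w. w \<in> ball z r \<Longrightarrow> f w \<in> borel_measurable M"
    and bd: "\<And>w y. w \<in> ball z r \<Longrightarrow> norm (f w y) \<le> g y"
    and g: "integrable M g"
  shows "((\<lambda>w. \<integral>y. f w y \<partial>M) has_field_derivative (\<integral>y. deriv (\<lambda>w. f w y) z \<partial>M)) (at z)"
proof -
  have fint: "integrable M (f w)" if "w \<in> ball z r" for w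
    by (rule Bochner_Integration.integrable_bound[OF g meas[OF that]])
       (use bd[OF that] in \<open>auto intro!: AE_I2 intro: order_trans[OF _ abs_ge_self]\<close>)
  have lip: "norm (f (z + h) y - f z y) \<le> g y / (r/4) * norm h" if "norm h < r/2" for h y
  proof -
    have der: "((\<lambda>w. f w y) has_field_derivative deriv (\<lambda>w. f w y) w) (at w within ball z (r/2))"
      if "w \<in> ball z (r/2)" for w
      using that r by (intro holomorphic_derivI[OF hol[of y]]) auto
    have db: "norm (deriv (\<lambda>w. f w y) w) \<le> g y / (r/4)" if w: "w \<in> ball z (r/2)" for w
    proof -
      have sub: "cball w (r/4) \<subseteq> ball z r"
      proof
        fix u assume "u \<in> cball w (r/4)"
        then show "u \<in> ball z r"
          using w r dist_triangle[of z u w] by (auto simp: dist_commute)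
      qed
      \<comment> \<open>Cauchy's inequality on a circle of radius r/4 turns the majorant of f itself
        into the majorant 4 g / r of its derivative, hence of all difference quotients on the
        smaller ball.\<close>
      have "norm ((deriv ^^ 1) (\<lambda>w. f w y) w) \<le> fact 1 * g y / (r/4) ^ 1"
      proof (rule Cauchy_inequality)
        show "(\<lambda>w. f w y) holomorphic_on ball w (r/4)"
          using holomorphic_on_subset[OF hol[of y]] sub ball_subset_cball by blast
        show "continuous_on (cball w (r/4)) (\<lambda>w. f w y)"
          using continuous_on_subset[OF holomorphic_on_imp_continuous_on[OF hol[of y]]] sub by blast
        show "0 < r/4" using r by simp
        fix x assume "norm (w - x) = r/4"
        then have "x \<in> cball w (r/4)" by (simp add: dist_norm)
        then show "norm (f x y) \<le> g y" using bd sub by blast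
      qed
      then show ?thesis by simp
    qed
    show ?thesis
      using field_differentiable_bound[OF convex_ball der db, of "z + h" z] that r
      by (simp add: dist_norm)
  qed
  have "((\<lambda>h. ((\<integral>y. f (z + h) y \<partial>M) - (\<integral>y. f z y \<partial>M)) / h) \<longlongrightarrow> (\<integral>y. deriv (\<lambda>w. f w y) z \<partial>M)) (at 0)"
    unfolding tendsto_at_iff_sequentially
  proof (intro allI impI)
    fix X :: "nat \<Rightarrow> complex"
    assume X: "\<forall>i. X i \<in> UNIV - {0}" and X0: "X \<longlonglongrightarrow> 0"
    \<comment> \<open>The quotient bound holds only for increments below r/2, so an initial part of
      the sequence is dropped; \<open>LIMSEQ_offset\<close> restores it at the end.\<close>
    have "\<exists>N. \<forall>n\<ge>N. norm (X n - 0) < r/2"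
      using X0 r unfolding LIMSEQ_iff by (metis half_gt_zero)
    then obtain N where N: "\<And>n. n \<ge> N \<Longrightarrow> norm (X n) < r/2" by auto
    define Y where "Y n = X (n + N)" for n
    have Y: "Y n \<noteq> 0" "norm (Y n) < r/2" for n using X N by (auto simp: Y_def)
    have Y0: "Y \<longlonglongrightarrow> 0" unfolding Y_def using X0 by (rule LIMSEQ_ignore_initial_segment)
    have inb: "z + Y n \<in> ball z r" "z \<in> ball z r" for n using Y(2)[of n] r by (auto simp: dist_norm)
    have lim: "(\<lambda>n. (f (z + Y n) y - f z y) / Y n) \<longlonglongrightarrow> deriv (\<lambda>w. f w y) z" for y
    proof -
      have "((\<lambda>w. f w y) has_field_derivative deriv (\<lambda>w. f w y) z) (at z)"
        using r by (intro holomorphic_derivI[OF hol[of y]]) auto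
      then have "((\<lambda>h. (f (z + h) y - f z y) / h) \<longlongrightarrow> deriv (\<lambda>w. f w y) z) (at 0)"
        by (simp add: DERIV_def)
      then show ?thesis
        using Y(1) Y0 unfolding tendsto_at_iff_sequentially by (auto simp: o_def)
    qed
    have m: "(\<lambda>y. (f (z + Y n) y - f z y) / Y n) \<in> borel_measurable M" for n
      using meas[OF inb(1)[of n]] meas[OF inb(2)] by measurable
    have "(\<lambda>n. \<integral>y. (f (z + Y n) y - f z y) / Y n \<partial>M) \<longlonglongrightarrow> (\<integral>y. deriv (\<lambda>w. f w y) z \<partial>M)"
    proof (rule integral_dominated_convergence[where w = "\<lambda>y. g y / (r/4)"])
      show "(\<lambda>y. deriv (\<lambda>w. f w y) z) \<in> borel_measurable M"
        by (rule borel_measurable_LIMSEQ_metric[OF m lim])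
      show "integrable M (\<lambda>y. g y / (r/4))" using g by simp
      show "AE x in M. norm ((f (z + Y n) x - f z x) / Y n) \<le> g x / (r/4)" for n
        using lip[OF Y(2)[of n]] Y(1)[of n] by (intro AE_I2) (simp add: norm_divide field_simps)
    qed (use lim m in auto)
    moreover have "(\<integral>y. (f (z + Y n) y - f z y) / Y n \<partial>M) = ((\<integral>y. f (z + Y n) y \<partial>M)
        - (\<integral>y. f z y \<partial>M)) / Y n" for n
      using fint[OF inb(1)[of n]] fint[OF inb(2)] by simp
    ultimately have "(\<lambda>n. ((\<integral>y. f (z + Y n) y \<partial>M) - (\<integral>y. f z y \<partial>M)) / Y n) \<longlonglongrightarrow> (\<integral>y. deriv (\<lambda>w. f w y) z \<partial>M)"
      by (simp only:)
    then show "((\<lambda>h. ((\<integral>y. f (z + h) y \<partial>M) - (\<integral>y. f z y \<partial>M)) / h) \<circ> X) \<longlonglongrightarrow> (\<integral>y. deriv (\<lambda>w. f w y) z \<partial>M)"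
      unfolding Y_def o_def by (rule LIMSEQ_offset)
  qed
  then show ?thesis by (simp add: DERIV_def)
qed

subsection \<open>The integral for the logarithm of the hyperbolic gamma function\<close>

lemma norm_sinh_minus_le: "norm (sinh w - w) \<le> norm w ^ 3 * exp \<bar>Re w\<bar> / 2" for w :: complex
proof -
  define e where "e v = exp v - (\<Sum>k\<le>2. v ^ k / (fact k))" for v :: complex
  have e: "norm (e v) \<le> exp \<bar>Re v\<bar> * norm v ^ 3 / 2" for v
    using Taylor_exp[of v 2] by (simp add: e_def eval_nat_numeral)
  \<comment> \<open>The constant and quadratic Taylor terms of exp w and exp (-w) cancel; only the
    two cubic remainders survive.\<close>
  have "sinh w - w = (e w - e (-w)) / 2"
    by (simp add: e_def sinh_field_def eval_nat_numeral field_simps)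
  also have "norm \<dots> \<le> (norm (e w) + norm (e (-w))) / 2"
    using norm_triangle_ineq4[of "e w" "e (-w)"] by (simp add: norm_divide)
  also have "\<dots> \<le> norm w ^ 3 * exp \<bar>Re w\<bar> / 2" using e[of w] e[of "-w"] by (simp add: mult.commute)
  finally show ?thesis .
qed

lemma norm_sinh_le: "norm (sinh w) \<le> exp \<bar>Re w\<bar>" for w :: complex
proof -
  have "norm (exp w - exp (-w)) \<le> exp (Re w) + exp (- Re w)"
    using norm_triangle_ineq4[of "exp w" "exp (-w)"] by simp
  also have "\<dots> \<le> exp \<bar>Re w\<bar> + exp \<bar>Re w\<bar>" by (intro add_mono) auto
  finally show ?thesis by (simp add: sinh_field_def norm_divide)
qed

lemma sinh_ge_self:
  fixes y :: real assumes "y \<ge> 0" shows "sinh y \<ge> y"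
proof -
  have "sinh 0 - 0 \<le> sinh y - y"
    using assms
    by (rule DERIV_nonneg_imp_nondecreasing)
       (auto intro!: exI derivative_eq_intros simp: cosh_real_ge_1)
  then show ?thesis by simp
qed

lemma sinh_minus_self_le:
  fixes y :: real assumes "y \<ge> 0" shows "sinh y - y \<le> y ^ 3 * exp y / 2"
proof -
  have "norm (sinh (of_real y) - of_real y :: complex)
      \<le> norm (of_real y :: complex) ^ 3 * exp \<bar>Re (of_real y)\<bar> / 2"
    by (rule norm_sinh_minus_le)
  moreover have "sinh (of_real y) - of_real y = (of_real (sinh y - y) :: complex)"
    by (simp add: sinh_field_def exp_of_real flip: of_real_minus)
  ultimately show ?thesis using assms sinh_ge_self[OF assms] by (simp only: norm_of_real) auto
qed

lemma sinh_ge_exp: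
  fixes y c :: real assumes "y \<ge> c" shows "sinh y \<ge> exp y * ((1 - exp (-2*c)) / 2)"
proof -
  have "exp (-y) = exp y * exp (-2*y)" by (simp flip: exp_add)
  moreover have "exp (-2*y) \<le> exp (-2*c)" using assms by simp
  ultimately have "exp (-y) \<le> exp y * exp (-2*c)" by (simp only: mult_left_mono exp_ge_zero)
  then show ?thesis by (simp add: sinh_field_def field_simps)
qed

text \<open>Trades exponential decay for \<open>1 / (1 + y\<^sup>2)\<close>, which is also harmless
  near 0, so that one integrable function dominates the density on the whole half line.\<close>

lemma exp_neg_le_inverse_square:
  fixes d y :: real assumes "d > 0" "y \<ge> 0"
  shows "exp (- d * y) \<le> (1 / min 1 (d\<^sup>2 / 2)) / (1 + y\<^sup>2)"
proof -
  have "min 1 (d\<^sup>2/2) * (1 + y\<^sup>2) \<le> 1 + d\<^sup>2/2 * y\<^sup>2"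
    unfolding distrib_left by (intro add_mono mult_right_mono) auto
  also have "\<dots> \<le> 1 + d * y + (d * y)\<^sup>2 / 2"
    using assms by (simp add: power_mult_distrib)
  also have "\<dots> \<le> exp (d * y)" using assms by (intro exp_lower_Taylor_quadratic) auto
  finally have "min 1 (d\<^sup>2/2) * (1 + y\<^sup>2) \<le> exp (d*y)" .
  moreover have "min 1 (d\<^sup>2/2) * (1 + y\<^sup>2) > 0"
    using assms by (intro mult_pos_pos add_pos_nonneg) auto
  ultimately have "1 / exp (d*y) \<le> 1 / (min 1 (d\<^sup>2/2) * (1 + y\<^sup>2))"
    by (intro divide_left_mono) auto
  moreover have "exp (- d * y) = 1 / exp (d * y)" by (simp add: exp_minus inverse_eq_divide)
  ultimately show ?thesis by (simp only: divide_divide_eq_left)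
qed

text \<open>Integrand of \<open>hyp_gamma_exponent (- k)\<close> without the prefactor: the two
  hyperbolic sines containing k are both odd in it, so their quotient does not see the sign and a
  positive k can be used.\<close>

definition gamma_density :: "real \<Rightarrow> complex \<Rightarrow> real \<Rightarrow> complex" where
  "gamma_density k z y =
     (z / of_real y - sinh (of_real (k * y) * z) / of_real (sinh y * sinh (k * y))) / of_real y"

text \<open>Uniformity in z on bounded parts of a closed substrip is what differentiation under the
  integral needs. At 0 the poles cancel; at infinity the quotient decays because
  \<open>k * s0 < 1 + k\<close>.\<close>

lemma gamma_density_bound:
  assumes k: "k > 0" and s0: "s0 < 1 + 1 / k"
  obtains M where "\<And>z y. \<bar>Re z\<bar> \<le> s0 \<Longrightarrow> norm z \<le> R \<Longrightarrow> y > 0 \<Longrightarrow>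
    norm (gamma_density k z y) \<le> M * (1 / (1 + y\<^sup>2))"
proof -
  \<comment> \<open>\<open>M1\<close> bounds the density for y \<le> 1. For y \<ge> 1,
    \<open>C\<close> comes from the lower bounds of the two hyperbolic sines in the denominator and
    \<open>d\<close> is the exponential rate left over.\<close>
  define M1 where "M1 = \<bar>R\<bar> * exp 1 / 2 + k\<^sup>2 * (\<bar>R\<bar> * exp k + \<bar>R\<bar> ^ 3 * exp (k * \<bar>R\<bar>)) / 2"
  define C where "C = ((1 - exp (-2)) / 2) * ((1 - exp (-2*k)) / 2)"
  define d where "d = 1 + k - k * s0"
  have C: "C > 0" unfolding C_def using k by (intro mult_pos_pos) auto
  have "k * s0 < k * (1 + 1/k)" by (rule mult_strict_left_mono) (use k s0 in auto)
  also have "k * (1 + 1/k) = k + 1" using k by (simp add: field_simps)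
  finally have d: "d > 0" by (simp add: d_def)
  define M2 where "M2 = 2 * \<bar>R\<bar> + 1 / C * (1 / min 1 (d\<^sup>2/2))"
  have M1: "M1 \<ge> 0" unfolding M1_def using k by (intro add_nonneg_nonneg) auto
  have M2: "M2 \<ge> 0" unfolding M2_def using C d by (intro add_nonneg_nonneg) auto
  have "norm (gamma_density k z y) \<le> (2 * M1 + M2) * (1 / (1 + y\<^sup>2))"
    if z: "\<bar>Re z\<bar> \<le> s0" "norm z \<le> R" and y: "y > 0" for z y
  proof (cases "y \<le> 1")
    case True
    define c where "c = k * y"
    have c: "c > 0" "c \<le> k" using k y True by (auto simp: c_def mult_left_le)
    have sy: "sinh y \<ge> y" "sinh c \<ge> c" using sinh_ge_self y c by auto
    then have sp: "sinh y > 0" "sinh c > 0" using y c by auto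
    have R: "R \<ge> 0" using z(2) norm_ge_zero[of z] by linarith
    \<comment> \<open>The numerator over the common denominator, regrouped so that each summand
      contains cubic remainders of hyperbolic sines. It is of order four in y, like the
      denominator.\<close>
    let ?N = "z * of_real ((sinh y - y) * sinh c) + of_real y * (z * of_real (sinh c - c)
        - (sinh (of_real c * z) - of_real c * z))"
    have eq: "gamma_density k z y = ?N / of_real (y * y * sinh y * sinh c)"
      using y sp unfolding gamma_density_def c_def[symmetric] by (simp add: field_simps)
    have n1: "norm (z * of_real ((sinh y - y) * sinh c)) \<le> R * (y ^ 3 * exp 1 / 2 * sinh c)"
    proof -
      have "sinh y - y \<le> y ^ 3 * exp y / 2" using sinh_minus_self_le y by auto
      also have "\<dots> \<le> y ^ 3 * exp 1 / 2" using True y by (intro divide_right_mono mult_left_mono) auto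
      finally have "(sinh y - y) * sinh c \<le> y ^ 3 * exp 1 / 2 * sinh c" using sp
          by (intro mult_right_mono) auto
      moreover have "(sinh y - y) * sinh c \<ge> 0" using sp sy by simp
      ultimately show ?thesis unfolding norm_mult norm_of_real using z R by (intro mult_mono) auto
    qed
    have n2: "norm (z * of_real (sinh c - c)) \<le> R * (c ^ 3 * exp k / 2)"
    proof -
      have "sinh c - c \<le> c ^ 3 * exp c / 2" using sinh_minus_self_le c by auto
      also have "\<dots> \<le> c ^ 3 * exp k / 2" using c by (intro divide_right_mono mult_left_mono) auto
      finally show ?thesis unfolding norm_mult norm_of_real using z R sy by (intro mult_mono) auto
    qed
    have n3: "norm (sinh (of_real c * z) - of_real c * z) \<le> c ^ 3 * (R ^ 3 * exp (k * R) / 2)"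
    proof -
      have cz: "norm (of_real c * z) \<le> c * R" using z c by (simp add: norm_mult mult_left_mono)
      have "\<bar>Re (of_real c * z)\<bar> \<le> k * R"
        using abs_Re_le_cmod[of "of_real c * z"] cz mult_right_mono[OF c(2) R] by linarith
      then have "norm (of_real c * z) ^ 3 * exp \<bar>Re (of_real c * z)\<bar> / 2 \<le> (c * R) ^ 3 * exp (k * R) / 2"
        using cz c R by (intro divide_right_mono mult_mono power_mono) auto
      then show ?thesis using norm_sinh_minus_le[of "of_real c * z"]
          by (simp add: power_mult_distrib mult.assoc)
    qed
    have n4: "norm ?N \<le> R * (y ^ 3 * exp 1 / 2 * sinh c) + y * (R * (c ^ 3 * exp k / 2)
        + c ^ 3 * (R ^ 3 * exp (k * R) / 2))"
      by (rule order_trans[OF norm_triangle_ineq add_mono[OF n1]])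
         (use order_trans[OF norm_triangle_ineq4 add_mono[OF n2 n3]] y in \<open>simp add: norm_mult
             mult_left_mono\<close>)
    have "norm (gamma_density k z y) \<le> (R * (y ^ 3 * exp 1 / 2 * sinh c)) / (y * y * sinh y * sinh c)
        + (y * (R * (c ^ 3 * exp k / 2) + c ^ 3 * (R ^ 3 * exp (k * R) / 2))) / (y * y * sinh y * sinh c)"
      unfolding eq norm_divide norm_of_real add_divide_distrib[symmetric]
      using n4 y sp by (simp add: divide_right_mono abs_mult)
    \<comment> \<open>In the denominators \<open>sinh y\<close> is lowered to y in both terms, but
      \<open>sinh c\<close> to c only in the second: in the first it cancels against the
      numerator.\<close>
    also have "\<dots> \<le> (R * (y ^ 3 * exp 1 / 2 * sinh c)) / (y * y * y * sinh c)
        + (y * (R * (c ^ 3 * exp k / 2) + c ^ 3 * (R ^ 3 * exp (k * R) / 2))) / (y * y * y * c)"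
      using y sp sy R c
      by (intro add_mono divide_left_mono mult_mono mult_nonneg_nonneg mult_pos_pos
          add_nonneg_nonneg) auto
    also have "\<dots> = M1"
      using y c sp R k unfolding M1_def c_def by (simp add: field_simps power3_eq_cube power2_eq_square)
    finally have *: "norm (gamma_density k z y) \<le> M1" .
    have "1 \<le> 2 * (1 / (1 + y\<^sup>2))"
      using power_le_one[of y 2] True y by (simp add: le_divide_eq add_pos_nonneg)
    then have "M1 * 1 \<le> M1 * (2 * (1 / (1 + y\<^sup>2)))" using M1 by (intro mult_left_mono)
    also have "\<dots> \<le> (2 * M1 + M2) * (1 / (1 + y\<^sup>2))"
      using M2 by (simp add: divide_right_mono)
    finally show ?thesis using * by simp
  next
    case False
    then have y1: "y \<ge> 1" by simp
    define c where "c = k * y"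
    have c: "c \<ge> k" "c > 0" using k y1 by (auto simp: c_def)
    have s1: "sinh y \<ge> exp y * ((1 - exp (-2)) / 2)" using sinh_ge_exp[OF y1] by simp
    have s2: "sinh c \<ge> exp c * ((1 - exp (-2*k)) / 2)" using sinh_ge_exp[OF c(1)] by simp
    have pr: "sinh y * sinh c \<ge> exp (y + c) * C"
    proof -
      have "exp (y + c) * C = (exp y * ((1 - exp (-2)) / 2)) * (exp c * ((1 - exp (-2*k)) / 2))"
        by (simp add: C_def exp_add mult_ac)
      also have "\<dots> \<le> sinh y * sinh c" using s1 s2 k y
          by (intro mult_mono) (auto intro!: mult_nonneg_nonneg)
      finally show ?thesis .
    qed
    have "norm (sinh (of_real c * z)) \<le> exp (c * s0)"
    proof -
      have "\<bar>Re (of_real c * z)\<bar> \<le> c * s0" using z(1) c by (simp add: abs_mult)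
      then show ?thesis using norm_sinh_le[of "of_real c * z"] by (meson exp_le_cancel_iff order_trans)
    qed
    then have "norm (sinh (of_real c * z) / of_real (sinh y * sinh c)) \<le> exp (c * s0) / (exp (y + c) * C)"
      unfolding norm_divide norm_of_real using pr C by (intro frac_le) (auto intro: order_trans[OF pr])
    also have "\<dots> = 1 / C * exp (- d * y)"
      using C by (simp add: d_def c_def algebra_simps exp_diff exp_add exp_minus divide_simps)
    also have "\<dots> \<le> 1 / C * ((1 / min 1 (d\<^sup>2 / 2)) / (1 + y\<^sup>2))"
      using C d y by (intro mult_left_mono exp_neg_le_inverse_square) auto
    finally have b2: "norm (sinh (of_real c * z) / of_real (sinh y * sinh c))
        \<le> 1 / C * ((1 / min 1 (d\<^sup>2 / 2)) / (1 + y\<^sup>2))" .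
    have "norm z / y / y \<le> 2 * \<bar>R\<bar> / (1 + y\<^sup>2)"
    proof -
      have "norm z / y / y = norm z / y\<^sup>2" by (simp add: power2_eq_square)
      also have "\<dots> \<le> \<bar>R\<bar> / y\<^sup>2" using z by (intro divide_right_mono) auto
      also have "\<dots> = 2 * \<bar>R\<bar> / (y\<^sup>2 + y\<^sup>2)" by simp
      also have "\<dots> \<le> 2 * \<bar>R\<bar> / (1 + y\<^sup>2)"
        using y1 by (intro divide_left_mono add_mono mult_pos_pos add_pos_nonneg) (auto simp:
            power2_eq_square mult_ge1_I)
      finally show ?thesis .
    qed
    moreover have "norm (gamma_density k z y) \<le> norm z / y / y
        + norm (sinh (of_real c * z) / of_real (sinh y * sinh c))"
    proof -
      have "norm (gamma_density k z y) \<le> (norm z / y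
          + norm (sinh (of_real c * z) / of_real (sinh y * sinh c))) / y"
        unfolding gamma_density_def c_def[symmetric] norm_divide[of _ "of_real y"]
        using norm_triangle_ineq4[of "z / of_real y" "sinh (of_real c * z) / of_real (sinh y * sinh c)"] y
        by (intro frac_le) (auto simp: norm_divide)
      also have "\<dots> \<le> norm z / y / y + norm (sinh (of_real c * z) / of_real (sinh y * sinh c)) / 1"
        unfolding add_divide_distrib using y1 by (intro add_mono divide_left_mono) auto
      finally show ?thesis by simp
    qed
    ultimately have "norm (gamma_density k z y) \<le> 2 * \<bar>R\<bar> / (1 + y\<^sup>2)
        + 1 / C * ((1 / min 1 (d\<^sup>2 / 2)) / (1 + y\<^sup>2))"
      using b2 by linarith
    also have "\<dots> = M2 * (1 / (1 + y\<^sup>2))" by (simp add: M2_def add_divide_distrib)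
    also have "\<dots> \<le> (2 * M1 + M2) * (1 / (1 + y\<^sup>2))"
      using M1 by (intro mult_right_mono) auto
    finally show ?thesis .
  qed
  then show ?thesis by (rule that)
qed

lemma integrable_inverse_one_plus_square: "set_integrable lborel {0<..} (\<lambda>y::real. 1 / (1 + y\<^sup>2))"
proof -
  have "set_integrable lborel (einterval 0 \<infinity>) (\<lambda>y::real. inverse (1 + y\<^sup>2))"
  proof (rule interval_integral_FTC_nonneg)
    show "DERIV arctan x :> inverse (1 + x\<^sup>2)" for x by (rule DERIV_arctan)
    show "((arctan \<circ> real_of_ereal) \<longlongrightarrow> 0) (at_right 0)"
      unfolding zero_ereal_def ereal_tendsto_simps using isCont_arctan[of 0]
      by (metis arctan_zero_zero continuous_within_subset continuous_within subset_UNIV)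
    show "((arctan \<circ> real_of_ereal) \<longlongrightarrow> pi/2) (at_left \<infinity>)"
      unfolding ereal_tendsto_simps by (rule tendsto_arctan_at_top)
  qed (auto intro!: continuous_intros simp: add_nonneg_eq_0_iff)
  then show ?thesis by (simp add: einterval_def zero_ereal_def inverse_eq_divide greaterThan_def)
qed

lemma sinh_complex_of_real: "sinh (complex_of_real y) = of_real (sinh y)"
  and cosh_complex_of_real: "cosh (complex_of_real y) = of_real (cosh y)"
  by (simp_all add: sinh_field_def cosh_field_def exp_of_real flip: of_real_minus)

lemma gamma_density_measurable [measurable]: "gamma_density k z \<in> borel_measurable borel"
  unfolding gamma_density_def sinh_field_def by measurable

lemma gamma_density_set_integrable:
  assumes k: "k > 0" and z: "\<bar>Re z\<bar> < 1 + 1 / k"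
  shows "set_integrable lborel {0<..} (gamma_density k z)"
proof -
  obtain M where M: "\<And>w y. \<bar>Re w\<bar> \<le> \<bar>Re z\<bar> \<Longrightarrow> norm w \<le> norm z \<Longrightarrow> y > 0 \<Longrightarrow>
    norm (gamma_density k w y) \<le> M * (1 / (1 + y\<^sup>2))"
    using gamma_density_bound[OF k z, of "norm z"] by blast
  have "set_integrable lborel {0<..} (\<lambda>y::real. M * (1 / (1 + y\<^sup>2)))"
    using integrable_inverse_one_plus_square by (rule set_integrable_mult_right)
  then show ?thesis
    by (rule set_integrable_bound)
       (use M[of z] in \<open>auto intro!: AE_I2 simp: set_borel_measurable_def
          intro!: order_trans[OF _ divide_right_mono[OF abs_ge_self[of M]]] add_nonneg_nonneg\<close>)
qed

text \<open>The factor 1/2 is \<open>\<i> / (2 * \<i>)\<close>: on the strip this is a branch of the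
  logarithm of G.\<close>

definition log_hyp_gamma :: "real \<Rightarrow> complex \<Rightarrow> complex" where
  "log_hyp_gamma k z = (LBINT y:{0<..}. gamma_density k z y) / 2"

lemma holomorphic_gamma_density:
  assumes "k > 0"
  shows "(\<lambda>w. indicat_real {0<..} y *\<^sub>R gamma_density k w y) holomorphic_on A"
proof (cases "y > 0")
  case True
  then show ?thesis using assms unfolding gamma_density_def sinh_field_def
    by (auto intro!: holomorphic_intros)
qed simp

lemma log_hyp_gamma_holomorphic:
  assumes k: "k > 0"
  shows "log_hyp_gamma k holomorphic_on {z. \<bar>Re z\<bar> < 1 + 1 / k}"
proof -
  have "log_hyp_gamma k field_differentiable (at z)" if z: "\<bar>Re z\<bar> < 1 + 1 / k" for z
  proof -
    define r where "r = (1 + 1/k - \<bar>Re z\<bar>) / 2"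
    have r: "r > 0" and s: "\<bar>Re z\<bar> + r < 1 + 1/k" using z by (auto simp: r_def field_simps)
    obtain M where M: "\<And>w y. \<bar>Re w\<bar> \<le> \<bar>Re z\<bar> + r \<Longrightarrow> norm w \<le> norm z + r \<Longrightarrow> y > 0 \<Longrightarrow>
      norm (gamma_density k w y) \<le> M * (1 / (1 + y\<^sup>2))"
      using gamma_density_bound[OF k s, of "norm z + r"] by blast
    let ?f = "\<lambda>w y. indicat_real {0<..} y *\<^sub>R gamma_density k w y"
    let ?g = "\<lambda>y::real. indicat_real {0<..} y *\<^sub>R (M * (1 / (1 + y\<^sup>2)))"
    have "((\<lambda>w. \<integral>y. ?f w y \<partial>lborel) has_field_derivative (\<integral>y. deriv (\<lambda>w. ?f w y) z \<partial>lborel)) (at z)"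
    proof (rule has_field_derivative_lebesgue_integral[where g = ?g])
      show "integrable lborel ?g"
        using set_integrable_mult_right[of M, OF integrable_inverse_one_plus_square]
            unfolding set_integrable_def by simp
      fix w y assume w: "w \<in> ball z r"
      have "\<bar>Re w\<bar> \<le> \<bar>Re z\<bar> + r" "norm w \<le> norm z + r"
        using w abs_Re_le_cmod[of "w - z"] norm_triangle_sub[of w z]
            by (auto simp: dist_norm norm_minus_commute)
      then show "norm (?f w y) \<le> ?g y" using M by (auto simp: indicator_def)
    qed (use r holomorphic_gamma_density[OF k] in auto)
    then show ?thesis
      unfolding log_hyp_gamma_def [abs_def] set_lebesgue_integral_def field_differentiable_def
      by (intro exI) (rule DERIV_cdivide)
  qed
  then show ?thesis by (auto simp: holomorphic_on_def intro: field_differentiable_at_within)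
qed

text \<open>The density is odd in z; exponentiated, this is the reflection formula on the
  strip.\<close>

lemma log_hyp_gamma_minus: "log_hyp_gamma k (- z) = - log_hyp_gamma k z"
proof -
  have "gamma_density k (- z) = (\<lambda>y. - gamma_density k z y)"
    by (simp add: gamma_density_def fun_eq_iff diff_divide_distrib)
  then show ?thesis by (simp add: log_hyp_gamma_def set_lebesgue_integral_def)
qed

subsection \<open>The functional equation on the strip\<close>

definition cosh_density :: "complex \<Rightarrow> real \<Rightarrow> complex" where
  "cosh_density a y = (1 / of_real y - cosh (of_real y * a) / of_real (sinh y)) / of_real y"

text \<open>The addition theorem produces a factor \<open>sinh (k * y)\<close> that cancels the one
  in the denominator, so k enters only through the product k z. One function of a complex variable
  then settles the functional equation for all k.\<close>

lemma gamma_density_diff: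
  assumes "k > 0" "y > 0"
  shows "gamma_density k (z + 1) y - gamma_density k (z - 1) y = 2 * cosh_density (of_real k * z) y"
proof -
  have "sinh (of_real (k*y) * (z + 1)) - sinh (of_real (k*y) * (z - 1))
      = 2 * cosh (of_real y * (of_real k * z)) * of_real (sinh (k * y))"
    unfolding distrib_left right_diff_distrib sinh_add sinh_diff mult_1_right sinh_complex_of_real
        cosh_complex_of_real
    by (simp add: mult_ac)
  moreover have "sinh y \<noteq> 0" "sinh (k * y) \<noteq> 0" using assms by auto
  ultimately show ?thesis using assms unfolding gamma_density_def cosh_density_def
    by (simp add: divide_simps) algebra
qed

text \<open>The case k = 1 carries the estimates of \<open>gamma_density\<close> over to
  \<open>cosh_density\<close>.\<close>

lemma cosh_density_eq:
  assumes "y > 0"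
  shows "cosh_density a y = (gamma_density 1 (a + 1) y - gamma_density 1 (a - 1) y) / 2"
  using gamma_density_diff[of 1 y a] assms by simp

definition cosh_integral :: "complex \<Rightarrow> complex" where
  "cosh_integral a = (LBINT y:{0<..}. cosh_density a y)"

lemma cosh_integral_eq:
  assumes k: "k > 0" and a: "\<bar>Re a\<bar> < 1"
  shows "cosh_integral a = log_hyp_gamma k (a / of_real k + 1) - log_hyp_gamma k (a / of_real k - 1)"
proof -
  have "\<bar>Re (a / of_real k)\<bar> < 1 / k" using k a by (simp add: divide_simps abs_mult)
  then have "\<bar>Re (a / of_real k + 1)\<bar> < 1 + 1 / k" "\<bar>Re (a / of_real k - 1)\<bar> < 1 + 1 / k"
    unfolding plus_complex.simps minus_complex.simps one_complex.simps by linarith+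
  then have int: "set_integrable lborel {0<..} (gamma_density k (a / of_real k + 1))"
    "set_integrable lborel {0<..} (gamma_density k (a / of_real k - 1))"
    by (simp_all only: gamma_density_set_integrable k)
  have "cosh_integral a = (LBINT y:{0<..}. (gamma_density k (a / of_real k + 1) y
      - gamma_density k (a / of_real k - 1) y) / 2)"
    unfolding cosh_integral_def using gamma_density_diff[OF k, of _ "a / of_real k"] k
    by (intro set_lebesgue_integral_cong) auto
  also have "\<dots> = log_hyp_gamma k (a / of_real k + 1) - log_hyp_gamma k (a / of_real k - 1)"
    by (subst set_integral_divide_zero) (simp only: set_integral_diff(2)[OF int] log_hyp_gamma_def
        diff_divide_distrib)
  finally show ?thesis .
qed

lemma cosh_density_bound:
  assumes s0: "s0 < 1"
  obtains M where "\<And>a y. \<bar>Re a\<bar> \<le> s0 \<Longrightarrow> norm a \<le> R \<Longrightarrow> y > 0 \<Longrightarrow>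
    norm (cosh_density a y) \<le> M * (1 / (1 + y\<^sup>2))"
proof -
  obtain M where M: "\<And>z y. \<bar>Re z\<bar> \<le> s0 + 1 \<Longrightarrow> norm z \<le> R + 1 \<Longrightarrow> y > 0 \<Longrightarrow>
    norm (gamma_density 1 z y) \<le> M * (1 / (1 + y\<^sup>2))"
    using gamma_density_bound[of 1 "s0 + 1" "R + 1"] s0 by auto
  have "norm (cosh_density a y) \<le> M * (1 / (1 + y\<^sup>2))" if a: "\<bar>Re a\<bar> \<le> s0" "norm a \<le> R" "y > 0" for a y
  proof -
    have "norm (a + 1) \<le> R + 1" "norm (a - 1) \<le> R + 1"
      using norm_triangle_ineq[of a 1] norm_triangle_ineq4[of a 1] a by auto
    then have "norm (gamma_density 1 (a + 1) y) \<le> M * (1 / (1 + y\<^sup>2))" "norm (gamma_density 1 (a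
        - 1) y) \<le> M * (1 / (1 + y\<^sup>2))"
      using a by (intro M; simp)+
    then show ?thesis
      unfolding cosh_density_eq[OF \<open>y > 0\<close>]
      using norm_triangle_ineq4[of "gamma_density 1 (a + 1) y" "gamma_density 1 (a - 1) y"]
      unfolding norm_divide by (simp only: norm_numeral)
  qed
  then show ?thesis by (rule that)
qed

lemma cosh_density_measurable [measurable]: "cosh_density a \<in> borel_measurable borel"
  unfolding cosh_density_def cosh_field_def sinh_field_def by measurable

text \<open>Differentiation in a removes the singular term and the outer factor 1/y, leaving an
  integrand without cancellation at 0.\<close>

lemma cosh_integral_has_field_derivative:
  assumes a: "\<bar>Re a\<bar> < 1"
  shows "(cosh_integral has_field_derivative - (LBINT y:{0<..}. sinh (of_real y * a) / of_real (sinh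
      y))) (at a)"
proof -
  define r where "r = (1 - \<bar>Re a\<bar>) / 2"
  have r: "r > 0" and s: "\<bar>Re a\<bar> + r < 1" using a by (auto simp: r_def field_simps)
  obtain M where M: "\<And>w y. \<bar>Re w\<bar> \<le> \<bar>Re a\<bar> + r \<Longrightarrow> norm w \<le> norm a + r \<Longrightarrow> y > 0 \<Longrightarrow>
    norm (cosh_density w y) \<le> M * (1 / (1 + y\<^sup>2))"
    using cosh_density_bound[OF s, of "norm a + r"] by blast
  let ?f = "\<lambda>w y. indicat_real {0<..} y *\<^sub>R cosh_density w y"
  let ?g = "\<lambda>y::real. indicat_real {0<..} y *\<^sub>R (M * (1 / (1 + y\<^sup>2)))"
  have der: "((\<lambda>w. ?f w y) has_field_derivative - (indicat_real {0<..} y *\<^sub>R (sinh (of_real y * w) /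
      of_real (sinh y)))) (at w)" for w y
  proof (cases "y > 0")
    case True
    then show ?thesis unfolding cosh_density_def by (auto intro!: derivative_eq_intros simp: field_simps)
  qed simp
  have "((\<lambda>w. \<integral>y. ?f w y \<partial>lborel) has_field_derivative (\<integral>y. deriv (\<lambda>w. ?f w y) a \<partial>lborel)) (at a)"
  proof (rule has_field_derivative_lebesgue_integral[where g = ?g])
    show "integrable lborel ?g"
      using set_integrable_mult_right[of M, OF integrable_inverse_one_plus_square]
          unfolding set_integrable_def by simp
    show "(\<lambda>w. ?f w y) holomorphic_on ball a r" for y
      using der by (auto simp: holomorphic_on_def field_differentiable_def intro:
          has_field_derivative_at_within)
    fix w y assume w: "w \<in> ball a r"
    have "\<bar>Re w\<bar> \<le> \<bar>Re a\<bar> + r" "norm w \<le> norm a + r"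
      using w abs_Re_le_cmod[of "w - a"] norm_triangle_sub[of w a]
          by (auto simp: dist_norm norm_minus_commute)
    then show "norm (?f w y) \<le> ?g y" using M by (auto simp: indicator_def)
  qed (use r in auto)
  then show ?thesis
    unfolding cosh_integral_def [abs_def] set_lebesgue_integral_def DERIV_imp_deriv[OF der] by simp
qed

section \<open>Evaluation of the derivative by partial fractions\<close>

lemma Digamma_reflection:
  fixes z :: complex assumes z: "z \<notin> \<int>"
  shows "Digamma z - Digamma (1 - z) = - of_real pi * cot (of_real pi * z)"
proof -
  define s where "s = of_real pi * z"
  have o: "open (- \<int> :: complex set)" by (simp add: open_Compl)
  have nz: "z \<notin> \<int>\<^sub>\<le>\<^sub>0" "1 - z \<notin> \<int>\<^sub>\<le>\<^sub>0" using z
    by (auto dest!: nonpos_Ints_Int)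
  have sn: "sin (of_real pi * w) \<noteq> 0" if "w \<notin> \<int>" for w :: complex
    using that by (auto simp: sin_eq_0)
  \<comment> \<open>Differentiates the reflection formula of the Gamma function: this product is the
    constant pi, so the derivative vanishes.\<close>
  have "((\<lambda>w. Gamma w * Gamma (1 - w) * sin (of_real pi * w)) has_field_derivative
     Gamma z * Gamma (1 - z) * ((Digamma z - Digamma (1 - z)) * sin s + of_real pi * cos s)) (at z)"
    using nz by (auto intro!: derivative_eq_intros simp: s_def algebra_simps)
  moreover have "((\<lambda>w. Gamma w * Gamma (1 - w) * sin (of_real pi * w)) has_field_derivative 0) (at z)"
  proof (rule has_field_derivative_transform_within_open[OF _ o])
    show "((\<lambda>w. of_real pi) has_field_derivative 0) (at z)" by simp
    show "of_real pi = Gamma w * Gamma (1 - w) * sin (of_real pi * w)" if "w \<in> - \<int>" for w :: complex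
      using that sn[of w] by (simp add: Gamma_reflection_complex)
  qed (use z in auto)
  ultimately have "Gamma z * Gamma (1 - z) * ((Digamma z - Digamma (1 - z)) * sin s
      + of_real pi * cos s) = 0"
    by (rule DERIV_unique)
  moreover have "Gamma z \<noteq> 0" "Gamma (1 - z) \<noteq> 0" using nz by (auto simp: Gamma_eq_zero_iff)
  ultimately have "(Digamma z - Digamma (1 - z)) * sin s + of_real pi * cos s = 0" by simp
  then show ?thesis using sn[OF z] unfolding cot_def s_def[symmetric]
    by (simp add: field_simps add_eq_0_iff)
qed

text \<open>Expanding 1 / sinh y as a geometric series in exp (-2 y) gives differences of
  exponentials. Their integrals form a partial fraction series, which is half the difference of the
  digamma series at (1 + a)/2 and (1 - a)/2.\<close>

lemma sinh_integral:
  assumes a: "0 < a" "a < 1"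
  shows "(LBINT y:{0<..}. sinh (of_real y * of_real a) / of_real (sinh y) :: complex)
      = of_real (pi / 2) * tan (of_real (pi * a / 2))"
proof -
  define u where "u n y = exp (- (y * (2 * real n + 1 - a))) - exp (- (y * (2 * real n + 1 + a)))" for n y
  define c where "c n = 1 / (2 * real n + 1 - a) - 1 / (2 * real n + 1 + a)" for n
  have e: "set_integrable lborel {0<..} (\<lambda>y. exp (- (y * t)))" "(LBINT y:{0<..}. exp (- (y * t)))
      = 1 / t" if "t > 0" for t :: real
    using that integrable_I0i_exp_mscale[of t] LBINT_I0i_exp_mscale[of t]
        by (auto simp: interval_lebesgue_integral_0_infty)
  have p: "2 * real n + 1 - a > 0" "2 * real n + 1 + a > 0" for n using a by (auto intro: add_nonneg_pos)
  have ui: "set_integrable lborel {0<..} (u n)" "(LBINT y:{0<..}. u n y) = c n" for n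
    unfolding u_def c_def using set_integral_diff[OF e(1)[OF p(1)[of n]] e(1)[OF p(2)[of n]]]
        e(2)[OF p(1)[of n]] e(2)[OF p(2)[of n]] by auto
  have u0: "u n y \<ge> 0" if "y > 0" for n y unfolding u_def using that a by (simp add: mult_left_mono)
  have us: "(\<lambda>n. u n y) sums (sinh (y * a) / sinh y)" if "y > 0" for y
  proof -
    have "(\<lambda>n. exp (-2*y) ^ n) sums (1 / (1 - exp (-2*y)))" using that by (intro geometric_sums) auto
    then have "(\<lambda>n. (exp (y * a) - exp (- (y * a))) * exp (-y) * exp (-2*y) ^ n) sums ((exp (y * a)
        - exp (- (y * a))) * exp (-y) * (1 / (1 - exp (-2*y))))"
      by (rule sums_mult)
    moreover have "(exp (y * a) - exp (- (y * a))) * exp (-y) * exp (-2*y) ^ n = u n y" for n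
      unfolding u_def by (simp add: exp_of_nat_mult[symmetric] algebra_simps flip: exp_add)
    moreover have "(exp (y * a) - exp (- (y * a))) * exp (-y) * (1 / (1 - exp (-2*y)))
        = sinh (y * a) / sinh y"
    proof -
      have "exp (-2*y) = exp (-y) * exp (-y)" by (simp flip: exp_add)
      moreover have "exp (-y) * exp y = 1" by (simp flip: exp_add)
      moreover have "1 - exp (-2*y) \<noteq> 0" "exp y - exp (-y) \<noteq> 0" using that by auto
      ultimately show ?thesis unfolding sinh_field_def by (simp add: divide_simps) algebra
    qed
    ultimately show ?thesis by simp
  qed
  have "(\<lambda>k. inverse (of_nat (Suc k)) - inverse (((1 + a) / 2) + of_nat k)) sums (Digamma ((1+a)/2)
      + euler_mascheroni)"
     "(\<lambda>k. inverse (of_nat (Suc k)) - inverse (((1 - a) / 2) + of_nat k)) sums (Digamma ((1-a)/2)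
         + euler_mascheroni)"
    unfolding Digamma_def using summable_Digamma[of "(1+a)/2"] summable_Digamma[of "(1-a)/2"] a
        by (auto simp: summable_sums)
  from sums_diff[OF this]
  have "(\<lambda>k. (inverse (((1 - a) / 2) + of_nat k) - inverse (((1 + a) / 2)
      + of_nat k)) * (1/2)) sums ((Digamma ((1+a)/2) - Digamma ((1-a)/2)) * (1/2))"
    by (intro sums_mult2) (simp add: algebra_simps)
  moreover have "(inverse (((1 - a) / 2) + of_nat k) - inverse (((1 + a) / 2) + of_nat k)) * (1/2)
      = c k" for k
    unfolding c_def using p[of k] a by (simp add: divide_simps) (simp add: algebra_simps)?
  ultimately have cs: "c sums ((Digamma ((1+a)/2) - Digamma ((1-a)/2)) / 2)" by simp
  have c0: "c n \<ge> 0" for n unfolding c_def using p[of n] a by (simp add: frac_le)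
  have "(\<lambda>n. \<integral>y. indicat_real {0<..} y *\<^sub>R u n y \<partial>lborel) sums (\<integral>y. (\<Sum>n. indicat_real {0<..} y *\<^sub>R u
      n y) \<partial>lborel)"
  proof (rule sums_integral)
    show "integrable lborel (\<lambda>y. indicat_real {0<..} y *\<^sub>R u n y)" for n using ui(1)
        unfolding set_integrable_def .
    \<comment> \<open>For a > 0 all terms are nonnegative, so absolute summability is plain
      summability.\<close>
    show "AE y in lborel. summable (\<lambda>n. norm (indicat_real {0<..} y *\<^sub>R u n y))"
      using us u0 by (auto intro!: AE_I2 simp: indicator_def sums_iff)
    have "(\<integral>y. norm (indicat_real {0<..} y *\<^sub>R u n y) \<partial>lborel) = c n" for n
      unfolding ui(2)[symmetric] set_lebesgue_integral_def
      using u0 by (intro Bochner_Integration.integral_cong) (auto simp: indicator_def)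
    then show "summable (\<lambda>n. \<integral>y. norm (indicat_real {0<..} y *\<^sub>R u n y) \<partial>lborel)" using cs
        by (simp add: sums_iff)
  qed
  then have "c sums (\<integral>y. (\<Sum>n. indicat_real {0<..} y *\<^sub>R u n y) \<partial>lborel)"
    using ui(2) unfolding set_lebesgue_integral_def by simp
  moreover have "(\<integral>y. (\<Sum>n. indicat_real {0<..} y *\<^sub>R u n y) \<partial>lborel)
      = (LBINT y:{0<..}. sinh (y * a) / sinh y)"
    unfolding set_lebesgue_integral_def using us by (intro Bochner_Integration.integral_cong) (auto
        simp: indicator_def sums_iff)
  ultimately have "(LBINT y:{0<..}. sinh (y * a) / sinh y) = (Digamma ((1+a)/2) - Digamma ((1-a)/2)) / 2"
    using cs sums_unique2 by metis
  moreover have "(LBINT y:{0<..}. sinh (of_real y * of_real a) / of_real (sinh y) :: complex)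
      = of_real (LBINT y:{0<..}. sinh (y * a) / sinh y)"
    by (simp add: sinh_complex_of_real flip: of_real_mult of_real_divide set_integral_complex_of_real)
  moreover have "of_real (Digamma ((1+a)/2) - Digamma ((1-a)/2))
      = of_real pi * tan (of_real (pi * a / 2) :: complex)"
  proof -
    \<comment> \<open>The points (1 - a)/2 and (1 + a)/2 have sum 1, so the reflection formula
      applies; the cotangent at pi/2 - pi a/2 is the tangent at pi a/2.\<close>
    define z where "z = complex_of_real ((1 - a) / 2)"
    have "z \<notin> \<int>"
    proof
      assume "z \<in> \<int>"
      then have "(1 - a) / 2 \<in> \<int>" by (simp add: z_def del: of_real_divide of_real_diff)
      then obtain i where i: "(1 - a) / 2 = real_of_int i" by (elim Ints_cases)
      have "real_of_int i > 0" "real_of_int i < 1" unfolding i[symmetric] using a by auto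
      then show False by simp
    qed
    from Digamma_reflection[OF this]
    have "Digamma (1 - z) - Digamma z = of_real pi * cot (of_real pi * z)" by (simp add: algebra_simps)
    moreover have "1 - z = of_real ((1 + a) / 2)" by (simp add: z_def field_simps)
    moreover have "cot (of_real pi * z) = tan (of_real (pi * a / 2))"
    proof -
      have "of_real pi * z = of_real pi / 2 - of_real (pi * a / 2)" by (simp add: z_def field_simps)
      then show ?thesis by (simp only: cot_def tan_def sin_diff cos_diff) simp
    qed
    moreover have "Digamma (complex_of_real ((1 + a) / 2)) = of_real (Digamma ((1
        + a) / 2))" "Digamma z = of_real (Digamma ((1 - a) / 2))"
      unfolding z_def using a by (intro Polygamma_of_real; simp)+
    ultimately show ?thesis by simp
  qed
  ultimately show ?thesis
    by (metis (no_types, lifting) of_real_divide of_real_numeral times_divide_eq_left)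
qed

text \<open>Substitution of 2 y for y, with sinh (2 y) = 2 sinh y cosh y: at a = 1/2 the hyperbolic
  cosine cancels. A quarter of the density at a = 0 remains, and the Jacobian is 2.\<close>

lemma cosh_integral_half: "cosh_integral (1/2) = cosh_integral 0 / 2"
proof -
  have e: "cosh_density (1/2) (2 * y) = cosh_density 0 y / 4" if "y > 0" for y
  proof -
    have s: "sinh (2 * y) = 2 * sinh y * cosh y" "cosh y \<noteq> 0" "sinh y \<noteq> 0"
      using that by (simp_all add: sinh_double)
    have "of_real (2 * y) * (1/2) = complex_of_real y" by simp
    then show ?thesis using that s unfolding cosh_density_def
      by (simp only: cosh_complex_of_real) (simp add: divide_simps)
  qed
  have "cosh_integral (1/2) = 2 *\<^sub>R (\<integral>y. indicat_real {0<..} (0 + 2 * y) *\<^sub>R cosh_density (1/2) (0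
      + 2 * y) \<partial>lborel)"
    unfolding cosh_integral_def set_lebesgue_integral_def
    by (subst lborel_integral_real_affine[where c = 2 and t = 0]) auto
  also have "(\<integral>y. indicat_real {0<..} (0 + 2 * y) *\<^sub>R cosh_density (1/2) (0 + 2 * y) \<partial>lborel)
      = (LBINT y:{0<..}. cosh_density 0 y / 4)"
    unfolding set_lebesgue_integral_def using e by (intro Bochner_Integration.integral_cong) (auto
        simp: indicator_def)
  finally show ?thesis by (simp add: cosh_integral_def scaleR_conv_of_real)
qed

lemma exp_cosh_integral:
  assumes a: "\<bar>Re a\<bar> < 1"
  shows "exp (cosh_integral a) = 2 * cos (of_real pi * a / 2)"
proof -
  define S where "S = {a. \<bar>Re a\<bar> < 1}"
  have S: "open S" "convex S" "connected S"
  proof -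
    have "S = {a. Re a < 1} \<inter> {a. Re a > -1}" by (auto simp: S_def)
    then show "open S" "convex S" by (auto simp: open_halfspace_Re_lt open_halfspace_Re_gt
        convex_halfspace_Re_lt convex_halfspace_Re_gt intro!: convex_Int)
    then show "connected S" by (simp add: convex_connected)
  qed
  define I' where "I' a = - (LBINT y:{0<..}. sinh (of_real y * a) / of_real (sinh y))" for a :: complex
  define c where "c a = 2 * cos (of_real pi * a / 2)" for a :: complex
  \<comment> \<open>The quotient of the two sides; it is constant because its derivative vanishes,
    and the constant is then found to be 1.\<close>
  define F where "F a = c a * exp (- cosh_integral a)" for a
  define F' where "F' a = (- of_real pi * sin (of_real pi * a / 2)
      - c a * I' a) * exp (- cosh_integral a)" for a
  have der: "(F has_field_derivative F' a) (at a)" if "a \<in> S" for a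
    unfolding F_def F'_def c_def
    using cosh_integral_has_field_derivative[of a] that unfolding S_def I'_def
    by (auto intro!: derivative_eq_intros simp: algebra_simps)
  have holF: "F holomorphic_on S"
    using der S(1) by (auto simp: holomorphic_on_open)
  \<comment> \<open>\<open>F'\<close> contains a parameter integral, but as the derivative of a
    holomorphic function it is holomorphic without a further look at that integral.\<close>
  have F'hol: "F' holomorphic_on S"
  proof (rule holomorphic_transform)
    show "deriv F holomorphic_on S" using holF S(1) by (rule holomorphic_deriv)
  qed (use der in \<open>auto intro: DERIV_imp_deriv\<close>)
  \<comment> \<open>The integral is known only on the real interval (0, 1); the identity theorem
    extends the vanishing of \<open>F'\<close> to the strip.\<close>
  have z0: "F' (of_real t) = 0" if t: "0 < t" "t < 1" for t
  proof -
    have "cos (pi * t / 2) > 0" using t pi_gt_zero by (intro cos_gt_zero) (auto simp: field_simps)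
    then have "cos (complex_of_real (pi * t / 2)) \<noteq> 0" by (simp only: cos_of_real of_real_eq_0_iff)
    then show ?thesis unfolding F'_def I'_def sinh_integral[OF t] c_def by (simp add: tan_def)
  qed
  have F'0: "F' a = 0" if "a \<in> S" for a
  proof (rule analytic_continuation[OF F'hol S(1,3)])
    show "complex_of_real ` {0<..<1} \<subseteq> S" by (auto simp: S_def)
    show "(1/2 :: complex) \<in> S" by (auto simp: S_def)
    show "(1/2 :: complex) islimpt of_real ` {0<..<1}"
      unfolding islimpt_sequential
    proof (intro exI[of _ "\<lambda>n. complex_of_real (1/2 + 1 / (real n + 3))"] conjI allI)
      have "1/2 + 1 / (real n + 3) \<in> {0<..<1}" for n by (auto simp: field_simps add_pos_nonneg)
      moreover have "complex_of_real (1/2 + 1 / (real n + 3)) \<noteq> 1/2" for n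
      proof -
        have "Re (complex_of_real (1/2 + 1 / (real n + 3))) \<noteq> Re (1/2)" by (simp add: add_nonneg_eq_0_iff)
        then show ?thesis by metis
      qed
      ultimately show "complex_of_real (1/2 + 1 / (real n + 3)) \<in> of_real ` {0<..<1} - {1/2}" for n
          by blast
      have "(\<lambda>n. 1/2 + 1 / (real n + 3)) \<longlonglongrightarrow> 1/2" by real_asymp
      then have "(\<lambda>n. complex_of_real (1/2 + 1 / (real n + 3))) \<longlonglongrightarrow> complex_of_real (1/2)"
          by (rule tendsto_of_real)
      then show "(\<lambda>n. complex_of_real (1/2 + 1 / (real n + 3))) \<longlonglongrightarrow> 1/2"
          by (simp only: of_real_divide of_real_1 of_real_numeral)
    qed
  qed (use z0 that in auto)
  have "(F has_field_derivative 0) (at a within S)" if "a \<in> S" for a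
    using der[OF that] F'0[OF that] by (simp add: has_field_derivative_at_within)
  then obtain k where k: "\<And>a. a \<in> S \<Longrightarrow> F a = k"
    using has_field_derivative_zero_constant[OF S(2)] by metis
  have ek: "c a = k * exp (cosh_integral a)" if "a \<in> S" for a
    using k[OF that] by (simp add: F_def exp_minus field_simps)
  \<comment> \<open>With e = \<open>exp (cosh_integral 0)\<close>, the point 0 gives
    \<open>2 = k * e\<close> and the square of the relation at 1/2 gives
    \<open>2 = k\<^sup>2 * e\<close>; hence k = 1.\<close>
  have k0: "2 = k * exp (cosh_integral 0)" using ek[of 0] by (simp add: c_def S_def)
  have "c (1/2) = k * exp (cosh_integral 0 / 2)" using ek[of "1/2"]
      by (simp add: S_def cosh_integral_half)
  moreover have "c (1/2) ^ 2 = 2"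
  proof -
    have "of_real pi * (1/2) / 2 = complex_of_real (pi / 4)" by simp
    then have "c (1/2) = 2 * complex_of_real (cos (pi / 4))" unfolding c_def by (simp only: cos_of_real)
    then show ?thesis by (simp add: cos_45 power_mult_distrib power_divide flip: of_real_power)
  qed
  ultimately have "2 = k\<^sup>2 * exp (cosh_integral 0 / 2) ^ 2" by (simp add: power_mult_distrib)
  also have "exp (cosh_integral 0 / 2) ^ 2 = exp (cosh_integral 0)" by (simp flip: exp_of_nat_mult)
  also have "k\<^sup>2 * exp (cosh_integral 0) = k * 2" using k0 by (simp add: power2_eq_square)
  finally have "k = 1" by simp
  then show ?thesis using ek[of a] a by (simp add: c_def S_def)
qed

text \<open>The functional equation in centred form, on the strip where both arguments are within
  reach of the integral.\<close>

lemma exp_log_hyp_gamma_shift: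
  assumes k: "k > 0" and z: "\<bar>Re z\<bar> < 1 / k"
  shows "exp (log_hyp_gamma k (z + 1)) = 2 * cos (of_real pi * of_real k * z / 2) * exp
      (log_hyp_gamma k (z - 1))"
proof -
  have "\<bar>Re (of_real k * z)\<bar> < 1" using k z by (simp add: abs_mult field_simps)
  from cosh_integral_eq[OF k this] exp_cosh_integral[OF this]
  have "exp (log_hyp_gamma k (z + 1) - log_hyp_gamma k (z - 1))
      = 2 * cos (of_real pi * (of_real k * z) / 2)"
    using k by simp
  then show ?thesis by (simp add: exp_diff field_simps)
qed

subsection \<open>Growth on the strip\<close>

text \<open>For imaginary z the points z + 1 and z - 1 are exchanged by minus complex conjugation.
  As the logarithm is odd and commutes with conjugation, the functional equation becomes a formula
  for the modulus alone.\<close>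

lemma Re_log_hyp_gamma_line:
  assumes k: "k > 0"
  shows "Re (log_hyp_gamma k (1 + \<i> * of_real t)) = ln (2 * cosh (pi * k * t / 2)) / 2"
proof -
  let ?z = "\<i> * of_real t"
  have cnj: "cnj (log_hyp_gamma k z) = log_hyp_gamma k (cnj z)" for z
  proof -
    have "cnj (gamma_density k z y) = gamma_density k (cnj z) y" for y
      unfolding gamma_density_def sinh_field_def by (simp add: exp_cnj)
    then have "cnj (indicat_real {0<..} y *\<^sub>R gamma_density k z y)
        = indicat_real {0<..} y *\<^sub>R gamma_density k (cnj z) y" for y
      by (simp add: scaleR_conv_of_real)
    then show ?thesis
      unfolding log_hyp_gamma_def set_lebesgue_integral_def complex_cnj_divide
      by (subst Bochner_Integration.integral_cnj[symmetric]) (simp only: complex_cnj_numeral)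
  qed
  have "exp (log_hyp_gamma k (?z + 1)) = 2 * cos (of_real pi * of_real k * ?z / 2) * exp
      (log_hyp_gamma k (?z - 1))"
    using k by (intro exp_log_hyp_gamma_shift) auto
  moreover have "cos (of_real pi * of_real k * ?z / 2) = of_real (cosh (pi * k * t / 2))"
  proof -
    have "of_real pi * of_real k * ?z / 2 = \<i> * of_real (pi * k * t / 2)" by simp
    then show ?thesis by (simp only: flip: cosh_complex_of_real) (simp add: cos_exp_eq
        cosh_field_def exp_minus algebra_simps)
  qed
  moreover have "?z - 1 = - cnj (?z + 1)" by simp
  then have "log_hyp_gamma k (?z - 1) = - cnj (log_hyp_gamma k (?z + 1))"
      by (simp only: log_hyp_gamma_minus cnj)
  ultimately have "exp (log_hyp_gamma k (?z + 1) + cnj (log_hyp_gamma k (?z + 1)))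
      = of_real (2 * cosh (pi * k * t / 2))"
    by (simp add: exp_add exp_minus field_simps)
  then have "norm (exp (log_hyp_gamma k (?z + 1) + cnj (log_hyp_gamma k (?z + 1))))
      = 2 * cosh (pi * k * t / 2)"
    by (simp only: norm_of_real) auto
  then have "exp (2 * Re (log_hyp_gamma k (?z + 1))) = 2 * cosh (pi * k * t / 2)" by simp
  then have "2 * Re (log_hyp_gamma k (?z + 1)) = ln (2 * cosh (pi * k * t / 2))" by (metis ln_exp)
  then show ?thesis by (simp add: add.commute)
qed

lemma Re_gamma_density:
  assumes "k > 0" "y > 0"
  shows "Re (gamma_density k z y) = (Re z / y - sinh (k * y * Re z) * cos (k * y * Im z) / (sinh y *
      sinh (k * y))) / y"
proof -
  have "Re (sinh w) = sinh (Re w) * cos (Im w)" for w :: complex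
    by (simp add: sinh_field_def Re_exp field_simps)
  then show ?thesis unfolding gamma_density_def by (simp add: Re_divide_of_real)
qed

text \<open>Convexity of sinh between 0 and c, with sinh 0 = 0. It is the source of the sign in the
  comparison of the densities.\<close>

lemma sinh_mult_le:
  fixes c s :: real assumes "0 \<le> c" "0 \<le> s" "s \<le> 1" shows "sinh (c * s) \<le> s * sinh c"
proof -
  have "convex_on {0..} (sinh :: real \<Rightarrow> real)"
    by (rule f''_ge0_imp_convex[where f' = cosh and f'' = sinh]) (auto intro!: derivative_eq_intros)
  from convex_onD[OF this, of s 0 c] show ?thesis using assms by (simp add: mult.commute)
qed

lemma Re_log_hyp_gamma:
  assumes "k > 0" "\<bar>Re z\<bar> < 1 + 1 / k"
  shows "set_integrable lborel {0<..} (\<lambda>y. Re (gamma_density k z y))"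
    and "Re (log_hyp_gamma k z) = (LBINT y:{0<..}. Re (gamma_density k z y)) / 2"
proof -
  note i = gamma_density_set_integrable[OF assms, unfolded set_integrable_def]
  show "set_integrable lborel {0<..} (\<lambda>y. Re (gamma_density k z y))"
    using integrable_Re[OF i] unfolding set_integrable_def by simp
  show "Re (log_hyp_gamma k z) = (LBINT y:{0<..}. Re (gamma_density k z y)) / 2"
    using integral_Re[OF i] unfolding log_hyp_gamma_def set_lebesgue_integral_def by simp
qed

text \<open>
  In the combination of the densities at \<open>s + \<i>t\<close> and \<open>1 + \<i>t\<close> the singular terms cancel, and
  what remains is \<open>cos (k y t)\<close> times a nonnegative function that does not depend on \<open>t\<close>.
\<close>

lemma Re_log_hyp_gamma_compare:
  assumes k: "k > 0" and s: "0 \<le> s" "s \<le> 1"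
  shows "\<bar>Re (log_hyp_gamma k (Complex s t)) - s * Re (log_hyp_gamma k (Complex 1 t))\<bar>
    \<le> Re (log_hyp_gamma k (of_real s)) - s * Re (log_hyp_gamma k 1)"
proof -
  define D where "D u y = Re (gamma_density k (Complex s u) y)
      - s * Re (gamma_density k (Complex 1 u) y)" for u y
  define N where "N y = (s * sinh (k * y) - sinh (k * y * s)) / (y * sinh y * sinh (k * y))" for y
  have "1 < 1 + 1/k" using k by simp
  then have r: "\<bar>Re (Complex s u)\<bar> < 1 + 1/k" "\<bar>Re (Complex 1 u)\<bar> < 1 + 1/k" for u using s
      by (simp_all only: complex.sel)
  have D: "D u y = cos (k * y * u) * N y" if "y > 0" for u y
    using that k unfolding D_def N_def by (simp add: Re_gamma_density divide_simps) (simp add: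
        algebra_simps)
  have N: "N y \<ge> 0" if "y > 0" for y
    unfolding N_def using sinh_mult_le[of "k*y" s] that k s by (simp add: divide_nonneg_pos)
  have Di: "set_integrable lborel {0<..} (D u)" for u
    unfolding D_def using Re_log_hyp_gamma(1)[OF k r(1)[of u]] Re_log_hyp_gamma(1)[OF k r(2)[of u]]
    by (intro set_integral_diff(1) set_integrable_mult_right) auto
  have Dint: "(LBINT y:{0<..}. D u y) = 2 * (Re (log_hyp_gamma k (Complex s u))
      - s * Re (log_hyp_gamma k (Complex 1 u)))" for u
    unfolding D_def Re_log_hyp_gamma(2)[OF k r(1)[of u]] Re_log_hyp_gamma(2)[OF k r(2)[of u]]
    using set_integral_diff(2)[OF Re_log_hyp_gamma(1)[OF k r(1)[of u]] set_integrable_mult_right[of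
        s, OF Re_log_hyp_gamma(1)[OF k r(2)[of u]]]]
    by simp
  have "\<bar>LBINT y:{0<..}. D t y\<bar> \<le> (LBINT y:{0<..}. D 0 y)"
  proof -
    have "norm (LBINT y:{0<..}. D t y) \<le> (LBINT y:{0<..}. norm (D t y))"
      using Di[of t] by (rule set_integral_norm_bound)
    also have "\<dots> \<le> (LBINT y:{0<..}. D 0 y)"
    proof (rule set_integral_mono)
      show "set_integrable lborel {0<..} (\<lambda>y. norm (D t y))" using Di[of t] by (rule set_integrable_norm)
      show "norm (D t y) \<le> D 0 y" if "y \<in> {0<..}" for y
        using that N[of y] mult_right_mono[OF abs_cos_le_one[of "k*y*t"] N[of y]]
            by (simp add: D abs_mult)
    qed (rule Di)
    finally show ?thesis by simp
  qed
  then show ?thesis unfolding Dint by (simp add: abs_mult complex_of_real_def one_complex.code)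
qed

lemma Re_log_hyp_gamma_upper:
  assumes k: "k > 0"
  obtains C where "\<And>z. \<bar>Re z\<bar> \<le> 1 \<Longrightarrow> Re (log_hyp_gamma k z) \<le> Re z * (pi * k * \<bar>Im z\<bar> / 4) + C"
proof -
  \<comment> \<open>The bound of \<open>Re_log_hyp_gamma_compare\<close> as a function of s; by
    continuity on [0, 1] a single constant B serves for all s.\<close>
  define f where "f s = Re (log_hyp_gamma k (of_real s)) - s * Re (log_hyp_gamma k 1)" for s
  have "1 < 1 + 1/k" using k by simp
  then have "\<bar>Re (complex_of_real s)\<bar> < 1 + 1/k" if "s \<in> {0..1}" for s
    using that unfolding Re_complex_of_real atLeastAtMost_iff by linarith
  then have sub: "complex_of_real ` {0..1} \<subseteq> {z. \<bar>Re z\<bar> < 1 + 1 / k}" by blast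
  have "continuous_on {0..1} f"
    unfolding f_def
    by (intro continuous_intros continuous_on_compose2[OF holomorphic_on_imp_continuous_on[OF
        log_hyp_gamma_holomorphic[OF k]]] sub)
  then obtain B where B: "\<And>s. 0 \<le> s \<Longrightarrow> s \<le> 1 \<Longrightarrow> f s \<le> B"
    using compact_continuous_image[of "{0..1}" f] compact_imp_bounded bounded_imp_bdd_above
    unfolding bdd_above_def by (metis atLeastAtMost_iff compact_Icc imageI)
  define l where "l t = ln (2 * cosh (pi * k * t / 2)) / 2" for t
  \<comment> \<open>The upper bound serves nonnegative real parts, the lower one negative real
    parts, where \<open>l\<close> occurs with a negative coefficient.\<close>
  have lb: "pi * k * \<bar>t\<bar> / 4 \<le> l t" "l t \<le> pi * k * \<bar>t\<bar> / 4 + ln 2 / 2" for t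
  proof -
    let ?u = "pi * k * t / 2"
    have u: "\<bar>?u\<bar> = pi * k * \<bar>t\<bar> / 2" using k by (simp add: abs_mult)
    have c: "2 * cosh ?u = exp \<bar>?u\<bar> + exp (- \<bar>?u\<bar>)" by (auto simp: cosh_field_def abs_if)
    have "ln (exp \<bar>?u\<bar>) \<le> ln (2 * cosh ?u)" unfolding c
        by (subst ln_le_cancel_iff) (auto intro: add_pos_pos)
    moreover have "ln (2 * cosh ?u) \<le> ln (2 * exp \<bar>?u\<bar>)" unfolding c
        by (subst ln_le_cancel_iff) (auto intro: add_pos_pos)
    moreover have "ln (2 * exp \<bar>?u\<bar>) = ln 2 + \<bar>?u\<bar>" by (simp add: ln_mult)
    moreover have "ln (exp \<bar>?u\<bar>) = \<bar>?u\<bar>" by simp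
    ultimately have "\<bar>?u\<bar> / 2 \<le> l t" "l t \<le> \<bar>?u\<bar> / 2 + ln 2 / 2" unfolding l_def by linarith+
    then show "pi * k * \<bar>t\<bar> / 4 \<le> l t" "l t \<le> pi * k * \<bar>t\<bar> / 4 + ln 2 / 2" unfolding u by simp_all
  qed
  have one: "Re (log_hyp_gamma k (Complex 1 t)) = l t" for t
  proof -
    have "Complex 1 t = 1 + \<i> * of_real t" by (simp add: complex_eq_iff)
    then show ?thesis using Re_log_hyp_gamma_line[OF k, of t] by (simp only: l_def)
  qed
  have main: "\<bar>Re (log_hyp_gamma k (Complex s t)) - s * l t\<bar> \<le> B" if "0 \<le> s" "s \<le> 1" for s t
    using Re_log_hyp_gamma_compare[OF k that, of t] B[OF that] unfolding one f_def by linarith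
  have "Re (log_hyp_gamma k z) \<le> Re z * (pi * k * \<bar>Im z\<bar> / 4) + (B + ln 2 / 2)" if z: "\<bar>Re z\<bar> \<le> 1" for z
  proof (cases "Re z \<ge> 0")
    case True
    then have "Re (log_hyp_gamma k z) \<le> Re z * l (Im z) + B" using main[of "Re z" "Im z"] z by simp
    also have "Re z * l (Im z) \<le> Re z * (pi * k * \<bar>Im z\<bar> / 4) + 1 * (ln 2 / 2)"
    proof -
      have "Re z * (ln 2 / 2) \<le> 1 * (ln 2 / 2)" using z by (intro mult_right_mono) auto
      then show ?thesis using mult_left_mono[OF lb(2)[of "Im z"] True] unfolding distrib_left by linarith
    qed
    finally show ?thesis by simp
  next
    case False
    then have "\<bar>Re (log_hyp_gamma k (-z)) - Re (-z) * l (Im (-z))\<bar> \<le> B"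
        using main[of "Re (-z)" "Im (-z)"] z by (simp del: uminus_complex.sel) simp
    then have "Re (log_hyp_gamma k z) \<le> Re z * l (- Im z) + B" by (simp add: log_hyp_gamma_minus)
    also have "Re z * l (- Im z) \<le> Re z * (pi * k * \<bar>Im z\<bar> / 4)"
      using mult_left_mono_neg[OF lb(1)[of "- Im z"], of "Re z"] False by simp
    also have "\<dots> \<le> \<dots> + ln 2 / 2" by simp
    finally show ?thesis by simp
  qed
  then show ?thesis by (rule that)
qed

subsection \<open>The meromorphic extension\<close>

text \<open>All poles of the hyperbolic gamma function with parameter \<open>- k\<close> lie on \<open>pole_ray k\<close>.\<close>

definition pole_ray :: "real \<Rightarrow> complex set" where
  "pole_ray k = {z. Im z = 0 \<and> Re z \<le> - (1 + 1 / k)}"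

lemma exp_hyp_gamma_exponent:
  assumes "k > 0" shows "exp (\<i> * hyp_gamma_exponent (- k) z) = exp (log_hyp_gamma k z)"
proof -
  have "(LBINT y:{0<..}. 1 / complex_of_real y * (z / of_real y
      - sinh (of_real (- k * y) * z) / of_real (sinh y * sinh (- k * y))))
     = (LBINT y:{0<..}. gamma_density k z y)"
    by (intro set_lebesgue_integral_cong) (auto simp: gamma_density_def)
  then have "\<i> * hyp_gamma_exponent (- k) z = log_hyp_gamma k z"
    unfolding hyp_gamma_exponent_def log_hyp_gamma_def by simp
  then show ?thesis by simp
qed

abbreviation shift_factor :: "real \<Rightarrow> complex \<Rightarrow> complex" where
  "shift_factor k z \<equiv> 2 * cos (of_real pi * z * of_real k / 2)"

lemma hyp_gamma_unfold:
  assumes "k > 0"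
  shows "0 \<le> Re z \<Longrightarrow> hyp_gamma (- k) z =
      (let n = (LEAST n::nat. Re z - 2 * real n < 1 + 1 / k); w = z - 2 * of_nat n
       in exp (log_hyp_gamma k w) * (\<Prod>j<n. shift_factor k (w + 2 * of_nat j + 1)))"
    and "Re z < 0 \<Longrightarrow> hyp_gamma (- k) z =
      (let n = (LEAST n::nat. - (1 + 1 / k) < Re z + 2 * real n); w = z + 2 * of_nat n
       in exp (log_hyp_gamma k w) / (\<Prod>j<n. shift_factor k (z + 2 * of_nat j + 1)))"
  using exp_hyp_gamma_exponent[OF assms] by (simp_all add: hyp_gamma_def Let_def)

lemma hyp_gamma_strip:
  assumes k: "k > 0" and z: "\<bar>Re z\<bar> < 1 + 1 / k"
  shows "hyp_gamma (- k) z = exp (log_hyp_gamma k z)"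
proof (cases "0 \<le> Re z")
  case True
  have "(LEAST n::nat. Re z - 2 * real n < 1 + 1 / k) = 0" using z by (intro Least_eq_0) auto
  then show ?thesis using hyp_gamma_unfold(1)[OF k True] by simp
next
  case False
  have "(LEAST n::nat. - (1 + 1 / k) < Re z + 2 * real n) = 0" using z by (intro Least_eq_0) auto
  then show ?thesis using hyp_gamma_unfold(2)[OF k, of z] False by simp
qed

lemma Least_archimedean_less:
  fixes a b :: real shows "\<exists>n::nat. a - 2 * real n < b"
proof -
  obtain n :: nat where "(a - b) / 2 < real n" using reals_Archimedean2 by blast
  then show ?thesis by (intro exI[of _ n]) (simp add: field_simps)
qed

text \<open>The reflection formula for every z: where z or -z is a pole, both sides are 0, because
  the definition assigns 0 to poles and \<open>inverse 0 = 0\<close>.\<close>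

lemma hyp_gamma_minus:
  assumes k: "k > 0" shows "hyp_gamma (- k) (- z) = inverse (hyp_gamma (- k) z)"
proof -
  have pos: "hyp_gamma (- k) (- z) = inverse (hyp_gamma (- k) z)" if z: "Re z > 0" for z
  proof -
    \<comment> \<open>Both branches of the definition take the same number of steps, at z and at -z.
      Reversing the order of the factors then matches the products, as cos is even.\<close>
    have iff: "- (1 + 1 / k) < Re (- z) + 2 * real n \<longleftrightarrow> Re z - 2 * real n < 1 + 1 / k" for n by auto
    define n where "n = (LEAST n::nat. Re z - 2 * real n < 1 + 1 / k)"
    define w where "w = z - 2 * of_nat n"
    have "(\<Prod>j<n. shift_factor k (- z + 2 * of_nat j + 1)) = (\<Prod>j<n. shift_factor k (w + 2 * of_nat (n
        - Suc j) + 1))"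
    proof (rule prod.cong)
      fix j assume "j \<in> {..<n}"
      then have "- z + 2 * of_nat j + 1 = - (w + 2 * of_nat (n - Suc j) + 1)"
        by (simp add: w_def of_nat_diff algebra_simps)
      moreover have "cos (of_real pi * (- u) * of_real k / 2)
          = cos (of_real pi * u * of_real k / 2)" for u :: complex
        by (metis cos_minus minus_divide_left mult_minus_left mult_minus_right)
      ultimately show "shift_factor k (- z + 2 * of_nat j + 1) = shift_factor k (w + 2 * of_nat (n
          - Suc j) + 1)" by metis
    qed simp
    also have "\<dots> = (\<Prod>j<n. shift_factor k (w + 2 * of_nat j + 1))"
      by (rule prod.nat_diff_reindex)
    finally have pr: "(\<Prod>j<n. shift_factor k (- z + 2 * of_nat j + 1)) = (\<Prod>j<n. shift_factor k (w
        + 2 * of_nat j + 1))" .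
    have w: "- z + 2 * of_nat n = - w" by (simp add: w_def)
    have "hyp_gamma (- k) (- z) = exp (log_hyp_gamma k (- w)) / (\<Prod>j<n. shift_factor k (- z
        + 2 * of_nat j + 1))"
    proof -
      have "Re (- z) < 0" using z by simp
      from hyp_gamma_unfold(2)[OF k this] show ?thesis unfolding iff n_def[symmetric] Let_def w .
    qed
    moreover have "hyp_gamma (- k) z = exp (log_hyp_gamma k w) * (\<Prod>j<n. shift_factor k (w
        + 2 * of_nat j + 1))"
    proof -
      have "0 \<le> Re z" using z by simp
      from hyp_gamma_unfold(1)[OF k this] show ?thesis
          unfolding n_def[symmetric] Let_def w_def[symmetric] .
    qed
    ultimately show ?thesis unfolding pr log_hyp_gamma_minus
        by (simp only: exp_minus divide_inverse inverse_mult_distrib)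
  qed
  consider "Re z > 0" | "Re z = 0" | "Re (- z) > 0" by (cases "Re z" "0::real" rule: linorder_cases) auto
  then show ?thesis
  proof cases
    case 1 then show ?thesis by (rule pos)
  next
    case 2
    then show ?thesis using k by (simp add: hyp_gamma_strip add_pos_pos log_hyp_gamma_minus exp_minus)
  next
    case 3 from pos[OF 3] show ?thesis by simp
  qed
qed

text \<open>At a zero \<open>(z + 1) * k\<close> is an odd integer, and no odd integer lies strictly
  between -1 and 1: this is the gap between the two alternatives.\<close>

lemma shift_factor_eq_0_imp:
  assumes k: "k > 0" and z: "shift_factor k (z + 1) = 0"
  shows "Im z = 0 \<and> (Re z \<le> - (1 + 1 / k) \<or> Re z \<ge> 1 / k - 1)"
proof -
  from z obtain n where n: "of_real pi * (z + 1) * of_real k / 2 = of_int n * complex_of_real pi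
      + of_real pi / 2"
    unfolding mult_eq_0_iff cos_eq_0 by auto
  have "of_real pi * ((z + 1) * of_real k) = of_real pi * (2 * of_int n + 1)"
  proof -
    have "of_real pi * ((z + 1) * of_real k) = 2 * (of_real pi * (z + 1) * of_real k / 2)" by simp
    then show ?thesis unfolding n by (simp add: algebra_simps)
  qed
  then have e: "(z + 1) * of_real k = 2 * of_int n + 1" unfolding mult_cancel_left by simp
  have "Im ((z + 1) * of_real k) = 0" "Re ((z + 1) * of_real k) = 2 * of_int n + 1" unfolding e
      by simp_all
  then have i: "Im z = 0" and r: "(Re z + 1) * k = 2 * of_int n + 1" using k by simp_all
  have "2 * real_of_int n + 1 \<le> -1 \<or> 2 * real_of_int n + 1 \<ge> 1"
  proof (cases "n \<ge> 0")
    case False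
    then have "real_of_int n \<le> -1" by linarith
    then show ?thesis by simp
  qed simp
  then have "(Re z + 1) * k \<le> - 1 \<or> (Re z + 1) * k \<ge> 1" unfolding r .
  then show ?thesis using i k by (auto simp: field_simps)
qed

lemma hyp_gamma_shift_strip:
  assumes k: "k > 0" and z: "\<bar>Re z\<bar> < 1 + 1 / k" "\<bar>Re (z + 2)\<bar> < 1 + 1 / k"
  shows "exp (log_hyp_gamma k (z + 2)) = shift_factor k (z + 1) * exp (log_hyp_gamma k z)"
proof -
  have "\<bar>Re (z + 1)\<bar> < 1 / k" using z by auto
  from exp_log_hyp_gamma_shift[OF k this] show ?thesis by (simp add: algebra_simps)
qed

lemma hyp_gamma_shift:
  assumes k: "k > 0" and z: "z \<notin> pole_ray k"
  shows "hyp_gamma (- k) (z + 2) = shift_factor k (z + 1) * hyp_gamma (- k) z"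
proof -
  define W where "W = 1 + 1 / k"
  have W: "W > 1" using k by (simp add: W_def)
  have r2: "Re (z + 2) = Re z + 2" by simp
  \<comment> \<open>The cases follow the branches of the definition: z and z + 2 in the strip; a
    further step on the right; a step from the left half of the strip across its right edge; z left
    of the open strip.\<close>
  consider "\<bar>Re z\<bar> < W" "\<bar>Re (z + 2)\<bar> < W" | "Re z \<ge> 0" "Re z
      + 2 \<ge> W" | "- W < Re z" "Re z < 0" "Re z + 2 \<ge> W"
    | "Re z \<le> - W"
    unfolding r2 using W by linarith
  then show ?thesis
  proof cases
    case 1
    then show ?thesis using k hyp_gamma_shift_strip[OF k, of z] unfolding W_def
        by (simp only: hyp_gamma_strip)
  next
    case 2
    define n where "n = (LEAST n::nat. Re z - 2 * real n < 1 + 1 / k)"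
    have "(LEAST n::nat. Re (z + 2) - 2 * real n < 1 + 1 / k) = Suc (LEAST n::nat. Re (z + 2)
        - 2 * real (Suc n) < 1 + 1 / k)"
    proof -
      obtain m :: nat where "Re (z + 2) - 2 * real m < 1 + 1 / k" using Least_archimedean_less by blast
      then show ?thesis by (rule Least_Suc) (use 2 in \<open>simp add: W_def\<close>)
    qed
    then have n': "(LEAST n::nat. Re (z + 2) - 2 * real n < 1 + 1 / k) = Suc n" by (simp add: n_def)
    have w: "z + 2 - 2 * of_nat (Suc n) = z - 2 * of_nat n" by simp
    have "z - 2 * of_nat n + 2 * of_nat n + 1 = z + 1" by simp
    then show ?thesis
      using hyp_gamma_unfold(1)[OF k, of "z + 2"] hyp_gamma_unfold(1)[OF k, of z] 2(1)
      unfolding n' n_def[symmetric] Let_def w by (simp add: mult_ac)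
  next
    case 3
    have n: "(LEAST n::nat. Re (z + 2) - 2 * real n < 1 + 1 / k) = 1"
    proof -
      have "(LEAST n::nat. Re (z + 2) - 2 * real n < 1 + 1 / k) = Suc (LEAST n::nat. Re (z + 2)
          - 2 * real (Suc n) < 1 + 1 / k)"
        by (rule Least_Suc[of _ 1]) (use 3 W in \<open>simp_all add: W_def\<close>)
      moreover have "(LEAST n::nat. Re (z + 2) - 2 * real (Suc n) < 1 + 1 / k) = 0"
        by (rule Least_eq_0) (use 3 W in \<open>simp add: W_def\<close>)
      ultimately show ?thesis by simp
    qed
    have "\<bar>Re z\<bar> < 1 + 1 / k" using 3 unfolding W_def by (simp add: abs_if)
    then show ?thesis
      using hyp_gamma_unfold(1)[OF k, of "z + 2"] 3 W hyp_gamma_strip[OF k, of z]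
      unfolding n Let_def by (simp add: mult_ac)
  next
    case 4
    \<comment> \<open>Off \<open>pole_ray\<close> the factor does not vanish here, so the additional
      factor in the denominator of the definition can be cancelled.\<close>
    have nz: "shift_factor k (z + 1) \<noteq> 0"
      using shift_factor_eq_0_imp[OF k, of z] z 4 k unfolding pole_ray_def W_def
      using zero_less_divide_1_iff[of k] by force
    have red: "(LEAST n::nat. - (1 + 1 / k) < Re z + 2 * real n) = Suc (LEAST n::nat. - (1
        + 1 / k) < Re (z + 2) + 2 * real n)"
    proof -
      obtain m :: nat where "- Re z - 2 * real m < 1 + 1 / k" using Least_archimedean_less by blast
      then have "- (1 + 1 / k) < Re z + 2 * real m" by simp
      then have "(LEAST n::nat. - (1 + 1 / k) < Re z + 2 * real n) = Suc (LEAST n::nat. - (1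
          + 1 / k) < Re z + 2 * real (Suc n))"
        by (rule Least_Suc) (use 4 in \<open>simp add: W_def\<close>)
      then show ?thesis by (simp add: algebra_simps)
    qed
    define n where "n = (LEAST n::nat. - (1 + 1 / k) < Re (z + 2) + 2 * real n)"
    have z1: "hyp_gamma (- k) z = exp (log_hyp_gamma k (z
        + 2 * of_nat (Suc n))) / (\<Prod>j<Suc n. shift_factor k (z + 2 * of_nat j + 1))"
      using hyp_gamma_unfold(2)[OF k, of z] 4 W unfolding red n_def[symmetric] Let_def by simp
    have "(\<Prod>j<Suc n. shift_factor k (z + 2 * of_nat j + 1)) = shift_factor k (z
        + 1) * (\<Prod>j<n. shift_factor k (z + 2 + 2 * of_nat j + 1))"
      unfolding prod.lessThan_Suc_shift by (simp add: algebra_simps)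
    moreover have w: "z + 2 * of_nat (Suc n) = z + 2 + 2 * of_nat n" by simp
    ultimately have z2: "shift_factor k (z + 1) * hyp_gamma (- k) z = exp (log_hyp_gamma k (z + 2
        + 2 * of_nat n)) / (\<Prod>j<n. shift_factor k (z + 2 + 2 * of_nat j + 1))"
      using nz unfolding z1 w by simp
    have "hyp_gamma (- k) (z + 2) = exp (log_hyp_gamma k (z + 2
        + 2 * of_nat n)) / (\<Prod>j<n. shift_factor k (z + 2 + 2 * of_nat j + 1))"
    proof (cases "Re (z + 2) < 0")
      case True
      then show ?thesis using hyp_gamma_unfold(2)[OF k True] unfolding n_def[symmetric] Let_def by simp
    next
      case False
      \<comment> \<open>The point z + 2 may fall under the other branch of the definition; as
        \<open>W > 1\<close>, it then still lies in the strip.\<close>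
      have W2: "\<bar>Re (z + 2)\<bar> < 1 + 1 / k" using False 4 W unfolding r2 W_def[symmetric] by linarith
      then have "n = 0" unfolding n_def by (intro Least_eq_0) simp
      moreover note W2
      ultimately show ?thesis using hyp_gamma_strip[OF k, of "z + 2"] by simp
    qed
    then show ?thesis using z2 by simp
  qed
qed

lemma closed_pole_ray: "closed (pole_ray k)"
proof -
  have "pole_ray k = {z. Im z = 0} \<inter> {z. Re z \<le> - (1 + 1 / k)}" by (auto simp: pole_ray_def)
  moreover have "closed {z. Im z = 0}" by (intro closed_Collect_eq continuous_intros)
  ultimately show ?thesis by (simp add: closed_Int closed_halfspace_Re_le)
qed

text \<open>Induction over strips of half width \<open>W + m\<close>: a new point is moved by 2 into
  the previous strip. On the right the factor is multiplied; on the left it is divided by, and it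
  has no zeros there off \<open>pole_ray\<close>. The functional equation holds on an open
  neighbourhood, so the derivative transfers.\<close>

lemma hyp_gamma_field_differentiable:
  assumes k: "k > 0" and z: "z \<notin> pole_ray k"
  shows "hyp_gamma (- k) field_differentiable (at z)"
proof -
  define W where "W = 1 + 1 / k"
  have W: "W > 1" using k by (simp add: W_def)
  have "hyp_gamma (- k) field_differentiable (at z)" if "\<bar>Re z\<bar> < W + real m" "z \<notin> pole_ray k" for m z
    using that
  proof (induction m arbitrary: z)
    case 0
    have o: "open {z. \<bar>Re z\<bar> < W}"
    proof -
      have "{z. \<bar>Re z\<bar> < W} = {z. Re z < W} \<inter> {z. Re z > - W}" by auto
      then show ?thesis by (simp add: open_Int open_halfspace_Re_lt open_halfspace_Re_gt)
    qed
    have "(\<lambda>z. exp (log_hyp_gamma k z)) holomorphic_on {z. \<bar>Re z\<bar> < W}"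
      unfolding W_def using log_hyp_gamma_holomorphic[OF k] by (intro holomorphic_intros)
    then have "hyp_gamma (- k) holomorphic_on {z. \<bar>Re z\<bar> < W}"
      by (rule holomorphic_transform) (simp add: hyp_gamma_strip[OF k] W_def)
    then show ?case using 0 o by (intro holomorphic_on_imp_differentiable_at[OF _ o]) auto
  next
    case (Suc m)
    consider "\<bar>Re z\<bar> < W + real m" | "Re z > 1" "Re z < W + real m + 1" | "Re z < -1" "Re z > - (W
        + real m + 1)"
      using Suc.prems W by (auto simp: abs_if split: if_splits) linarith+
    then show ?case
    proof cases
      case 1 then show ?thesis using Suc by blast
    next
      case 2
      have "z - 2 \<notin> pole_ray k" unfolding pole_ray_def W_def[symmetric] using 2 W by auto
      moreover have "\<bar>Re (z - 2)\<bar> < W + real m" using 2 W by (auto simp: abs_if)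
      ultimately have d: "hyp_gamma (- k) field_differentiable (at (z - 2))" using Suc.IH by blast
      have "((\<lambda>w. hyp_gamma (- k) (w - 2)) has_field_derivative deriv (hyp_gamma (- k)) (z - 2) * (1
          - 0)) (at z)"
        by (rule DERIV_chain2[where g = "\<lambda>w. w - 2"])
           (use d in \<open>auto intro!: derivative_eq_intros simp: field_differentiable_derivI\<close>)
      then have d': "(\<lambda>w. shift_factor k (w - 1) * hyp_gamma (- k) (w - 2)) field_differentiable (at z)"
        by (intro derivative_intros field_differentiable_mult) (auto simp: field_differentiable_def
            intro!: exI derivative_eq_intros)
      have o: "open {w. Re w > 1}" by (rule open_halfspace_Re_gt)
      have "shift_factor k (w - 1) * hyp_gamma (- k) (w - 2) = hyp_gamma (- k) w" if "w
          \<in> {w. Re w > 1}" for w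
      proof -
        have "w - 2 \<notin> pole_ray k" unfolding pole_ray_def W_def[symmetric] using that W by auto
        from hyp_gamma_shift[OF k this] show ?thesis by (simp add: algebra_simps)
      qed
      with d' o 2(1) show ?thesis
        unfolding field_differentiable_def by (metis (no_types, lifting)
            has_field_derivative_transform_within_open mem_Collect_eq)
    next
      case 3
      have nz: "shift_factor k (w + 1) \<noteq> 0" if "Re w < -1" "w \<notin> pole_ray k" for w
        using shift_factor_eq_0_imp[OF k, of w] that k unfolding pole_ray_def by (auto dest: order_trans)
      have "z + 2 \<notin> pole_ray k" using Suc.prems(2) W unfolding pole_ray_def W_def[symmetric] by auto
      moreover have "\<bar>Re (z + 2)\<bar> < W + real m" using 3 W by (auto simp: abs_if)
      ultimately have d: "hyp_gamma (- k) field_differentiable (at (z + 2))" using Suc.IH by blast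
      have "((\<lambda>w. hyp_gamma (- k) (w + 2)) has_field_derivative deriv (hyp_gamma (- k)) (z + 2) * (1
          + 0)) (at z)"
        by (rule DERIV_chain2[where g = "\<lambda>w. w + 2"])
           (use d in \<open>auto intro!: derivative_eq_intros simp: field_differentiable_derivI\<close>)
      then have d': "(\<lambda>w. hyp_gamma (- k) (w + 2) / shift_factor k (w + 1)) field_differentiable (at z)"
        using nz[of z] 3 Suc.prems(2)
        by (intro field_differentiable_divide) (auto simp: field_differentiable_def intro!: exI
            derivative_eq_intros)
      have o: "open ({w. Re w < -1} \<inter> - pole_ray k)"
        by (intro open_Int open_halfspace_Re_lt open_Compl closed_pole_ray)
      have "hyp_gamma (- k) (w + 2) / shift_factor k (w + 1) = hyp_gamma (- k) w" if "w
          \<in> {w. Re w < -1} \<inter> - pole_ray k" for w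
        using that hyp_gamma_shift[OF k, of w] nz[of w] by auto
      moreover have "z \<in> {w. Re w < -1} \<inter> - pole_ray k" using 3 Suc.prems(2) by auto
      ultimately show ?thesis
        using d' o unfolding field_differentiable_def
            by (metis (no_types, lifting) has_field_derivative_transform_within_open)
    qed
  qed
  moreover obtain m :: nat where "\<bar>Re z\<bar> - W < real m" using reals_Archimedean2 by blast
  ultimately show ?thesis using z by (simp add: algebra_simps)
qed

subsection \<open>Growth of the hyperbolic gamma function\<close>

lemma norm_two_cos_bounds:
  fixes w :: complex
  shows "norm (2 * cos w) \<le> 2 * exp \<bar>Im w\<bar>"
    and "exp \<bar>Im w\<bar> - exp (- \<bar>Im w\<bar>) \<le> norm (2 * cos w)"
proof -
  have c: "2 * cos w = exp (\<i> * w) + exp (- (\<i> * w))" by (simp add: cos_exp_eq)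
  have n: "norm (exp (\<i> * w)) = exp (- Im w)" "norm (exp (- (\<i> * w))) = exp (Im w)" by simp_all
  have "norm (2 * cos w) \<le> exp (- Im w) + exp (Im w)"
    unfolding c n[symmetric] by (rule norm_triangle_ineq)
  also have "\<dots> \<le> exp \<bar>Im w\<bar> + exp \<bar>Im w\<bar>" by (intro add_mono) auto
  finally show "norm (2 * cos w) \<le> 2 * exp \<bar>Im w\<bar>" by simp
  have "\<bar>exp (- Im w) - exp (Im w)\<bar> \<le> norm (2 * cos w)"
    unfolding c n[symmetric] using norm_triangle_ineq3[of "exp (\<i> * w)" "- exp (- (\<i> * w))"] by simp
  then show "exp \<bar>Im w\<bar> - exp (- \<bar>Im w\<bar>) \<le> norm (2 * cos w)" by (auto simp: abs_if split: if_splits)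
qed

text \<open>For |Im z| \<ge> 1 the factor in the functional equation is of the exact order exp (2
  b), which is the change of the claimed bound when Re z grows by 2. Induction thus carries the
  estimate outward from |Re z| \<le> 1, and only the constant changes.\<close>

lemma norm_hyp_gamma_le:
  assumes k: "k > 0"
  shows "\<exists>C\<ge>0. \<forall>z. \<bar>Re z\<bar> \<le> N \<longrightarrow> 1 \<le> \<bar>Im z\<bar> \<longrightarrow>
    norm (hyp_gamma (- k) z) \<le> C * exp (Re z * (pi * k * \<bar>Im z\<bar> / 4))"
proof -
  define b where "b t = pi * k * \<bar>t\<bar> / 4" for t
  \<comment> \<open>The value of 1 - exp (-4 b) at height 1, where 4 b = pi k; at greater heights
    that expression is larger.\<close>
  define c0 where "c0 = 1 - exp (- (pi * k))"
  have c0: "c0 > 0" using k by (simp add: c0_def)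
  have up: "norm (shift_factor k z) \<le> 2 * exp (2 * b (Im z))"
    and lo: "1 \<le> \<bar>Im z\<bar> \<Longrightarrow> c0 * exp (2 * b (Im z)) \<le> norm (shift_factor k z)" for z
  proof -
    let ?w = "of_real pi * z * of_real k / 2"
    have "Im ?w = pi * Im z * k / 2" by simp
    then have i: "\<bar>Im ?w\<bar> = 2 * b (Im z)" using k by (simp add: abs_mult b_def)
    show "norm (shift_factor k z) \<le> 2 * exp (2 * b (Im z))"
      using norm_two_cos_bounds(1)[of ?w] unfolding i .
    assume 1: "1 \<le> \<bar>Im z\<bar>"
    have "pi * k * 1 \<le> pi * k * \<bar>Im z\<bar>" using 1 k by (intro mult_left_mono) auto
    then have "exp (- 4 * b (Im z)) \<le> exp (- (pi * k))" by (simp add: b_def)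
    then have "c0 * exp (2 * b (Im z)) \<le> (1 - exp (- 4 * b (Im z))) * exp (2 * b (Im z))"
      unfolding c0_def by (intro mult_right_mono) auto
    also have "\<dots> = exp (2 * b (Im z)) - exp (- (2 * b (Im z)))"
      by (simp add: left_diff_distrib flip: exp_add)
    also have "\<dots> \<le> norm (shift_factor k z)" using norm_two_cos_bounds(2)[of ?w] unfolding i .
    finally show "c0 * exp (2 * b (Im z)) \<le> norm (shift_factor k z)" .
  qed
  have np: "z \<notin> pole_ray k" if "1 \<le> \<bar>Im z\<bar>" for z using that by (auto simp: pole_ray_def)
  have "\<exists>C\<ge>0. \<forall>z. \<bar>Re z\<bar> \<le> 1 + 2 * real m \<longrightarrow> 1 \<le> \<bar>Im z\<bar> \<longrightarrow>
    norm (hyp_gamma (- k) z) \<le> C * exp (Re z * b (Im z))" for m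
  proof (induction m)
    case 0
    obtain C where C: "\<And>z. \<bar>Re z\<bar> \<le> 1 \<Longrightarrow> Re (log_hyp_gamma k z) \<le> Re z * (pi * k * \<bar>Im z\<bar> / 4) + C"
      using Re_log_hyp_gamma_upper[OF k] by blast
    have "norm (hyp_gamma (- k) z) \<le> exp C * exp (Re z * b (Im z))" if z: "\<bar>Re z\<bar> \<le> 1" for z
    proof -
      have "1 < 1 + 1 / k" using k by simp
      then have "norm (hyp_gamma (- k) z) = exp (Re (log_hyp_gamma k z))"
        using order_le_less_trans[OF z] by (subst hyp_gamma_strip[OF k]) (simp_all only: norm_exp_eq_Re)
      then show ?thesis using C[OF z] by (simp add: b_def add.commute flip: exp_add)
    qed
    then show ?case by (intro exI[of _ "exp C"]) auto
  next
    case (Suc m)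
    then obtain C where C: "C \<ge> 0" "\<And>z. \<bar>Re z\<bar> \<le> 1 + 2 * real m \<Longrightarrow> 1 \<le> \<bar>Im z\<bar> \<Longrightarrow>
      norm (hyp_gamma (- k) z) \<le> C * exp (Re z * b (Im z))" by blast
    \<comment> \<open>The entries serve the old strip, a step to the right and a step to the left,
      in this order.\<close>
    define C' where "C' = max C (max (2 * C) (C / c0))"
    have C': "C \<le> C'" "2 * C \<le> C'" "C / c0 \<le> C'" "0 \<le> C'" using C(1) by (auto simp: C'_def)
    have "norm (hyp_gamma (- k) z) \<le> C' * exp (Re z * b (Im z))"
      if z: "\<bar>Re z\<bar> \<le> 1 + 2 * real (Suc m)" "1 \<le> \<bar>Im z\<bar>" for z
    proof -
      consider "\<bar>Re z\<bar> \<le> 1 + 2 * real m" | "Re z \<ge> 1" | "Re z \<le> -1" by linarith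
      then show ?thesis
      proof cases
        case 1
        show ?thesis by (rule order_trans[OF C(2)[OF 1 z(2)]])
            (use C'(1) in \<open>intro mult_right_mono, auto\<close>)
      next
        case 2
        have "norm (hyp_gamma (- k) (z - 2)) \<le> C * exp (Re (z - 2) * b (Im (z - 2)))"
          using 2 z by (intro C(2)) auto
        then have "norm (shift_factor k (z - 1)) * norm (hyp_gamma (- k) (z - 2))
            \<le> (2 * exp (2 * b (Im z))) * (C * exp ((Re z - 2) * b (Im z)))"
          using up[of "z - 1"] by (intro mult_mono) auto
        also have "\<dots> = (2 * C) * exp (Re z * b (Im z))" by (simp add: left_diff_distrib flip: exp_add)
        also have "\<dots> \<le> C' * exp (Re z * b (Im z))" using C'(2) by (intro mult_right_mono) auto
        finally show ?thesis
          using hyp_gamma_shift[OF k np[of "z - 2"]] z by (simp add: norm_mult algebra_simps)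
      next
        case 3
        have l: "c0 * exp (2 * b (Im z)) \<le> norm (shift_factor k (z + 1))" using lo[of "z + 1"] z by simp
        then have nz: "norm (shift_factor k (z + 1)) > 0" using c0
            by (meson exp_gt_zero less_le_trans mult_pos_pos)
        have "norm (hyp_gamma (- k) (z + 2)) \<le> C * exp (Re (z + 2) * b (Im (z + 2)))"
          using 3 z by (intro C(2)) auto
        moreover have "hyp_gamma (- k) z = hyp_gamma (- k) (z + 2) / shift_factor k (z + 1)"
          using hyp_gamma_shift[OF k np[OF z(2)]] nz by simp
        moreover have "norm (hyp_gamma (- k) (z + 2)) / norm (shift_factor k (z + 1))
            \<le> (C * exp (Re (z + 2) * b (Im (z + 2)))) / (c0 * exp (2 * b (Im z)))"
          using calculation(1) l c0 C(1) by (intro frac_le) auto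
        ultimately have "norm (hyp_gamma (- k) z) \<le> (C * exp ((Re z
            + 2) * b (Im z))) / (c0 * exp (2 * b (Im z)))"
          by (simp add: norm_divide)
        also have "\<dots> = C / c0 * exp (Re z * b (Im z))" by (simp add: distrib_right exp_add)
        also have "\<dots> \<le> C' * exp (Re z * b (Im z))" using C'(3) by (intro mult_right_mono) auto
        finally show ?thesis .
      qed
    qed
    then show ?case using C'(4) by blast
  qed
  moreover obtain m :: nat where "N < real m" using reals_Archimedean2 by blast
  then have "N \<le> 1 + 2 * real m" by simp
  ultimately show ?thesis unfolding b_def by (meson order_trans)
qed

text \<open>The shift makes the ray of poles start at the origin.\<close>

definition hgam :: "real \<Rightarrow> complex \<Rightarrow> complex" where
  "hgam k w = hyp_gamma (- k) (w - 1 - 1 / of_real k)"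

lemma pole_ray_hgam: "k > 0 \<Longrightarrow> w - 1 - 1 / of_real k \<in> pole_ray k \<longleftrightarrow> w \<in> \<real>\<^sub>\<le>\<^sub>0"
  by (auto simp: pole_ray_def complex_nonpos_Reals_iff Re_divide_of_real Im_divide_of_real)

lemma hgam_shift:
  assumes k: "k > 0" and w: "w \<notin> \<real>\<^sub>\<le>\<^sub>0"
  shows "hgam k (w + 2) = 2 * sin (of_real pi * of_real k * w / 2) * hgam k w"
proof -
  have e: "of_real pi * (w - 1 - 1 / of_real k + 1) * of_real k / 2 = of_real pi * of_real k * w / 2
      - of_real pi / 2"
    using k by (simp add: field_simps)
  have s: "w + 2 - 1 - 1 / of_real k = w - 1 - 1 / of_real k + 2" by simp
  have "w - 1 - 1 / of_real k \<notin> pole_ray k" using w pole_ray_hgam[OF k] by simp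
  from hyp_gamma_shift[OF k this] show ?thesis
    unfolding hgam_def s e by (simp add: cos_diff)
qed

lemma hgam_holomorphic:
  assumes k: "k > 0" shows "hgam k holomorphic_on - \<real>\<^sub>\<le>\<^sub>0"
proof -
  have "hyp_gamma (- k) holomorphic_on - pole_ray k"
    using hyp_gamma_field_differentiable[OF k] by (auto simp: holomorphic_on_def intro:
        field_differentiable_at_within)
  then have "(hyp_gamma (- k) \<circ> (\<lambda>w. w - 1 - 1 / of_real k)) holomorphic_on - \<real>\<^sub>\<le>\<^sub>0"
    using pole_ray_hgam[OF k] k by (intro holomorphic_on_compose_gen[where t
        = "- pole_ray k"]) (auto intro!: holomorphic_intros)
  then show ?thesis by (simp add: hgam_def [abs_def] o_def)
qed

text \<open>Replacing |Im (z - c)| by |Im z| in the exponent costs only a constant factor, as the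
  real parts are bounded. Afterwards bounds for different c can be multiplied.\<close>

lemma norm_hgam_le:
  assumes k: "k > 0"
  shows "\<exists>C Y. \<forall>z. \<bar>Re z\<bar> \<le> N \<longrightarrow> Y \<le> \<bar>Im z\<bar> \<longrightarrow>
      norm (hgam k (z - c)) \<le> C * exp ((Re z - Re c - 1 - 1/k) * (pi * k * \<bar>Im z\<bar> / 4))"
    and "\<exists>C Y. \<forall>z. \<bar>Re z\<bar> \<le> N \<longrightarrow> Y \<le> \<bar>Im z\<bar> \<longrightarrow>
      norm (hgam k (c - z)) \<le> C * exp ((Re c - Re z - 1 - 1/k) * (pi * k * \<bar>Im z\<bar> / 4))"
proof -
  define M where "M = N + \<bar>Re c\<bar> + 1 + 1/k"
  obtain C where C: "C \<ge> 0" "\<And>z. \<bar>Re z\<bar> \<le> M \<Longrightarrow> 1 \<le> \<bar>Im z\<bar> \<Longrightarrow>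
    norm (hyp_gamma (- k) z) \<le> C * exp (Re z * (pi * k * \<bar>Im z\<bar> / 4))"
    using norm_hyp_gamma_le[OF k, of M] by blast
  have *: "norm (hyp_gamma (- k) v) \<le> C * exp (M * (pi * k * \<bar>Im c\<bar> / 4)) * exp (Re v * (pi * k *
      \<bar>Im z\<bar> / 4))"
    if v: "\<bar>Re v\<bar> \<le> M" "\<bar>Im v\<bar> = \<bar>Im z - Im c\<bar>" "1 + \<bar>Im c\<bar> \<le> \<bar>Im z\<bar>" for v z
  proof -
    have "Re v * (\<bar>Im v\<bar> - \<bar>Im z\<bar>) \<le> \<bar>Re v\<bar> * \<bar>\<bar>Im v\<bar> - \<bar>Im z\<bar>\<bar>"
      by (metis abs_ge_self abs_mult)
    also have "\<dots> \<le> M * \<bar>Im c\<bar>" using v by (intro mult_mono) linarith+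
    finally have "Re v * \<bar>Im v\<bar> \<le> M * \<bar>Im c\<bar> + Re v * \<bar>Im z\<bar>" by (simp add: right_diff_distrib)
    then have "(pi * k / 4) * (Re v * \<bar>Im v\<bar>) \<le> (pi * k / 4) * (M * \<bar>Im c\<bar> + Re v * \<bar>Im z\<bar>)"
      using k by (intro mult_left_mono) auto
    then have "Re v * (pi * k * \<bar>Im v\<bar> / 4) \<le> M * (pi * k * \<bar>Im c\<bar> / 4) + Re v * (pi * k * \<bar>Im z\<bar> / 4)"
      by (simp add: algebra_simps)
    then have "exp (Re v * (pi * k * \<bar>Im v\<bar> / 4)) \<le> exp (M * (pi * k * \<bar>Im c\<bar> / 4)) * exp (Re v *
        (pi * k * \<bar>Im z\<bar> / 4))"
      by (simp flip: exp_add)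
    then have "C * exp (Re v * (pi * k * \<bar>Im v\<bar> / 4))
        \<le> C * (exp (M * (pi * k * \<bar>Im c\<bar> / 4)) * exp (Re v * (pi * k * \<bar>Im z\<bar> / 4)))"
      using C(1) by (rule mult_left_mono)
    moreover have "norm (hyp_gamma (- k) v) \<le> C * exp (Re v * (pi * k * \<bar>Im v\<bar> / 4))" using v
        by (intro C(2)) linarith+
    ultimately show ?thesis by (simp only: mult.assoc)
  qed
  have k1: "1 / k > 0" using k by simp
  have re: "Re (u - 1 - 1 / of_real k) = Re u - 1 - 1 / k" "Im (u - 1 - 1 / of_real k) = Im u"
      for u :: complex
    by (simp_all add: Re_divide_of_real Im_divide_of_real)
  have "norm (hgam k (z - c)) \<le> C * exp (M * (pi * k * \<bar>Im c\<bar> / 4)) * exp ((Re z - Re c - 1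
      - 1/k) * (pi * k * \<bar>Im z\<bar> / 4))"
    if "\<bar>Re z\<bar> \<le> N" "1 + \<bar>Im c\<bar> \<le> \<bar>Im z\<bar>" for z
  proof -
    have r: "Re (z - c - 1 - 1 / of_real k) = Re z - Re c - 1 - 1/k" "Im (z - c - 1 - 1 / of_real k)
        = Im z - Im c"
      by (simp_all add: re del: minus_complex.sel) simp_all
    show ?thesis unfolding hgam_def r(1)[symmetric]
      by (rule *) (use that k1 in \<open>unfold r M_def, linarith+\<close>)
  qed
  then show "\<exists>C Y. \<forall>z. \<bar>Re z\<bar> \<le> N \<longrightarrow> Y \<le> \<bar>Im z\<bar> \<longrightarrow>
      norm (hgam k (z - c)) \<le> C * exp ((Re z - Re c - 1 - 1/k) * (pi * k * \<bar>Im z\<bar> / 4))" by blast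
  have "norm (hgam k (c - z)) \<le> C * exp (M * (pi * k * \<bar>Im c\<bar> / 4)) * exp ((Re c - Re z - 1
      - 1/k) * (pi * k * \<bar>Im z\<bar> / 4))"
    if "\<bar>Re z\<bar> \<le> N" "1 + \<bar>Im c\<bar> \<le> \<bar>Im z\<bar>" for z
  proof -
    have r: "Re (c - z - 1 - 1 / of_real k) = Re c - Re z - 1 - 1/k" "Im (c - z - 1 - 1 / of_real k)
        = Im c - Im z"
      by (simp_all add: re del: minus_complex.sel) simp_all
    show ?thesis unfolding hgam_def r(1)[symmetric]
      by (rule *) (use that k1 in \<open>unfold r M_def, linarith+\<close>)
  qed
  then show "\<exists>C Y. \<forall>z. \<bar>Re z\<bar> \<le> N \<longrightarrow> Y \<le> \<bar>Im z\<bar> \<longrightarrow>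
      norm (hgam k (c - z)) \<le> C * exp ((Re c - Re z - 1 - 1/k) * (pi * k * \<bar>Im z\<bar> / 4))" by blast
qed

section \<open>Products of hyperbolic gamma functions over half lines\<close>

definition ray_product :: "real \<Rightarrow> complex list \<Rightarrow> complex list \<Rightarrow> complex \<Rightarrow> complex" where
  "ray_product k ls rs z = (\<Prod>l\<leftarrow>ls. hgam k (z - l)) * (\<Prod>r\<leftarrow>rs. hgam k (r - z))"

lemma prod_list_exp_bound:
  fixes f :: "'b \<Rightarrow> complex \<Rightarrow> complex"
  assumes "\<And>x. x \<in> set xs \<Longrightarrow> \<exists>C Y. \<forall>z. \<bar>Re z\<bar> \<le> N \<longrightarrow> Y \<le> \<bar>Im z\<bar> \<longrightarrow> norm (f x z) \<le> C * exp (e x z)"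
  shows "\<exists>C Y. \<forall>z. \<bar>Re z\<bar> \<le> N \<longrightarrow> Y \<le> \<bar>Im z\<bar> \<longrightarrow> norm (\<Prod>x\<leftarrow>xs. f x z) \<le> C * exp (\<Sum>x\<leftarrow>xs. e x z)"
  using assms
proof (induction xs)
  case (Cons x xs)
  from Cons.prems[of x] obtain C Y where 1: "\<And>z. \<bar>Re z\<bar> \<le> N \<Longrightarrow> Y \<le> \<bar>Im z\<bar> \<Longrightarrow> norm (f x z)
      \<le> C * exp (e x z)" by auto
  from Cons obtain D V where 2: "\<And>z. \<bar>Re z\<bar> \<le> N \<Longrightarrow> V \<le> \<bar>Im z\<bar> \<Longrightarrow> norm (\<Prod>x\<leftarrow>xs. f x z)
      \<le> D * exp (\<Sum>x\<leftarrow>xs. e x z)"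
    by (metis list.set_intros(2))
  have "norm (\<Prod>x\<leftarrow>x # xs. f x z) \<le> C * D * exp (\<Sum>x\<leftarrow>x # xs. e x z)" if "\<bar>Re z\<bar> \<le> N" "max Y V \<le> \<bar>Im z\<bar>" for z
  proof -
    have "norm (f x z) * norm (\<Prod>x\<leftarrow>xs. f x z) \<le> (C * exp (e x z)) * (D * exp (\<Sum>x\<leftarrow>xs. e x z))"
      using 1[of z] 2[of z] that by (intro mult_mono) (auto intro: order_trans[OF norm_ge_zero])
    then show ?thesis by (simp add: norm_mult exp_add mult_ac)
  qed
  then show ?case by blast
qed (intro exI[of _ 1], simp)

text \<open>With equally many left and right factors the contributions of Re z cancel, so the rate
  in |Im z| depends on the initial points only through their sums.\<close>

lemma norm_ray_product_le:
  assumes k: "k > 0" and len: "length ls = length rs"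
  shows "\<exists>C Y. \<forall>z. \<bar>Re z\<bar> \<le> N \<longrightarrow> Y \<le> \<bar>Im z\<bar> \<longrightarrow>
    norm (ray_product k ls rs z) \<le> C * exp ((Re (sum_list rs) - Re (sum_list ls)
        - 2 * length ls * (1 + 1/k)) * (pi * k * \<bar>Im z\<bar> / 4))"
proof -
  obtain C Y where 1: "\<And>z. \<bar>Re z\<bar> \<le> N \<Longrightarrow> Y \<le> \<bar>Im z\<bar> \<Longrightarrow>
      norm (\<Prod>l\<leftarrow>ls. hgam k (z - l)) \<le> C * exp (\<Sum>l\<leftarrow>ls. (Re z - Re l - 1 - 1/k) * (pi * k * \<bar>Im z\<bar> / 4))"
    using prod_list_exp_bound[of ls N "\<lambda>l z. hgam k (z - l)" "\<lambda>l z. (Re z - Re l - 1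
        - 1/k) * (pi * k * \<bar>Im z\<bar> / 4)"]
      norm_hgam_le(1)[OF k] by blast
  obtain D V where 2: "\<And>z. \<bar>Re z\<bar> \<le> N \<Longrightarrow> V \<le> \<bar>Im z\<bar> \<Longrightarrow>
      norm (\<Prod>r\<leftarrow>rs. hgam k (r - z)) \<le> D * exp (\<Sum>r\<leftarrow>rs. (Re r - Re z - 1 - 1/k) * (pi * k * \<bar>Im z\<bar> / 4))"
    using prod_list_exp_bound[of rs N "\<lambda>r z. hgam k (r - z)" "\<lambda>r z. (Re r - Re z - 1
        - 1/k) * (pi * k * \<bar>Im z\<bar> / 4)"]
      norm_hgam_le(2)[OF k] by blast
  have s1: "(\<Sum>l\<leftarrow>ls. (Re z - Re l - 1 - 1/k) * B) = (length ls * (Re z - 1 - 1/k)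
      - Re (sum_list ls)) * B" for z B
    by (induction ls) (simp_all add: algebra_simps)
  have s2: "(\<Sum>r\<leftarrow>rs. (Re r - Re z - 1 - 1/k) * B) = (Re (sum_list rs) - length rs * (Re z + 1
      + 1/k)) * B" for z B
    by (induction rs) (simp_all add: algebra_simps)
  have "norm (ray_product k ls rs z) \<le> C * D * exp ((Re (sum_list rs) - Re (sum_list ls)
      - 2 * length ls * (1 + 1/k)) * (pi * k * \<bar>Im z\<bar> / 4))"
    if z: "\<bar>Re z\<bar> \<le> N" "max Y V \<le> \<bar>Im z\<bar>" for z
  proof -
    let ?B = "pi * k * \<bar>Im z\<bar> / 4"
    have "norm (ray_product k ls rs z) \<le> (C * exp (\<Sum>l\<leftarrow>ls. (Re z - Re l - 1
        - 1/k) * ?B)) * (D * exp (\<Sum>r\<leftarrow>rs. (Re r - Re z - 1 - 1/k) * ?B))"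
      unfolding ray_product_def norm_mult using 1[of z] 2[of z] z
          by (intro mult_mono) (auto intro: order_trans[OF norm_ge_zero])
    also have "\<dots> = C * D * exp ((length ls * (Re z - 1 - 1/k) - Re (sum_list ls)) * ?B
        + (Re (sum_list rs) - length rs * (Re z + 1 + 1/k)) * ?B)"
      unfolding s1 s2 exp_add by simp
    also have "(length ls * (Re z - 1 - 1/k) - Re (sum_list ls)) * ?B + (Re (sum_list rs)
        - length rs * (Re z + 1 + 1/k)) * ?B
       = (Re (sum_list rs) - Re (sum_list ls) - 2 * length ls * (1 + 1/k)) * ?B"
      unfolding len distrib_right[symmetric] by (rule arg_cong2[where f
          = times]) (simp_all add: algebra_simps)
    finally show ?thesis .
  qed
  then show ?thesis by blast
qed

subsection \<open>Integration along deformations of the imaginary axis\<close>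

lemma in_left_ray_iff: "z \<in> left_ray p \<longleftrightarrow> Im z = Im p \<and> Re z \<le> Re p"
proof
  assume "Im z = Im p \<and> Re z \<le> Re p"
  then show "z \<in> left_ray p"
    unfolding left_ray_def by (intro image_eqI[of _ _ "Re z - Re p"]) (auto simp: complex_eq_iff)
qed (auto simp: left_ray_def)

lemma in_right_ray_iff: "z \<in> right_ray p \<longleftrightarrow> Im z = Im p \<and> Re p \<le> Re z"
proof
  assume "Im z = Im p \<and> Re p \<le> Re z"
  then show "z \<in> right_ray p"
    unfolding right_ray_def by (intro image_eqI[of _ _ "Re z - Re p"]) (auto simp: complex_eq_iff)
qed (auto simp: right_ray_def)

definition ray_complement :: "complex set \<Rightarrow> complex set \<Rightarrow> complex set" where
  "ray_complement L R = {z. (\<forall>p\<in>L. z \<notin> left_ray p) \<and> (\<forall>p\<in>R. z \<notin> right_ray p)}"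

lemma open_ray_complement:
  assumes "finite L" "finite R" shows "open (ray_complement L R)"
proof -
  have i: "closed {z. Im z = c}" for c by (intro closed_Collect_eq continuous_intros)
  have "left_ray p = {z. Im z = Im p} \<inter> {z. Re z \<le> Re p}" "right_ray p = {z. Im z
      = Im p} \<inter> {z. Re z \<ge> Re p}" for p
    by (auto simp: in_left_ray_iff in_right_ray_iff)
  then have "closed (left_ray p)" "closed (right_ray p)" for p
    using i by (simp_all add: closed_Int closed_halfspace_Re_le closed_halfspace_Re_ge)
  then have "closed ((\<Union>p\<in>L. left_ray p) \<union> (\<Union>p\<in>R. right_ray p))"
    using assms by (intro closed_Un closed_UN) auto
  moreover have "ray_complement L R = - ((\<Union>p\<in>L. left_ray p) \<union> (\<Union>p\<in>R. right_ray p))"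
    by (auto simp: ray_complement_def)
  ultimately show ?thesis by (simp only: open_Compl)
qed

section \<open>Contours passing the half lines on prescribed sides\<close>

lemma interpolating_bump:
  fixes h e :: real assumes e: "e > 0"
  obtains c c' where "\<And>t. (c has_real_derivative c' t) (at t)" "continuous_on UNIV c'" "c h = 1"
    "\<And>t. \<bar>t - h\<bar> \<ge> e \<Longrightarrow> c t = (0::real)"
proof
  define u where "u t = 1 - ((t - h) / e)\<^sup>2" for t
  \<comment> \<open>Squaring the positive part of a concave parabola removes its corners: the result
    is continuously differentiable.\<close>
  define c where "c t = (max 0 (u t))\<^sup>2" for t
  define c' where "c' t = 2 * max 0 (u t) * (2 * ((t - h) / e) * (- 1 / e))" for t
  have sq: "((\<lambda>x::real. (max 0 x)\<^sup>2) has_real_derivative 2 * max 0 x) (at x)" for x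
  proof -
    have "((\<lambda>y. ((max 0 y)\<^sup>2 - (max 0 x)\<^sup>2) / (y - x) - 2 * max 0 x) \<longlongrightarrow> 0) (at x)"
    proof (rule Lim_null_comparison)
      show "\<forall>\<^sub>F y in at x. norm (((max 0 y)\<^sup>2 - (max 0 x)\<^sup>2) / (y - x) - 2 * max 0 x) \<le> \<bar>y - x\<bar>"
        unfolding eventually_at_topological
      proof (intro exI[of _ UNIV] conjI ballI impI)
        fix y :: real assume "y \<noteq> x"
        have "\<bar>(max 0 y)\<^sup>2 - (max 0 x)\<^sup>2 - 2 * max 0 x * (y - x)\<bar> \<le> (y - x)\<^sup>2"
        proof -
          consider "x \<ge> 0" "y \<ge> 0" | "x \<ge> 0" "y < 0" | "x < 0" "y \<ge> 0" | "x < 0" "y < 0" by linarith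
          then show ?thesis
          proof cases
            case 1
            then have "(max 0 y)\<^sup>2 - (max 0 x)\<^sup>2 - 2 * max 0 x * (y - x) = (y - x)\<^sup>2"
              by (simp add: power2_eq_square algebra_simps)
            then show ?thesis by simp
          next
            case 2
            then have e: "(max 0 y)\<^sup>2 - (max 0 x)\<^sup>2 - 2 * max 0 x * (y - x) = x\<^sup>2 - 2 * (x * y)"
              by (simp add: max_def power2_eq_square algebra_simps)
            have "x * y \<le> 0" using 2 by (simp add: mult_nonneg_nonpos)
            then have "\<bar>x\<^sup>2 - 2 * (x * y)\<bar> = x\<^sup>2 - 2 * (x * y)" using zero_le_power2[of x] by linarith
            also have "\<dots> \<le> (y - x)\<^sup>2" by (simp add: power2_diff mult.commute)
            finally show ?thesis unfolding e .
          next
            case 3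
            then have "y\<^sup>2 \<le> (y - x)\<^sup>2" by (intro power_mono) auto
            then show ?thesis using 3 by simp
          qed simp
        qed
        then have le: "\<bar>(max 0 y)\<^sup>2 - (max 0 x)\<^sup>2 - 2 * max 0 x * (y - x)\<bar> / \<bar>y - x\<bar> \<le> (y
            - x)\<^sup>2 / \<bar>y - x\<bar>"
          by (rule divide_right_mono) simp
        have e1: "((max 0 y)\<^sup>2 - (max 0 x)\<^sup>2) / (y - x) - 2 * max 0 x = ((max 0 y)\<^sup>2 - (max 0 x)\<^sup>2
            - 2 * max 0 x * (y - x)) / (y - x)"
          using \<open>y \<noteq> x\<close> by (simp add: diff_divide_distrib)
        have e2: "(y - x)\<^sup>2 / \<bar>y - x\<bar> = \<bar>y - x\<bar>" 
        proof -
          have "(y - x)\<^sup>2 = \<bar>y - x\<bar> * \<bar>y - x\<bar>" by (simp add: power2_eq_square)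
          moreover have "\<bar>y - x\<bar> \<noteq> 0" using \<open>y \<noteq> x\<close> by simp
          ultimately show ?thesis by (metis nonzero_mult_div_cancel_left)
        qed
        show "norm (((max 0 y)\<^sup>2 - (max 0 x)\<^sup>2) / (y - x) - 2 * max 0 x) \<le> \<bar>y - x\<bar>"
          unfolding e1 real_norm_def abs_divide using le unfolding e2 .
      qed auto
      show "((\<lambda>y. \<bar>y - x\<bar>) \<longlongrightarrow> 0) (at x)" by (auto intro!: tendsto_eq_intros)
    qed
    then show ?thesis by (simp add: has_field_derivative_iff LIM_zero_iff)
  qed
  have "(u has_real_derivative - (2 * ((t - h) / e) * (1 / e))) (at t)" for t
    unfolding u_def using e by (auto intro!: derivative_eq_intros)
  from DERIV_chain2[OF sq this] show "(c has_real_derivative c' t) (at t)" for t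
    unfolding c_def [abs_def] c'_def by simp
  show "continuous_on UNIV c'" unfolding c'_def u_def using e by (auto intro!: continuous_intros)
  show "c h = 1" by (simp add: c_def u_def)
  fix t assume "\<bar>t - h\<bar> \<ge> e"
  then have "1 \<le> \<bar>(t - h) / e\<bar>" using e by (simp add: abs_divide)
  from one_le_power[OF this, of 2] have "1 \<le> ((t - h) / e)\<^sup>2" by (simp only: power2_abs)
  then show "c t = 0" by (simp add: c_def u_def)
qed

lemma interpolating_profile:
  fixes H :: "real set" and v :: "real \<Rightarrow> real"
  assumes "finite H"
  shows "\<exists>c c' M. (\<forall>t. (c has_real_derivative c' t) (at t)) \<and> continuous_on UNIV c' \<and> (\<forall>h\<in>H. c h = v h) \<and>
    (\<forall>t. \<bar>t\<bar> > M \<longrightarrow> c t = 0)"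
  using assms
proof (induction H)
  case empty
  then show ?case by (intro exI[of _ "\<lambda>_. 0"]) auto
next
  case (insert h H)
  then obtain c c' M where c: "\<And>t. (c has_real_derivative c' t) (at t)" "continuous_on UNIV c'" "\<And>h.
      h \<in> H \<Longrightarrow> c h = v h"
    "\<And>t. \<bar>t\<bar> > M \<Longrightarrow> c t = 0" by metis
  \<comment> \<open>The radius is so small that the new bump vanishes at all heights already
    treated, and their values are kept.\<close>
  obtain e where e: "e > 0" "\<And>x. x \<in> H \<Longrightarrow> x \<noteq> h \<Longrightarrow> e \<le> dist h x"
    using finite_set_avoid[OF insert(1), of h] by blast
  obtain b b' where b: "\<And>t. (b has_real_derivative b' t) (at t)" "continuous_on UNIV b'" "b h = 1"
    "\<And>t. \<bar>t - h\<bar> \<ge> e \<Longrightarrow> b t = 0" using interpolating_bump[OF e(1), of h] by blast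
  let ?c = "\<lambda>t. c t + (v h - c h) * b t" and ?c' = "\<lambda>t. c' t + (v h - c h) * b' t"
  have "(?c has_real_derivative ?c' t) (at t)" for t using c(1) b(1)
      by (auto intro!: derivative_eq_intros)
  moreover have "continuous_on UNIV ?c'" using c(2) b(2) by (intro continuous_intros)
  moreover have "?c x = v x" if "x \<in> insert h H" for x
  proof (cases "x = h")
    case False
    then have "b x = 0" using that e(2)[of x] by (intro b(4)) (auto simp: dist_real_def abs_minus_commute)
    then show ?thesis using that False c(3) by auto
  qed (simp add: b)
  moreover have "?c t = 0" if "\<bar>t\<bar> > max M (\<bar>h\<bar> + e)" for t
  proof -
    have "M < \<bar>t\<bar>" "e \<le> \<bar>t - h\<bar>" using that by linarith+
    then show ?thesis using c(4)[of t] b(4)[of t] by simp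
  qed
  ultimately show ?case by (intro exI[of _ ?c] exI[of _ ?c'] exI[of _ "max M (\<bar>h\<bar>
      + e)"] conjI allI impI ballI)
qed

text \<open>On its horizontal line the initial point of a half line is the one nearest to the
  contour, so it decides for the whole half line.\<close>

lemma separates_iff:
  "separates g (\<Union>p\<in>L. left_ray p) (\<Union>p\<in>R. right_ray p) \<longleftrightarrow>
    (\<forall>p\<in>L. \<forall>t. Im (g t) = Im p \<longrightarrow> Re p < Re (g t)) \<and> (\<forall>p\<in>R. \<forall>t. Im (g t) = Im p \<longrightarrow> Re (g t) < Re p)"
  unfolding separates_def by (fastforce simp: in_left_ray_iff in_right_ray_iff)

lemma profile_exists:
  assumes fin: "finite L" "finite R" and dis: "Im ` L \<inter> Im ` R = {}"
  obtains c c' M where "\<And>t. (c has_real_derivative c' t) (at t)" "continuous_on UNIV c'"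
    "\<And>p. p \<in> L \<Longrightarrow> Re p < c (Im p)" "\<And>p. p \<in> R \<Longrightarrow> c (Im p) < Re p" "\<And>t. \<bar>t\<bar> > M \<Longrightarrow> c t = 0"
proof -
  \<comment> \<open>B exceeds every |Re p|. The graph takes the value B at the heights of L and -B
    at those of R, which is consistent because no height occurs in both.\<close>
  define B where "B = (\<Sum>p\<in>L \<union> R. \<bar>Re p\<bar>) + 1"
  have B: "\<bar>Re p\<bar> < B" if "p \<in> L \<union> R" for p
    using member_le_sum[OF that, of "\<lambda>p. \<bar>Re p\<bar>"] fin unfolding B_def by auto
  obtain c c' M where c: "\<And>t. (c has_real_derivative c' t) (at t)" "continuous_on UNIV c'"
    "\<And>h. h \<in> Im ` (L \<union> R) \<Longrightarrow> c h = (if h \<in> Im ` L then B else - B)" "\<And>t. \<bar>t\<bar> > M \<Longrightarrow> c t = 0"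
    using interpolating_profile[of "Im ` (L \<union> R)" "\<lambda>h. if h \<in> Im ` L then B else - B"] fin
        by (metis finite_Un finite_imageI)
  show ?thesis
  proof (rule that[OF c(1,2) _ _ c(4)])
    show "Re p < c (Im p)" if "p \<in> L" for p using that c(3)[of "Im p"] B[of p] by auto
    show "c (Im p) < Re p" if "p \<in> R" for p
    proof -
      have "Im p \<notin> Im ` L" using dis that by auto
      then show ?thesis using that c(3)[of "Im p"] B[of p] by auto
    qed
  qed
qed

lemma contour_exists:
  assumes "finite L" "finite R" "Im ` L \<inter> Im ` R = {}"
  obtains g where "deformation_of_imag_axis g"
    "separates g (\<Union>p\<in>L. left_ray p) (\<Union>p\<in>R. right_ray p)"
proof -
  obtain c c' M where c: "\<And>t. (c has_real_derivative c' t) (at t)" "continuous_on UNIV c'"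
    "\<And>p. p \<in> L \<Longrightarrow> Re p < c (Im p)" "\<And>p. p \<in> R \<Longrightarrow> c (Im p) < Re p" "\<And>t. \<bar>t\<bar> > M \<Longrightarrow> c t = 0"
    using profile_exists[OF assms] by blast
  define g where "g t = complex_of_real (c t) + \<i> * of_real t" for t
  have "(g has_vector_derivative (of_real (c' t) + \<i>)) (at t)" for t
    unfolding g_def by (auto intro!: derivative_eq_intros has_vector_derivative_of_real
       simp: has_real_derivative_iff_has_vector_derivative[symmetric] c(1))
  then have "g C1_differentiable_on UNIV"
    unfolding C1_differentiable_on_def using c(2) by (intro exI[of _ "\<lambda>t. of_real (c' t)
        + \<i>"]) (auto intro!: continuous_intros)
  then have "g piecewise_C1_differentiable_on UNIV" by (rule C1_differentiable_imp_piecewise)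
  moreover have "Im \<circ> g = id" by (auto simp: g_def)
  moreover have "g t = \<i> * of_real (Im (g t))" if "\<bar>Im (g t)\<bar> > M" for t
    using c(5)[of t] that by (simp add: g_def)
  ultimately have "deformation_of_imag_axis g" unfolding deformation_of_imag_axis_def
      by (auto simp: strict_mono_def)
  moreover have "separates g (\<Union>p\<in>L. left_ray p) (\<Union>p\<in>R. right_ray p)"
    unfolding separates_iff using c(3,4) by (auto simp: g_def)
  ultimately show ?thesis by (rule that)
qed

text \<open>Sliding points horizontally onto a separating graph contracts the complement of the rays.\<close>

lemma contractible_ray_complement:
  assumes "finite L" "finite R" "Im ` L \<inter> Im ` R = {}"
  shows "contractible (ray_complement L R)"
proof -
  let ?S = "ray_complement L R"
  obtain c c' M where c: "\<And>t. (c has_real_derivative c' t) (at t)" "continuous_on UNIV c'"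
    "\<And>p. p \<in> L \<Longrightarrow> Re p < c (Im p)" "\<And>p. p \<in> R \<Longrightarrow> c (Im p) < Re p" "\<And>t. \<bar>t\<bar> > M \<Longrightarrow> c t = 0"
    using profile_exists[OF assms] by blast
  define q where "q t = Complex (c t) t" for t
  have cc: "continuous_on A c" for A using c(1) DERIV_isCont continuous_at_imp_continuous_on by blast
  have cq: "continuous_on UNIV q" unfolding q_def by (intro continuous_on_Complex continuous_intros cc)
  have "homotopic_with_canon (\<lambda>_. True) ?S ?S id (q \<circ> Im)"
  proof (rule homotopic_with_linear)
    show "continuous_on ?S (q \<circ> Im)" by (intro continuous_on_compose continuous_intros
        continuous_on_subset[OF cq]) auto
    fix z assume z: "z \<in> ?S"
    show "closed_segment (id z) ((q \<circ> Im) z) \<subseteq> ?S"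
    proof
      fix w assume "w \<in> closed_segment (id z) ((q \<circ> Im) z)"
      then obtain u where u: "0 \<le> u" "u \<le> 1" "w = (1 - u) *\<^sub>R z + u *\<^sub>R q (Im z)"
          by (auto simp: closed_segment_def)
      have i: "Im w = Im z" unfolding u(3) by (simp add: q_def left_diff_distrib)
      have r: "Re w = (1 - u) * Re z + u * c (Im z)" using u(3) by (simp add: q_def)
      have "w \<notin> left_ray p" if p: "p \<in> L" for p
      proof
        assume w: "w \<in> left_ray p"
        then have "Re z > Re p" using z p i by (auto simp: ray_complement_def in_left_ray_iff)
        moreover have "c (Im z) > Re p" using c(3)[OF p] w i by (simp add: in_left_ray_iff)
        ultimately have "(1 - u) * Re z + u * c (Im z) > Re p"
            using convex_bound_lt[of "- Re z" "- Re p" "- c (Im z)" "1 - u" u] u by simp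
        then show False using w r by (simp add: in_left_ray_iff)
      qed
      moreover have "w \<notin> right_ray p" if p: "p \<in> R" for p
      proof
        assume w: "w \<in> right_ray p"
        then have "Re z < Re p" using z p i by (auto simp: ray_complement_def in_right_ray_iff)
        moreover have "c (Im z) < Re p" using c(4)[OF p] w i by (simp add: in_right_ray_iff)
        ultimately have "(1 - u) * Re z + u * c (Im z) < Re p"
            using convex_bound_lt[of "Re z" "Re p" "c (Im z)" "1 - u" u] u by simp
        then show False using w r by (simp add: in_right_ray_iff)
      qed
      ultimately show "w \<in> ?S" by (simp add: ray_complement_def)
    qed
  qed auto
  \<comment> \<open>The end of the homotopy factors through Im and hence through the contractible
    real line.\<close>
  moreover obtain a where "homotopic_with_canon (\<lambda>_. True) ?S ?S (q \<circ> Im) (\<lambda>_. a)"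
  proof (rule nullhomotopic_through_contractible[of ?S Im UNIV q ?S])
    have "q t \<in> ?S" for t using c(3,4) by (force simp: ray_complement_def in_left_ray_iff
        in_right_ray_iff q_def)
    then show "q \<in> UNIV \<rightarrow> ?S" by auto
  qed (auto intro!: continuous_intros cq)
  ultimately show ?thesis unfolding contractible_def using homotopic_with_trans by blast
qed

section \<open>Line integrals through primitives\<close>

lemma ray_complement_primitive:
  assumes "finite L" "finite R" "Im ` L \<inter> Im ` R = {}" "f holomorphic_on ray_complement L R"
  obtains F where "\<And>z. z \<in> ray_complement L R \<Longrightarrow> (F has_field_derivative f z) (at z)"
proof -
  have "simply_connected (ray_complement L R)"
    by (intro contractible_imp_simply_connected contractible_ray_complement assms)
  then show ?thesis
    using simply_connected_eq_global_primitive[OF open_ray_complement[OF assms(1,2)]] assms(4) that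
        by blast
qed

lemma has_integral_UNIV_limits:
  fixes f h :: "real \<Rightarrow> complex"
  assumes int: "\<And>a b. a \<le> b \<Longrightarrow> (f has_integral (h b - h a)) {a..b}"
    and T: "(h \<longlongrightarrow> T) at_top" and B: "(h \<longlongrightarrow> B) at_bot"
  shows "(f has_integral (T - B)) UNIV"
  unfolding has_integral_alt'
proof (intro conjI allI impI)
  show "(\<lambda>x. if x \<in> UNIV then f x else 0) integrable_on cbox a b" for a b
    using int[of a b] by (cases "a \<le> b") auto
  fix e :: real assume e: "e > 0"
  have "\<forall>\<^sub>F b in at_top. dist (h b) T < e/2" using e by (intro tendstoD[OF T]) simp
  then obtain b0 where b0: "\<And>b. b \<ge> b0 \<Longrightarrow> dist (h b) T < e/2" unfolding eventually_at_top_linorder by blast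
  have "\<forall>\<^sub>F a in at_bot. dist (h a) B < e/2" using e by (intro tendstoD[OF B]) simp
  then obtain a0 where a0: "\<And>a. a \<le> a0 \<Longrightarrow> dist (h a) B < e/2" unfolding eventually_at_bot_linorder by blast
  define K where "K = \<bar>a0\<bar> + \<bar>b0\<bar> + 1"
  have "norm (integral (cbox a b) (\<lambda>x. if x \<in> UNIV then f x else 0) - (T - B)) < e"
    if ab: "ball 0 K \<subseteq> cbox a b" for a b
  proof -
    have "- \<bar>a0\<bar> \<in> cbox a b" "\<bar>b0\<bar> \<in> cbox a b" using ab by (rule subsetD; simp add: K_def)+
    then have r: "a \<le> - \<bar>a0\<bar>" "a \<le> b" "\<bar>b0\<bar> \<le> b" by auto
    have "a \<le> a0" "b0 \<le> b" using r abs_ge_minus_self[of a0] abs_ge_self[of b0] by linarith+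
    then have d: "dist (h b) T < e/2" "dist (h a) B < e/2" using a0 b0 by blast+
    have "integral (cbox a b) (\<lambda>x. if x \<in> UNIV then f x else 0) - (T - B) = (h b - T) - (h a - B)"
      using integral_unique[OF int[OF r(2)]] by simp
    then show ?thesis using norm_triangle_ineq4[of "h b - T" "h a - B"] d unfolding dist_norm
        by (simp only:)
  qed
  then show "\<exists>K>0. \<forall>a b. ball 0 K \<subseteq> cbox a b \<longrightarrow> norm (integral (cbox a b) (\<lambda>x. if x
      \<in> UNIV then f x else 0) - (T - B)) < e"
    by (intro exI[of _ K]) (auto simp: K_def)
qed

text \<open>The limits are taken on the imaginary axis only: along g the imaginary part is monotone
  and onto, and g lies on the axis at large heights. Hence the value does not involve g.\<close>

lemma has_line_integral_primitive:
  assumes g: "deformation_of_imag_axis g"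
    and F: "\<And>t. (F has_field_derivative f (g t)) (at (g t))"
    and top: "((\<lambda>t. F (\<i> * of_real t)) \<longlongrightarrow> T) at_top" and bot: "((\<lambda>t. F (\<i> * of_real t)) \<longlongrightarrow> B) at_bot"
  shows "has_line_integral f (T - B) g"
proof -
  from g obtain S M where cg: "continuous_on UNIV g" and S: "finite S" "g C1_differentiable_on (UNIV - S)"
    and mono: "strict_mono (Im \<circ> g)" and sj: "surj (Im \<circ> g)" and M: "\<And>t. \<bar>Im (g t)\<bar> > M \<Longrightarrow> g t
        = \<i> * of_real (Im (g t))"
    unfolding deformation_of_imag_axis_def piecewise_C1_differentiable_on_def by blast
  have gt: "filterlim (\<lambda>t. Im (g t)) at_top at_top"
    unfolding filterlim_at_top
  proof
    fix Z from surjD[OF sj, of Z] obtain t0 where t0: "Z = Im (g t0)" by auto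
    show "\<forall>\<^sub>F t in at_top. Z \<le> Im (g t)"
      unfolding eventually_at_top_linorder t0 using monoD[OF strict_mono_mono[OF mono]]
          by (intro exI[of _ t0]) simp
  qed
  have gb: "filterlim (\<lambda>t. Im (g t)) at_bot at_bot"
    unfolding filterlim_at_bot
  proof
    fix Z from surjD[OF sj, of Z] obtain t0 where t0: "Z = Im (g t0)" by auto
    show "\<forall>\<^sub>F t in at_bot. Im (g t) \<le> Z"
      unfolding eventually_at_bot_linorder t0 using monoD[OF strict_mono_mono[OF mono]]
          by (intro exI[of _ t0]) simp
  qed
  have "\<forall>\<^sub>F t in at_top. F (\<i> * of_real (Im (g t))) = F (g t)"
    using gt[unfolded filterlim_at_top, rule_format, of "\<bar>M\<bar> + 1"] by eventually_elim (use M in force)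
  with filterlim_compose[OF top gt] have T: "((\<lambda>t. F (g t)) \<longlongrightarrow> T) at_top"
      by (rule Lim_transform_eventually)
  have "\<forall>\<^sub>F t in at_bot. F (\<i> * of_real (Im (g t))) = F (g t)"
    using gb[unfolded filterlim_at_bot, rule_format, of "- (\<bar>M\<bar> + 1)"] by eventually_elim (use M in force)
  with filterlim_compose[OF bot gb] have B: "((\<lambda>t. F (g t)) \<longlongrightarrow> B) at_bot"
      by (rule Lim_transform_eventually)
  \<comment> \<open>At the finitely many corners of g continuity is enough for the strong form of
    the fundamental theorem.\<close>
  have int: "((\<lambda>t. f (g t) * vector_derivative g (at t)) has_integral (F (g b) - F (g a))) {a..b}"
      if "a \<le> b" for a b
  proof (rule fundamental_theorem_of_calculus_strong[OF S(1) that])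
    show "((\<lambda>t. F (g t)) has_vector_derivative f (g t) * vector_derivative g (at t)) (at t)" if "t
        \<in> {a..b} - S" for t
    proof -
      have "g differentiable at t" using S(2) that by (auto simp: C1_differentiable_on_eq)
      then have "(g has_vector_derivative vector_derivative g (at t)) (at t)"
          by (simp add: vector_derivative_works)
      from field_vector_diff_chain_at[OF this F] show ?thesis by (simp add: o_def mult.commute)
    qed
    have "isCont g t" for t using cg continuous_on_eq_continuous_at[OF open_UNIV] by blast
    then have "isCont (\<lambda>t. F (g t)) t" for t
      using DERIV_isCont[OF F[of t]] by (rule isCont_o2[where f = g and g = F])
    then show "continuous_on {a..b} (\<lambda>t. F (g t))" by (simp add: continuous_at_imp_continuous_on)
  qed
  show ?thesis
    unfolding has_line_integral_def by (rule has_integral_UNIV_limits[OF int T B])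
qed

text \<open>\<open>E s\<close> is the integral of the bound from s to infinity, so it dominates all
  increments of p beyond s. Completeness gives a limit along the integers, and the same estimate
  extends it to real t.\<close>

lemma exponential_decay_imp_convergent:
  fixes p :: "real \<Rightarrow> complex"
  assumes d: "d > 0" and der: "\<And>t. t \<ge> Y \<Longrightarrow> (p has_vector_derivative p' t) (at t)"
    and bd: "\<And>t. t \<ge> Y \<Longrightarrow> norm (p' t) \<le> C * exp (- d * t)"
  shows "\<exists>L. (p \<longlongrightarrow> L) at_top"
proof -
  define E where "E t = C / d * exp (- d * t)" for t
  have C: "C \<ge> 0" using order_trans[OF norm_ge_zero bd[OF order_refl]] by (simp add: zero_le_mult_iff)
  have le: "norm (p t - p s) \<le> E s" if "Y \<le> s" "s < t" for s t
  proof -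
    have "norm (p t - p s) \<le> - E t - - E s"
    proof (rule differentiable_bound_general[OF that(2)])
      show "continuous_on {s..t} p"
        using that by (intro continuous_at_imp_continuous_on ballI
            has_vector_derivative_continuous[OF der]) auto
      show "(p has_vector_derivative p' x) (at x)" if "s < x" "x < t" for x using that \<open>Y \<le> s\<close>
          by (intro der) simp
      show "((\<lambda>t. - E t) has_vector_derivative C * exp (- d * x)) (at x)" for x
        unfolding E_def has_real_derivative_iff_has_vector_derivative[symmetric]
        by (rule derivative_eq_intros refl)+ (use d in simp)
      show "norm (p' x) \<le> C * exp (- d * x)" if "s < x" "x < t" for x using that \<open>Y \<le> s\<close>
          by (intro bd) simp
      show "continuous_on {s..t} (\<lambda>t. - E t)" unfolding E_def by (intro continuous_intros) (use d in simp)
    qed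
    also have "\<dots> \<le> E s" using C d by (simp add: E_def)
    finally show ?thesis .
  qed
  have E0: "(E \<longlongrightarrow> 0) at_top" unfolding E_def using d by real_asymp
  have "Cauchy (\<lambda>n. p (real n))"
  proof (rule metric_CauchyI)
    fix e :: real assume e: "e > 0"
    obtain K where K: "\<And>t. t \<ge> K \<Longrightarrow> \<bar>E t\<bar> < e" using tendstoD[OF E0 e]
        unfolding eventually_at_top_linorder by auto
    obtain N :: nat where N: "max K Y < real N" using reals_Archimedean2 by blast
    have "dist (p (real m)) (p (real n)) < e" if "m \<ge> N" "n > m" for m n
    proof -
      have "norm (p (real n) - p (real m)) \<le> E (real m)" using that N by (intro le) auto
      also have "\<dots> < e" using K[of "real m"] that N by auto
      finally show ?thesis by (simp add: dist_norm norm_minus_commute)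
    qed
    then show "\<exists>N. \<forall>m\<ge>N. \<forall>n\<ge>N. dist (p (real m)) (p (real n)) < e"
      using e by (metis dist_commute dist_self linorder_neqE_nat)
  qed
  then obtain L where L: "(\<lambda>n. p (real n)) \<longlonglongrightarrow> L" using Cauchy_convergent convergent_def by blast
  have "norm (p t - L) \<le> E t" if "t \<ge> Y" for t
  proof (rule tendsto_upperbound)
    show "(\<lambda>n. norm (p t - p (real n))) \<longlonglongrightarrow> norm (p t - L)" using L by (intro tendsto_intros)
    obtain N :: nat where "t < real N" using reals_Archimedean2 by blast
    then show "\<forall>\<^sub>F n in sequentially. norm (p t - p (real n)) \<le> E t"
      unfolding eventually_sequentially
    proof (intro exI[of _ N] allI impI)
      fix n assume "n \<ge> N"
      then have "t < real n" using \<open>t < real N\<close> by simp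
      from le[OF that this] show "norm (p t - p (real n)) \<le> E t" by (simp add: norm_minus_commute)
    qed
  qed simp
  then have "\<forall>\<^sub>F t in at_top. norm (p t - L) \<le> E t" unfolding eventually_at_top_linorder by blast
  then have "((\<lambda>t. p t - L) \<longlongrightarrow> 0) at_top" using E0 by (rule Lim_null_comparison)
  then show ?thesis using LIM_zero_iff by blast
qed

text \<open>The first part holds since the end values of a primitive F do not depend on g. In the
  second, F(z + 2) - F(z) is a primitive along g and tends to 0 at both ends, as f is small on the
  segments from z to z + 2; these segments are the reason for the strip |Re z| \<le> 2 in the decay
  hypothesis.\<close>

lemma contour_integral_independent:
  assumes fin: "finite L" "finite R" and dis: "Im ` L \<inter> Im ` R = {}"
    and hol: "f holomorphic_on ray_complement L R" and d: "d > 0"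
    and dec: "\<And>z. \<bar>Re z\<bar> \<le> 2 \<Longrightarrow> Y \<le> \<bar>Im z\<bar> \<Longrightarrow> norm (f z) \<le> C * exp (- d * \<bar>Im z\<bar>)"
  shows "\<exists>I. \<forall>g. deformation_of_imag_axis g \<longrightarrow> separates g (\<Union>p\<in>L. left_ray p) (\<Union>p\<in>R. right_ray p) \<longrightarrow>
      has_line_integral f I g"
    and "deformation_of_imag_axis g \<Longrightarrow> separates g (\<Union>p\<in>L. left_ray p) (\<Union>p\<in>R. right_ray p) \<Longrightarrow>
      separates (\<lambda>t. g t + 2) (\<Union>p\<in>L. left_ray p) (\<Union>p\<in>R. right_ray p) \<Longrightarrow>
      has_line_integral (\<lambda>z. f (z + 2) - f z) 0 g"
proof -
  let ?S = "ray_complement L R"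
  obtain F where F: "\<And>z. z \<in> ?S \<Longrightarrow> (F has_field_derivative f z) (at z)"
    using ray_complement_primitive[OF fin dis hol] by blast
  \<comment> \<open>Beyond height V the decay estimate applies and no half line is met.\<close>
  define V where "V = \<bar>Y\<bar> + (\<Sum>p\<in>L \<union> R. \<bar>Im p\<bar>) + 1"
  have V: "Y \<le> V" "V > 0" unfolding V_def by (auto intro!: add_nonneg_pos add_nonneg_nonneg
      sum_nonneg simp: add_increasing2)
  have inS: "z \<in> ?S" if "V \<le> \<bar>Im z\<bar>" for z
  proof -
    have "Im z \<noteq> Im p" if "p \<in> L \<union> R" for p
      using member_le_sum[OF that, of "\<lambda>p. \<bar>Im p\<bar>"] fin \<open>V \<le> \<bar>Im z\<bar>\<close> unfolding V_def by auto
    then show ?thesis by (auto simp: ray_complement_def in_left_ray_iff in_right_ray_iff)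
  qed
  have gS: "g t \<in> ?S" if "separates g (\<Union>p\<in>L. left_ray p) (\<Union>p\<in>R. right_ray p)" for g t
    using that unfolding separates_iff by (force simp: ray_complement_def in_left_ray_iff
        in_right_ray_iff)
  have axis: "((\<lambda>t. F (c * \<i> * of_real t)) has_vector_derivative c * \<i> * f (c * \<i> * of_real t)) (at t)"
      "norm (c * \<i> * f (c * \<i> * of_real t)) \<le> C * exp (- d * t)"
    if "c = 1 \<or> c = - 1" "V \<le> t" for c t
  proof -
    have "((\<lambda>t. c * \<i> * of_real t) has_vector_derivative c * \<i>) (at t)"
      by (auto intro!: derivative_eq_intros)
    moreover have a: "\<bar>Im (c * \<i> * of_real t)\<bar> = t" "Re (c * \<i> * of_real t) = 0" using that V by auto
    ultimately show "((\<lambda>t. F (c * \<i> * of_real t)) has_vector_derivative c * \<i> * f (c * \<i> * of_real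
        t)) (at t)"
      using field_vector_diff_chain_at[OF _ F[OF inS]] that by (fastforce simp: o_def)
    have "norm (f (c * \<i> * of_real t)) \<le> C * exp (- d * t)"
      using dec[of "c * \<i> * of_real t"] V that unfolding a by simp
    then show "norm (c * \<i> * f (c * \<i> * of_real t)) \<le> C * exp (- d * t)"
      using that by (auto simp: norm_mult)
  qed
  obtain T where T: "((\<lambda>t. F (\<i> * of_real t)) \<longlongrightarrow> T) at_top"
    using exponential_decay_imp_convergent[OF d axis(1)[of 1] axis(2)[of 1]] by auto
  obtain B where B: "((\<lambda>t. F (\<i> * of_real t)) \<longlongrightarrow> B) at_bot"
    using exponential_decay_imp_convergent[OF d axis(1)[of "-1"] axis(2)[of "-1"]]
    unfolding filterlim_at_bot_mirror by auto
  show "\<exists>I. \<forall>g. deformation_of_imag_axis g \<longrightarrow> separates g (\<Union>p\<in>L. left_ray p) (\<Union>p\<in>R. right_ray p) \<longrightarrow>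
      has_line_integral f I g"
    by (intro exI[of _ "T - B"] allI impI has_line_integral_primitive[where F = F] F gS T B)
  assume g: "deformation_of_imag_axis g" "separates g (\<Union>p\<in>L. left_ray p) (\<Union>p\<in>R. right_ray p)"
    "separates (\<lambda>t. g t + 2) (\<Union>p\<in>L. left_ray p) (\<Union>p\<in>R. right_ray p)"
  define H where "H z = F (z + 2) - F z" for z
  have H: "(H has_field_derivative f (g t + 2) - f (g t)) (at (g t))" for t
    unfolding H_def using F[OF gS[OF g(3)]] F[OF gS[OF g(2)]]
    by (intro DERIV_diff) (simp_all add: DERIV_shift add.commute)
  have Hb: "norm (H (\<i> * of_real t)) \<le> 2 * C * exp (- d * \<bar>t\<bar>)" if t: "V \<le> \<bar>t\<bar>" for t
  proof -
    let ?z = "\<i> * complex_of_real t"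
    have seg: "\<bar>Re w\<bar> \<le> 2 \<and> Im w = t" if "w \<in> closed_segment ?z (?z + 2)" for w
      using that by (auto simp: closed_segment_def algebra_simps)
    have "norm (F (?z + 2) - F ?z) \<le> C * exp (- d * \<bar>t\<bar>) * norm (?z + 2 - ?z)"
    proof (rule field_differentiable_bound[OF convex_closed_segment])
      fix w assume "w \<in> closed_segment ?z (?z + 2)"
      then have w: "\<bar>Re w\<bar> \<le> 2" "Im w = t" using seg by auto
      then have "w \<in> ?S" using inS t by simp
      then show "(F has_field_derivative f w) (at w within closed_segment ?z (?z + 2))"
        using F has_field_derivative_at_within by blast
      show "norm (f w) \<le> C * exp (- d * \<bar>t\<bar>)" using dec[of w] w t V by simp
    qed auto
    then show ?thesis by (simp add: H_def)
  qed
  have "((\<lambda>t. 2 * C * exp (- d * \<bar>t\<bar>)) \<longlongrightarrow> 0) at_top" "((\<lambda>t. 2 * C * exp (- d * \<bar>t\<bar>)) \<longlongrightarrow> 0) at_bot"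
    using d by real_asymp+
  moreover have "\<forall>\<^sub>F t in at_top. norm (H (\<i> * of_real t)) \<le> 2 * C * exp (- d * \<bar>t\<bar>)"
    unfolding eventually_at_top_linorder using Hb by (intro exI[of _ V]) auto
  moreover have "\<forall>\<^sub>F t in at_bot. norm (H (\<i> * of_real t)) \<le> 2 * C * exp (- d * \<bar>t\<bar>)"
    unfolding eventually_at_bot_linorder
  proof (intro exI[of _ "- V"] allI impI Hb)
    fix t assume "t \<le> - V"
    then show "V \<le> \<bar>t\<bar>" by linarith
  qed
  ultimately have "((\<lambda>t. H (\<i> * of_real t)) \<longlongrightarrow> 0) at_top" "((\<lambda>t. H (\<i> * of_real t)) \<longlongrightarrow> 0) at_bot"
    by (auto intro: Lim_null_comparison)
  from has_line_integral_primitive[OF g(1) H this] show "has_line_integral (\<lambda>z. f (z + 2)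
      - f z) 0 g" by simp
qed

subsection \<open>The telescoping certificate\<close>

text \<open>
  The coefficients \<open>k1\<close>, \<open>k0\<close>, \<open>k2\<close> are found by evaluating the identity at the zeros of
  \<open>X * Z / (Q * y) + Q * y / (X * Z) - m\<close> and of \<open>Q\<^sup>2 * y * X * Z + 1 / (Q\<^sup>2 * y * X * Z) - sg\<close>,
  where all but two terms vanish.
\<close>

lemma certificate_normalised:
  fixes Q X y Z sg rh m n :: "'a::field"
  assumes nz: "Q \<noteq> 0" "X \<noteq> 0" "y \<noteq> 0" "Z \<noteq> 0"
    and d: "1 - X^2 \<noteq> 0" "1 - Q^2 * X^2 \<noteq> 0" "X^2 - Q^2 \<noteq> 0"
  defines "w \<equiv> Q * X" and "v \<equiv> Q / X" and "g \<equiv> Q * y^2"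
  defines "pf \<equiv> Q^2 * X^2 / ((1 - X^2) * (1 - Q^2 * X^2))"
    and "pd \<equiv> - (Q^2 * X^2 / ((1 - X^2) * (X^2 - Q^2)))"
  defines "B \<equiv> pf * ((w + 1/w)^2 - (w + 1/w) * sg * rh + sg^2 + rh^2 - 4)"
    and "D \<equiv> pd * ((v + 1/v)^2 - (v + 1/v) * m * n + m^2 + n^2 - 4)"
    and "U \<equiv> - (pf * (rh * n + sg * m - w * (rh * m + n * sg)) + pd * (rh * n + sg * m - v * (rh * m
        + n * sg)) + Q * (y^2 + 1/y^2))"
  defines "k1 \<equiv> y * X * (pf * (rh - sg * w) / g + pd * (m / v - n))"
    and "k2 \<equiv> (pf * g * (rh - sg / w) + pd * (m * v - n)) / (y * X)"
    and "k0 \<equiv> w / (1 - X^2) * (g - 1/g) + pf * m * (sg / w - rh) - sg * pd * (m * v - n)"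
  shows "B * (Q*X*Z/y + y/(Q*X*Z) - m) * (X*Z/(Q*y) + Q*y/(X*Z) - m)
       + U * (X*Z/(Q*y) + Q*y/(X*Z) - m) * (Q^2*y*X*Z + 1/(Q^2*y*X*Z) - sg)
       + D * (y*X*Z + 1/(y*X*Z) - sg) * (Q^2*y*X*Z + 1/(Q^2*y*X*Z) - sg)
       = - (k1 * (Q^2*Z) + k0 + k2 / (Q^2*Z)) * (X*Z/(Q*y) + Q*y/(X*Z) - m) * (Q*y*Z + 1/(Q*y*Z) - rh)
       + (k1 * Z + k0 + k2 / Z) * (Z/y + y/Z - n) * (Q^2*y*X*Z + 1/(Q^2*y*X*Z) - sg)"
proof -
  \<comment> \<open>Each of the six Laurent factors has the form p Z + 1/(p Z) minus a constant;
    these are the six values of p.\<close>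
  let ?al = "X/(Q*y)" let ?be = "Q*y" let ?ga = "1/y" let ?de = "Q^2*y*X" let ?ep = "Q*X/y" let ?th
      = "y*X"
  \<comment> \<open>The difference of the two sides is a Laurent polynomial in Z with coefficients
    \<open>c2\<close> to \<open>cm2\<close>. The terms of degree 3 and -3 cancel beforehand, since
    \<open>?al * ?be * Q^2 = ?ga * ?de\<close>.\<close>
  define c2 where "c2 = B * X^2/y^2 + U * Q * X^2 + D * Q^2*y^2*X^2
     + X * k0 - k1*Q^2 * (?al * rh + ?be * m) - k0 * Q^2 * X + k1 * (?ga * sg + ?de * n)"
  define c1 where "c1 = - B * m * (?ep + ?al) - U * (?al * sg + ?de * m) - D * sg * (?th + ?de)
     + k1*Q^2 * (?al / ?be + ?be / ?al + m * rh) - k0 * (?al * rh + ?be * m) + k2 / Q^2 * X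
     - k1 * (?ga / ?de + ?de / ?ga + n * sg) + k0 * (?ga * sg + ?de * n) - k2 * Q^2 * X"
  define c0 where "c0 = B * (?ep / ?al + ?al/?ep + m^2) + U * (?al/?de + ?de/?al + m * sg)
      + D * (?th/?de + ?de/?th + sg^2)
     - k1*Q^2 * (rh / ?al + m / ?be) + k0 * (?al / ?be + ?be / ?al + m * rh) - k2 / Q^2 * (?al * rh
         + ?be * m)
     + k1 * (sg / ?ga + n / ?de) - k0 * (?ga / ?de + ?de / ?ga + n * sg) + k2 * (?ga * sg + ?de * n)"
  define cm1 where "cm1 = - B * m * (1/?ep + 1/?al) - U * (sg / ?al + m / ?de) - D * sg * (1/?th + 1/?de)
     + k1*Q^2 / X - k0 * (rh / ?al + m / ?be) + k2 / Q^2 * (?al / ?be + ?be / ?al + m * rh)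
     - k1 / (Q^2 * X) + k0 * (sg / ?ga + n / ?de) - k2 * (?ga / ?de + ?de / ?ga + n * sg)"
  define cm2 where "cm2 = B / (?ep*?al) + U / (?al*?de) + D / (?th*?de)
     + k0 / X - k2 / Q^2 * (rh / ?al + m / ?be) - k0 / (Q^2*X) + k2 * (sg / ?ga + n / ?de)"
  have "c2 = 0" using nz d unfolding c2_def B_def U_def D_def k1_def k2_def k0_def w_def v_def g_def
      pf_def pd_def
    by (simp add: divide_simps) algebra
  moreover have "c1 = 0" using nz d unfolding c1_def B_def U_def D_def k1_def k2_def k0_def w_def
      v_def g_def pf_def pd_def
    by (simp add: divide_simps) algebra
  moreover have "c0 = 0" using nz d unfolding c0_def B_def U_def D_def k1_def k2_def k0_def w_def
      v_def g_def pf_def pd_def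
    by (simp add: divide_simps) algebra
  moreover have "cm1 = 0" using nz d unfolding cm1_def B_def U_def D_def k1_def k2_def k0_def w_def
      v_def g_def pf_def pd_def
    by (simp add: divide_simps) algebra
  moreover have "cm2 = 0" using nz d unfolding cm2_def B_def U_def D_def k1_def k2_def k0_def w_def
      v_def g_def pf_def pd_def
    by (simp add: divide_simps) algebra
  moreover have "B * (Q*X*Z/y + y/(Q*X*Z) - m) * (X*Z/(Q*y) + Q*y/(X*Z) - m)
       + U * (X*Z/(Q*y) + Q*y/(X*Z) - m) * (Q^2*y*X*Z + 1/(Q^2*y*X*Z) - sg)
       + D * (y*X*Z + 1/(y*X*Z) - sg) * (Q^2*y*X*Z + 1/(Q^2*y*X*Z) - sg)
       + (k1 * (Q^2*Z) + k0 + k2 / (Q^2*Z)) * (X*Z/(Q*y) + Q*y/(X*Z) - m) * (Q*y*Z + 1/(Q*y*Z) - rh)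
       - (k1 * Z + k0 + k2 / Z) * (Z/y + y/Z - n) * (Q^2*y*X*Z + 1/(Q^2*y*X*Z) - sg)
     = c2 * Z^2 + c1 * Z + c0 + cm1 / Z + cm2 / Z^2"
    unfolding c2_def c1_def c0_def cm1_def cm2_def
    using nz by (simp add: divide_simps) algebra
  ultimately show ?thesis by (simp add: algebra_simps)
qed

text \<open>After division by \<open>s / mu\<close>, which stands for q^(-\<beta>), the three
  coefficients on the left depend on s, mu, nu, r only through the sums with their inverses. This
  symmetry brings the identity to \<open>certificate_normalised\<close>.\<close>

lemma certificate_exists:
  fixes Q X y s mu nu r :: "'a::field"
  assumes nz: "Q \<noteq> 0" "X \<noteq> 0" "y \<noteq> 0" "s \<noteq> 0" "mu \<noteq> 0" "nu \<noteq> 0" "r \<noteq> 0"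
    and d: "X^2 \<noteq> 1" "Q^2 * X^2 \<noteq> 1" "X^2 \<noteq> Q^2"
  defines "A \<equiv> \<lambda>t. (1 - Q * r * s*t) * (1 - Q * s*t/r) * (1 - Q*nu*t/mu) * (1 - Q*t/(nu*mu)) / ((1
      - t^2) * (1 - Q^2*t^2))"
    and "B \<equiv> s/mu * ((1 - Q * r * s*X) * (1 - Q*X/(r * s)) * (1 - Q * s*X/r) * (1
        - Q * r*X/s)) / ((1 - X^2) * (1 - Q^2*X^2))"
    and "D \<equiv> s/mu * ((1 - Q*nu/(mu*X)) * (1 - Q*mu/(nu*X)) * (1 - Q/(nu*mu*X)) * (1
        - Q*nu*mu/X)) / ((1 - 1/X^2) * (1 - Q^2/X^2))"
    and "E \<equiv> - 1 - Q^2 * s^2/mu^2 + Q * s/mu * (y^2 + 1/y^2)"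
  shows "\<exists>k1 k0 k2. \<forall>Z. Z \<noteq> 0 \<longrightarrow>
      B * (Q*X*Z/y + y/(Q*X*Z) - (mu + 1/mu)) * (X*Z/(Q*y) + Q*y/(X*Z) - (mu + 1/mu))
       + (- A X - A (1/X) - E) * (X*Z/(Q*y) + Q*y/(X*Z) - (mu + 1/mu)) * (Q^2*y*X*Z + 1/(Q^2*y*X*Z)
           - (s + 1/s))
       + D * (y*X*Z + 1/(y*X*Z) - (s + 1/s)) * (Q^2*y*X*Z + 1/(Q^2*y*X*Z) - (s + 1/s))
       = - (k1 * (Q^2*Z) + k0 + k2 / (Q^2*Z)) * (X*Z/(Q*y) + Q*y/(X*Z) - (mu + 1/mu)) * (Q*y*Z
           + 1/(Q*y*Z) - (r + 1/r))
       + (k1 * Z + k0 + k2 / Z) * (Z/y + y/Z - (nu + 1/nu)) * (Q^2*y*X*Z + 1/(Q^2*y*X*Z) - (s + 1/s))"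
proof -
  define f where "f = s / mu"
  define m where "m = mu + 1/mu" define n where "n = nu + 1/nu" define sg where "sg = s
      + 1/s" define rh where "rh = r + 1/r"
  define w where "w = Q * X" define v where "v = Q / X" define g where "g = Q * y^2"
  define pf where "pf = Q^2 * X^2 / ((1 - X^2) * (1 - Q^2 * X^2))"
  define pd where "pd = - (Q^2 * X^2 / ((1 - X^2) * (X^2 - Q^2)))"
  define B' where "B' = pf * ((w + 1/w)^2 - (w + 1/w) * sg * rh + sg^2 + rh^2 - 4)"
  define D' where "D' = pd * ((v + 1/v)^2 - (v + 1/v) * m * n + m^2 + n^2 - 4)"
  define U' where "U' = - (pf * (rh * n + sg * m - w * (rh * m + n * sg)) + pd * (rh * n + sg * m
      - v * (rh * m + n * sg)) + Q * (y^2 + 1/y^2))"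
  define k1 where "k1 = y * X * (pf * (rh - sg * w) / g + pd * (m / v - n))"
  define k2 where "k2 = (pf * g * (rh - sg / w) + pd * (m * v - n)) / (y * X)"
  define k0 where "k0 = w / (1 - X^2) * (g - 1/g) + pf * m * (sg / w - rh) - sg * pd * (m * v - n)"
  have d': "1 - X^2 \<noteq> 0" "1 - Q^2 * X^2 \<noteq> 0" "X^2 - Q^2 \<noteq> 0" using d by auto
  have B: "B = f * B'"
    using nz d' unfolding B_def B'_def f_def pf_def w_def sg_def rh_def
        by (simp add: divide_simps) algebra
  have e1: "1 - 1/X^2 = - ((1 - X^2) / X^2)" and e2: "1 - Q^2/X^2 = (X^2 - Q^2) / X^2" using nz
      by (simp_all add: field_simps)
  have D: "D = f * D'"
    using nz d' unfolding D_def D'_def f_def pd_def v_def m_def n_def e1 e2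
        by (simp add: divide_simps) algebra
  have U: "- A X - A (1/X) - E = f * U'"
  proof -
    \<comment> \<open>The two values of A are not symmetric in this sense separately. Their
      remainders over \<open>1 - X^2\<close> combine by \<open>a3\<close> to
      \<open>1/f + f * Q^2\<close>, which is cancelled by terms of E.\<close>
    have a1: "A X = f * (pf * (rh * n + sg * m - w * (rh * m + n * sg)) + (1/f - f * w^2
        - w * (rh * mu + n / s)) / (1 - X^2))"
      using nz d' unfolding A_def f_def pf_def w_def sg_def rh_def m_def n_def
          by (simp add: divide_simps) algebra
    have a2: "A (1/X) = f * (pd * (rh * n + sg * m - v * (rh * m + n * sg)) - (X^2 * (1/f) - f * Q^2
        - w * (rh * mu + n / s)) / (1 - X^2))"
      using nz d' unfolding A_def power_divide power_one times_divide_eq_right mult_1_right e1 e2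
          f_def pd_def v_def w_def sg_def rh_def m_def n_def
      by (simp add: divide_simps) algebra
    have a3: "(1/f - f * w^2 - w * (rh * mu + n / s)) / (1 - X^2) - (X^2 * (1/f) - f * Q^2
        - w * (rh * mu + n / s)) / (1 - X^2) = 1/f + f * Q^2"
      using d'(1) unfolding diff_divide_distrib[symmetric] w_def
          by (simp add: divide_eq_eq) (simp add: algebra_simps power_mult_distrib)?
    have fE: "E = f * (- (1/f) - Q^2 * f + Q * (y^2 + 1/y^2))"
      using nz unfolding E_def f_def by (simp add: field_simps power2_eq_square)
    show ?thesis unfolding a1 a2 fE U'_def using a3 by algebra
  qed
  show ?thesis
  proof (intro exI allI impI)
    fix Z :: 'a assume Z: "Z \<noteq> 0"
    note cert = certificate_normalised[OF nz(1-3) Z d', of sg rh m n, folded w_def v_def g_def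
        pf_def pd_def,
      folded B'_def D'_def U'_def k1_def k2_def k0_def]
    have scale: "(f * b) * p * p1 + (f * u) * p1 * p2 + (f * d) * p3 * p2 = - (f * k) * p1 * p4
        + (f * l) * p5 * p2"
      if "b * p * p1 + u * p1 * p2 + d * p3 * p2 = - k * p1 * p4 + l * p5 * p2"
          for b u d k l p p1 p2 p3 p4 p5
      using arg_cong[OF that, of "\<lambda>t. f * t"] by (simp add: algebra_simps)
    have sc: "(f * k1) * t + f * k0 + (f * k2) / u = f * (k1 * t + k0 + k2 / u)" for t u
      by (simp add: distrib_left mult.assoc)
    show "B * (Q*X*Z/y + y/(Q*X*Z) - (mu + 1/mu)) * (X*Z/(Q*y) + Q*y/(X*Z) - (mu + 1/mu))
       + (- A X - A (1/X) - E) * (X*Z/(Q*y) + Q*y/(X*Z) - (mu + 1/mu)) * (Q^2*y*X*Z + 1/(Q^2*y*X*Z)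
           - (s + 1/s))
       + D * (y*X*Z + 1/(y*X*Z) - (s + 1/s)) * (Q^2*y*X*Z + 1/(Q^2*y*X*Z) - (s + 1/s))
       = - ((f * k1) * (Q^2*Z) + f * k0 + (f * k2) / (Q^2*Z)) * (X*Z/(Q*y) + Q*y/(X*Z) - (mu
           + 1/mu)) * (Q*y*Z + 1/(Q*y*Z) - (r + 1/r))
       + ((f * k1) * Z + f * k0 + (f * k2) / Z) * (Z/y + y/Z - (nu + 1/nu)) * (Q^2*y*X*Z
           + 1/(Q^2*y*X*Z) - (s + 1/s))"
      unfolding sc B D U m_def[symmetric] n_def[symmetric] sg_def[symmetric] rh_def[symmetric]
      by (rule scale[OF cert[unfolded w_def]])
  qed
qed

subsection \<open>The integrand as a product over singular half lines\<close>

lemma qpow_add: "qpow \<tau> (u + v) = qpow \<tau> u * qpow \<tau> v"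
  unfolding qpow_def distrib_left by (rule exp_add)

lemma qpow_diff: "qpow \<tau> (u - v) = qpow \<tau> u / qpow \<tau> v"
  unfolding qpow_def right_diff_distrib by (rule exp_diff)

lemma qpow_minus: "qpow \<tau> (- u) = 1 / qpow \<tau> u"
proof -
  have "qpow \<tau> 0 = 1" by (simp add: qpow_def)
  then show ?thesis using qpow_diff[of \<tau> 0 u] by (simp only: diff_0)
qed

lemma qpow_double: "qpow \<tau> (2 * u) = (qpow \<tau> u)\<^sup>2"
  using qpow_add[of \<tau> u u] by (simp only: power2_eq_square mult_2)

lemma qpow_nonzero: "qpow \<tau> u \<noteq> 0"
  by (simp add: qpow_def)

lemma qpow_half_period: "\<tau> \<noteq> 0 \<Longrightarrow> qpow \<tau> (1 / (2 * of_real \<tau>)) = - 1"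
  by (simp add: qpow_def mult.commute)

text \<open>Equals \<open>\<i>\<close> times q^(w/2) - q^(-w/2); the minus sign belongs to the
  positive parameter \<open>- 2 * \<tau>\<close> of \<open>hgam\<close>.\<close>

definition q_sine :: "real \<Rightarrow> complex \<Rightarrow> complex" where
  "q_sine \<tau> w = 2 * sin (- (of_real pi * of_real \<tau> * w))"

text \<open>The sines in the certificate come in pairs, and the product formula turns each pair into
  a Laurent polynomial in q^z: half powers disappear.\<close>

lemma q_sine_mult:
  "q_sine \<tau> u * q_sine \<tau> v = (qpow \<tau> ((u - v) / 2) + 1 / qpow \<tau> ((u - v) / 2)) - (qpow \<tau> ((u
      + v) / 2) + 1 / qpow \<tau> ((u + v) / 2))"
proof -
  define a where "a = of_real pi * of_real \<tau> * u" define b where "b = of_real pi * of_real \<tau> * v"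
  have e: "2 * of_real pi * \<i> * of_real \<tau> * ((u - v) / 2) = \<i> * (a
      - b)" "2 * of_real pi * \<i> * of_real \<tau> * ((u + v) / 2) = \<i> * (a + b)"
    by (simp_all add: a_def b_def algebra_simps add_divide_distrib diff_divide_distrib)
  have "qpow \<tau> ((u - v) / 2) + 1 / qpow \<tau> ((u - v) / 2) = 2 * cos (a - b)"
    unfolding qpow_def e by (simp add: cos_exp_eq exp_minus inverse_eq_divide)
  moreover have "qpow \<tau> ((u + v) / 2) + 1 / qpow \<tau> ((u + v) / 2) = 2 * cos (a + b)"
    unfolding qpow_def e by (simp add: cos_exp_eq exp_minus inverse_eq_divide)
  moreover have "q_sine \<tau> u * q_sine \<tau> v = 2 * cos (a - b) - 2 * cos (a + b)"
    by (simp add: q_sine_def a_def b_def cos_add cos_diff)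
  ultimately show ?thesis by simp
qed

text \<open>Factors of the numerator are values of \<open>hgam\<close> as they stand; those of the
  denominator become so by reflection. As \<open>hyp_gamma_minus\<close> covers poles too, the
  equality holds at every z.\<close>

lemma psi_integrand_eq_ray_product:
  assumes "\<tau> < 0"
  shows "psi_integrand \<tau> \<alpha> \<rho> \<beta> \<sigma> lam x z = ray_product (- 2 * \<tau>) (left_points \<tau> \<alpha> \<rho> \<beta> \<sigma> lam x)
      (right_points \<tau> \<alpha> \<rho> \<beta> \<sigma> lam x) z"
proof -
  define h :: complex where "h = 1 / (2 * of_real \<tau>)"
  define G where "G = hyp_gamma (2 * \<tau>)"
  have h: "1 / complex_of_real \<tau> = 2 * h" "- 1 / complex_of_real \<tau> =
      - (2 * h)" "1 / complex_of_real (- 2 * \<tau>) = - h"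
    using assms by (simp_all add: h_def field_simps)
  have hg: "hgam (- 2 * \<tau>) w = G (w - 1 + h)" for w
    unfolding hgam_def h G_def by simp
  have inv: "inverse (G u) = G (- u)" for u
    using hyp_gamma_minus[of "- 2 * \<tau>" u] assms by (simp add: G_def)
  have A1: "hgam (- 2 * \<tau>) (z - (-1 - \<beta> - \<sigma> + \<i> * lam - x)) = G (h + \<beta> + \<sigma> - \<i> * lam + x + z)"
    unfolding hg inv by (rule arg_cong[where f = G]) (simp add: algebra_simps)
  have A2: "hgam (- 2 * \<tau>) ((\<sigma> - \<i> * lam - x) - z) = G (h - 1 + \<sigma> - \<i> * lam - x - z)"
    unfolding hg inv by (rule arg_cong[where f = G]) (simp add: algebra_simps)
  have B1: "hgam (- 2 * \<tau>) (z - (-1 + \<beta> + \<sigma> + \<i> * lam - x)) = inverse (G (- h + \<beta> + \<sigma> + \<i> * lam - x - z))"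
    unfolding hg inv by (rule arg_cong[where f = G]) (simp add: algebra_simps)
  have B2: "hgam (- 2 * \<tau>) ((- \<sigma> - \<i> * lam - x) - z) = inverse (G (- h + 1 + \<sigma> + \<i> * lam + x + z))"
    unfolding hg inv by (rule arg_cong[where f = G]) (simp add: algebra_simps)
  have A3: "hgam (- 2 * \<tau>) ((- (2 * h) + \<alpha> + \<rho> + \<i> * lam) - z) = G (- h - 1 + \<alpha> + \<rho> + \<i> * lam - z)"
    unfolding hg inv by (rule arg_cong[where f = G]) (simp add: algebra_simps)
  have A4: "hgam (- 2 * \<tau>) (z - (-1 + 2 * h - \<rho> - \<i> * lam)) = G (- h + \<rho> + \<i> * lam + z)"
    unfolding hg inv by (rule arg_cong[where f = G]) (simp add: algebra_simps)
  have B3: "hgam (- 2 * \<tau>) ((- \<alpha> - \<rho> + \<i> * lam) - z) = inverse (G (- h + 1 + \<alpha> + \<rho> - \<i> * lam + z))"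
    unfolding hg inv by (rule arg_cong[where f = G]) (simp add: algebra_simps)
  have B4: "hgam (- 2 * \<tau>) (z - (-1 + \<rho> - \<i> * lam)) = inverse (G (- h + \<rho> - \<i> * lam - z))"
    unfolding hg inv by (rule arg_cong[where f = G]) (simp add: algebra_simps)
  show ?thesis
    unfolding psi_integrand_def Let_def h_def[symmetric] G_def[symmetric] ray_product_def
        left_points_def right_points_def h
      list.map prod_list.Cons prod_list.Nil A1 A2 A3 A4 B1 B2 B3 B4
    by (simp only: divide_inverse inverse_mult_distrib mult_ac mult_1_right mult_1_left)
qed

lemma hgam_shift_q_sine:
  assumes "\<tau> < 0" "w \<notin> \<real>\<^sub>\<le>\<^sub>0"
  shows "hgam (- 2 * \<tau>) (w + 2) = q_sine \<tau> w * hgam (- 2 * \<tau>) w"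
proof -
  have "hgam (- 2 * \<tau>) (w + 2) = 2 * sin (of_real pi * of_real (- 2 * \<tau>) * w / 2) * hgam (- 2 * \<tau>) w"
    using assms by (intro hgam_shift) auto
  moreover have "of_real pi * of_real (- 2 * \<tau>) * w / 2 = - (of_real pi * of_real \<tau> * w)" by simp
  ultimately show ?thesis by (simp only: q_sine_def)
qed

lemma ray_product_holomorphic:
  assumes "k > 0"
  shows "ray_product k ls rs holomorphic_on ray_complement (set ls) (set rs)"
proof -
  have l: "(\<lambda>z. hgam k (z - p)) holomorphic_on ray_complement (set ls) (set rs)" if "p \<in> set ls" for p
  proof -
    have "(hgam k \<circ> (\<lambda>z. z - p)) holomorphic_on ray_complement (set ls) (set rs)"
    proof (rule holomorphic_on_compose_gen[OF _ hgam_holomorphic[OF assms]])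
      show "(\<lambda>z. z - p) ` ray_complement (set ls) (set rs) \<subseteq> - \<real>\<^sub>\<le>\<^sub>0"
        using that by (auto simp: ray_complement_def in_left_ray_iff complex_nonpos_Reals_iff)
    qed (intro holomorphic_intros)
    then show ?thesis by (simp add: o_def)
  qed
  have r: "(\<lambda>z. hgam k (p - z)) holomorphic_on ray_complement (set ls) (set rs)" if "p \<in> set rs" for p
  proof -
    have "(hgam k \<circ> (\<lambda>z. p - z)) holomorphic_on ray_complement (set ls) (set rs)"
    proof (rule holomorphic_on_compose_gen[OF _ hgam_holomorphic[OF assms]])
      show "(\<lambda>z. p - z) ` ray_complement (set ls) (set rs) \<subseteq> - \<real>\<^sub>\<le>\<^sub>0"
        using that by (auto simp: ray_complement_def in_right_ray_iff complex_nonpos_Reals_iff)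
    qed (intro holomorphic_intros)
    then show ?thesis by (simp add: o_def)
  qed
  have prod: "(\<lambda>z. \<Prod>p\<leftarrow>ps. f p z) holomorphic_on S" if "\<And>p. p \<in> set ps \<Longrightarrow> f p holomorphic_on S"
    for ps :: "complex list" and f :: "complex \<Rightarrow> complex \<Rightarrow> complex" and S
    using that by (induction ps) (auto intro!: holomorphic_intros)
  show ?thesis unfolding ray_product_def [abs_def] by (intro holomorphic_on_mult prod l r)
qed

text \<open>The rate is \<open>(4 + 4/k) - 8 * (1 + 1/k)\<close> times \<open>pi * k / 4\<close>.
  Its excess over \<open>pi * k\<close> later absorbs the growth of q^z and q^(-z).\<close>

lemma norm_ray_product_decay:
  assumes k: "k > 0" and len: "length ls = 4" "length rs = 4"
    and sum: "sum_list rs - sum_list ls = 4 + 4 / of_real k"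
  obtains C Y where "\<And>z. \<bar>Re z\<bar> \<le> 2 \<Longrightarrow> Y \<le> \<bar>Im z\<bar> \<Longrightarrow>
    norm (ray_product k ls rs z) \<le> C * exp (- (pi * (k + 1)) * \<bar>Im z\<bar>)"
proof -
  have "Re (sum_list rs - sum_list ls) = 4 + 4 / k" unfolding sum using k by (simp add: Re_divide_of_real)
  then have "(Re (sum_list rs) - Re (sum_list ls) - 2 * length ls * (1 + 1/k)) * (pi * k * t / 4) =
      - (pi * (k + 1)) * t" for t
    using k by (simp add: len field_simps)
  then show ?thesis using norm_ray_product_le[OF k, of ls rs 2] len that by metis
qed

lemma sum_list_points:
  assumes "\<tau> < 0"
  shows "sum_list (right_points \<tau> \<alpha> \<rho> \<beta> \<sigma> lam x) - sum_list (left_points \<tau> \<alpha> \<rho> \<beta> \<sigma> lam x) = 4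
      + 4 / of_real (- 2 * \<tau>)"
  using assms by (simp add: left_points_def right_points_def field_simps)

text \<open>The description in \<open>psi\<close> denotes the integral only if its value is unique,
  and uniqueness rests on an admissible contour; g provides one.\<close>

lemma psi_has_line_integral:
  assumes \<tau>: "\<tau> < 0" and dis: "Im ` set (left_points \<tau> \<alpha> \<rho> \<beta> \<sigma> lam x) \<inter> Im ` set (right_points \<tau> \<alpha> \<rho>
      \<beta> \<sigma> lam x) = {}"
    and g: "admissible_contour \<tau> \<alpha> \<rho> \<beta> \<sigma> lam x g"
  shows "has_line_integral (psi_integrand \<tau> \<alpha> \<rho> \<beta> \<sigma> lam x) (psi \<tau> \<alpha> \<rho> \<beta> \<sigma> lam x) g"
proof -
  let ?L = "left_points \<tau> \<alpha> \<rho> \<beta> \<sigma> lam x" and ?R = "right_points \<tau> \<alpha> \<rho> \<beta> \<sigma> lam x"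
  let ?f = "psi_integrand \<tau> \<alpha> \<rho> \<beta> \<sigma> lam x"
  define k where "k = - 2 * \<tau>"
  have k: "k > 0" using \<tau> by (simp add: k_def)
  have f: "?f = ray_product k ?L ?R" using psi_integrand_eq_ray_product[OF \<tau>] by (auto simp: k_def)
  have len: "length ?L = 4" "length ?R = 4" by (simp_all add: left_points_def right_points_def)
  have sum: "sum_list ?R - sum_list ?L = 4 + 4 / of_real k" unfolding k_def
      by (rule sum_list_points[OF \<tau>])
  obtain C Y where CY: "\<And>z. \<bar>Re z\<bar> \<le> 2 \<Longrightarrow> Y \<le> \<bar>Im z\<bar> \<Longrightarrow> norm (ray_product k ?L ?R z)
      \<le> C * exp (- (pi * (k + 1)) * \<bar>Im z\<bar>)"
    using norm_ray_product_decay[OF k len sum] by blast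
  have "0 < pi * (k + 1)" using k by simp
  from contour_integral_independent(1)[OF finite_set finite_set dis ray_product_holomorphic[OF k]
      this, of Y C] CY
  obtain I where I: "\<And>g. admissible_contour \<tau> \<alpha> \<rho> \<beta> \<sigma> lam x g \<Longrightarrow> has_line_integral ?f I g"
    unfolding f admissible_contour_def by blast
  have "psi \<tau> \<alpha> \<rho> \<beta> \<sigma> lam x = I"
    unfolding psi_def
  proof (rule the_equality)
    show "J = I" if "\<forall>g. admissible_contour \<tau> \<alpha> \<rho> \<beta> \<sigma> lam x g \<longrightarrow> has_line_integral ?f J g" for J
      using that I[OF g] g unfolding has_line_integral_def by (blast intro: has_integral_unique)
  qed (use I in blast)
  then show ?thesis using I[OF g] by simp
qed

lemma has_line_integral_add:
  "has_line_integral f I g \<Longrightarrow> has_line_integral f' J g \<Longrightarrow> has_line_integral (\<lambda>z. f z + f' z) (I + J) g"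
  unfolding has_line_integral_def distrib_right by (rule has_integral_add)

lemma has_line_integral_cmult:
  "has_line_integral f I g \<Longrightarrow> has_line_integral (\<lambda>z. c * f z) (c * I) g"
  unfolding has_line_integral_def mult.assoc by (rule has_integral_mult_right)

lemma has_line_integral_unique:
  assumes "has_line_integral f I g" "has_line_integral f' J g" "\<And>t. f (g t) = f' (g t)"
  shows "I = J"
  using assms unfolding has_line_integral_def by (auto intro: has_integral_unique)

text \<open>\<open>certificate_exists\<close> in additive notation: \<open>Q\<close>,
  \<open>X\<close>, \<open>y\<close>, \<open>s\<close>, \<open>mu\<close>, \<open>nu\<close>,
  \<open>r\<close>, \<open>Z\<close> are the powers of q with exponents 1, x,
  \<open>\<i> * lam\<close>, \<sigma>, \<beta> + \<sigma>, \<alpha> + \<rho>, \<rho>, z.\<close>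

lemma coeff_certificate:
  assumes \<tau>: "\<tau> < 0" and qx: "qpow \<tau> (2 * x) \<notin> {1, qpow \<tau> 2, qpow \<tau> (-2)}"
    and L: "left_points \<tau> \<alpha> \<rho> \<beta> \<sigma> lam x = [L1, L2, L3, L4]"
    and R: "right_points \<tau> \<alpha> \<rho> \<beta> \<sigma> lam x = [R1, R2, R3, R4]"
  shows "\<exists>k1 k0 k2. \<forall>z.
     coeff_B \<tau> \<rho> \<beta> \<sigma> x * (q_sine \<tau> (z - L1) * q_sine \<tau> (z - L2)) * (q_sine \<tau> (z - L1
         - 2) * q_sine \<tau> (z - L2 - 2))
     + (coeff_C \<tau> \<alpha> \<rho> \<beta> \<sigma> x - eigenvalue \<tau> lam \<beta>) * (q_sine \<tau> (z - L1 - 2) * q_sine \<tau> (z - L2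
         - 2)) * (q_sine \<tau> (R1 - 2 - z) * q_sine \<tau> (R2 - 2 - z))
     + coeff_D \<tau> \<alpha> \<rho> \<beta> \<sigma> x * (q_sine \<tau> (R1 - z) * q_sine \<tau> (R2 - z)) * (q_sine \<tau> (R1 - 2
         - z) * q_sine \<tau> (R2 - 2 - z))
     = (k1 * qpow \<tau> (z + 2) + k0 + k2 / qpow \<tau> (z + 2)) * (q_sine \<tau> (z - L1 - 2) * q_sine \<tau> (z - L2
         - 2)) * (q_sine \<tau> (z - L3) * q_sine \<tau> (z - L4))
     - (k1 * qpow \<tau> z + k0 + k2 / qpow \<tau> z) * (q_sine \<tau> (R3 - z) * q_sine \<tau> (R4
         - z)) * (q_sine \<tau> (R1 - 2 - z) * q_sine \<tau> (R2 - 2 - z))"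
proof -
  let ?q = "qpow \<tau>"
  define Q X y s mu nu r where "Q = ?q 1" and "X = ?q x" and "y = ?q (\<i> * lam)" and "s = ?q \<sigma>"
    and "mu = ?q (\<beta> + \<sigma>)" and "nu = ?q (\<alpha> + \<rho>)" and "r = ?q \<rho>"
  note defs = Q_def X_def y_def s_def mu_def nu_def r_def
  have nz: "Q \<noteq> 0" "X \<noteq> 0" "y \<noteq> 0" "s \<noteq> 0" "mu \<noteq> 0" "nu \<noteq> 0" "r \<noteq> 0" unfolding defs
      by (rule qpow_nonzero)+
  have q2: "?q 2 = Q\<^sup>2" using qpow_double[of \<tau> 1] by (simp add: Q_def)
  have qx2: "?q (2 * x) = X\<^sup>2" unfolding X_def by (rule qpow_double)
  have "X\<^sup>2 \<noteq> 1" "X\<^sup>2 \<noteq> Q\<^sup>2" "X\<^sup>2 \<noteq> 1 / Q\<^sup>2" using qx unfolding qx2 by (auto simp: q2 qpow_minus)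
  then have d: "X\<^sup>2 \<noteq> 1" "Q\<^sup>2 * X\<^sup>2 \<noteq> 1" "X\<^sup>2 \<noteq> Q\<^sup>2" using nz by (auto simp: field_simps)
  have p: "L1 = -1 - \<beta> - \<sigma> + \<i> * lam - x" "L2 = -1 + \<beta> + \<sigma> + \<i> * lam - x" "L3 = -1 + 1 / of_real \<tau>
      - \<rho> - \<i> * lam"
     "L4 = -1 + \<rho> - \<i> * lam" "R1 = - \<sigma> - \<i> * lam - x" "R2 = \<sigma> - \<i> * lam - x" "R3 = - \<alpha> - \<rho> + \<i> * lam"
     "R4 = - 1 / of_real \<tau> + \<alpha> + \<rho> + \<i> * lam"
    using L R by (auto simp: left_points_def right_points_def)
  define h :: complex where "h = 1 / (2 * of_real \<tau>)"
  have h: "1 / complex_of_real \<tau> = 2 * h" "- 1 / complex_of_real \<tau> = - (2 * h)" using \<tau>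
      by (simp_all add: h_def)
  have qh: "?q h = - 1" unfolding h_def using \<tau> by (intro qpow_half_period) auto
  have sq: "q_sine \<tau> u * q_sine \<tau> v = (?q e + 1 / ?q e) - (?q e' + 1 / ?q e')" if "u - v = 2 * e" "u
      + v = 2 * e'" for u v e e'
    unfolding q_sine_mult that by simp
  obtain k1 k0 k2 where K: "\<And>Z. Z \<noteq> 0 \<Longrightarrow> coeff_B \<tau> \<rho> \<beta> \<sigma> x * (Q*X*Z/y + y/(Q*X*Z) - (mu
      + 1/mu)) * (X*Z/(Q*y) + Q*y/(X*Z) - (mu + 1/mu))
       + (coeff_C \<tau> \<alpha> \<rho> \<beta> \<sigma> x - eigenvalue \<tau> lam \<beta>) * (X*Z/(Q*y) + Q*y/(X*Z) - (mu
           + 1/mu)) * (Q^2*y*X*Z + 1/(Q^2*y*X*Z) - (s + 1/s))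
       + coeff_D \<tau> \<alpha> \<rho> \<beta> \<sigma> x * (y*X*Z + 1/(y*X*Z) - (s + 1/s)) * (Q^2*y*X*Z + 1/(Q^2*y*X*Z) - (s + 1/s))
       = - (k1 * (Q^2*Z) + k0 + k2 / (Q^2*Z)) * (X*Z/(Q*y) + Q*y/(X*Z) - (mu + 1/mu)) * (Q*y*Z
           + 1/(Q*y*Z) - (r + 1/r))
       + (k1 * Z + k0 + k2 / Z) * (Z/y + y/Z - (nu + 1/nu)) * (Q^2*y*X*Z + 1/(Q^2*y*X*Z) - (s + 1/s))"
  proof -
    have qb: "?q (- \<beta>) = s / mu" by (simp add: s_def mu_def qpow_add qpow_minus qpow_nonzero)
    have qab: "?q (\<beta> + \<sigma>) = mu" "?q (\<alpha> + \<rho>) = nu" by (simp_all add: mu_def nu_def)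
    have ab: "?q (1 + \<rho> + \<sigma> + u) = Q * r * s * ?q u" "?q (1 - \<rho> + \<sigma> + u) = Q * s * ?q u / r"
      "?q (2 - (1 + \<rho> + \<sigma>) + u) = Q * ?q u / (r * s)" "?q (2 - (1 - \<rho> + \<sigma>) + u) = Q * r * ?q u / s"
      "?q (1 + \<alpha> + \<rho> - \<beta> - \<sigma> + u) = Q * nu * ?q u / mu" "?q (1 - \<alpha> - \<rho> - \<beta> - \<sigma> + u)
          = Q * ?q u / (nu * mu)"
      "?q (2 - (1 + \<alpha> + \<rho> - \<beta> - \<sigma>) + u) = Q * mu * ?q u / nu" "?q (2 - (1 - \<alpha> - \<rho> - \<beta> - \<sigma>) + u)
          = Q * nu * mu * ?q u" for u
      by (simp_all add: defs qpow_add qpow_diff qpow_minus q2 qpow_nonzero power2_eq_square)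
    have cd: "?q (1 + \<alpha> + \<rho> - \<beta> - \<sigma> - x) = Q * nu / (mu * X)" "?q (1 - \<alpha> - \<rho> - \<beta> - \<sigma> - x)
        = Q / (nu * mu * X)"
      "?q (2 - (1 + \<alpha> + \<rho> - \<beta> - \<sigma>) - x) = Q * mu / (nu * X)" "?q (2 - (1 - \<alpha> - \<rho> - \<beta> - \<sigma>) - x)
          = Q * nu * mu / X"
      by (simp_all add: defs qpow_add qpow_diff qpow_minus q2 qpow_nonzero power2_eq_square)
    have den: "?q (2 + 2 * u) = Q\<^sup>2 * (?q u)\<^sup>2" "?q (- 2 * u) = 1 / (?q u)\<^sup>2" "?q (2 - 2 * u)
        = Q\<^sup>2 / (?q u)\<^sup>2" for u
      using qpow_minus[of \<tau> "2 * u"] by (simp_all add: qpow_add qpow_diff qpow_double q2)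
    have A: "coeff_A \<tau> \<alpha> \<rho> \<beta> \<sigma> u = (1 - Q * r * s*?q u) * (1 - Q * s*?q u/r) * (1
        - Q*nu*?q u/mu) * (1 - Q*?q u/(nu*mu)) / ((1 - (?q u)^2) * (1 - Q^2*(?q u)^2))" for u
      unfolding coeff_A_def Let_def ab den qpow_double by simp
    have C: "coeff_C \<tau> \<alpha> \<rho> \<beta> \<sigma> x = - coeff_A \<tau> \<alpha> \<rho> \<beta> \<sigma> x - coeff_A \<tau> \<alpha> \<rho> \<beta> \<sigma> (- x)"
        by (simp add: coeff_C_def)
    have B: "coeff_B \<tau> \<rho> \<beta> \<sigma> x = s/mu * ((1 - Q * r * s*X) * (1 - Q*X/(r * s)) * (1
        - Q * s*X/r) * (1 - Q * r*X/s)) / ((1 - X^2) * (1 - Q^2*X^2))"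
      unfolding coeff_B_def Let_def ab den qb qpow_double X_def[symmetric] by simp
    have D: "coeff_D \<tau> \<alpha> \<rho> \<beta> \<sigma> x = s/mu * ((1 - Q*nu/(mu*X)) * (1 - Q*mu/(nu*X)) * (1
        - Q/(nu*mu*X)) * (1 - Q*nu*mu/X)) / ((1 - 1/X^2) * (1 - Q^2/X^2))"
      unfolding coeff_D_def Let_def cd den qb X_def[symmetric] by simp
    have E: "eigenvalue \<tau> lam \<beta> = - 1 - Q^2 * s^2/mu^2 + Q * s/mu * (y^2 + 1/y^2)"
    proof -
      have "?q (2 - 2 * \<beta>) = Q\<^sup>2 * (?q (- \<beta>))\<^sup>2" "?q (1 - \<beta>) = Q * ?q (- \<beta>)"
        by (simp_all add: qpow_diff qpow_minus qpow_double q2 Q_def power_divide)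
      moreover have "?q (2 * \<i> * lam) = y\<^sup>2" "?q (- 2 * \<i> * lam) = 1 / y\<^sup>2"
        using qpow_double[of \<tau> "\<i> * lam"] qpow_minus[of \<tau> "2 * \<i> * lam"]
            by (simp_all add: y_def mult.assoc)
      ultimately show ?thesis unfolding eigenvalue_def qb by (simp add: power_divide)
    qed
    have qmx: "?q (- x) = 1 / X" by (simp add: X_def qpow_minus)
    show ?thesis
      using certificate_exists[OF nz d] that
      unfolding C A X_def[symmetric] qmx B D E by metis
  qed
  show ?thesis
  proof (intro exI allI)
    fix z
    define Z where "Z = ?q z"
    have Z: "Z \<noteq> 0" unfolding Z_def by (rule qpow_nonzero)
    have s1: "q_sine \<tau> (z - L1) * q_sine \<tau> (z - L2) = - (Q*X*Z/y + y/(Q*X*Z) - (mu + 1/mu))"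
      by (subst sq[of _ _ "\<beta> + \<sigma>" "1 + x + z - \<i> * lam"]) (simp_all add: p defs Z_def qpow_add
          qpow_diff mult_ac)
    have s2: "q_sine \<tau> (z - L1 - 2) * q_sine \<tau> (z - L2 - 2) = - (X*Z/(Q*y) + Q*y/(X*Z) - (mu + 1/mu))"
      by (subst sq[of _ _ "\<beta> + \<sigma>" "x + z - (1 + \<i> * lam)"]) (simp_all add: p defs Z_def qpow_add
          qpow_diff mult_ac)
    have s3: "q_sine \<tau> (R1 - z) * q_sine \<tau> (R2 - z) = - (y*X*Z + 1/(y*X*Z) - (s + 1/s))"
      by (subst sq[of _ _ "- \<sigma>" "- (\<i> * lam + x + z)"]) (simp_all add: p defs Z_def qpow_diff
          qpow_minus mult_ac)
    have s4: "q_sine \<tau> (R1 - 2 - z) * q_sine \<tau> (R2 - 2 - z) = - (Q^2*y*X*Z + 1/(Q^2*y*X*Z) - (s + 1/s))"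
      by (subst sq[of _ _ "- \<sigma>" "- (2 + \<i> * lam + x
          + z)"]) (simp_all add: p defs Z_def qpow_diff qpow_minus q2[unfolded Q_def] mult_ac)
    \<comment> \<open>The half period h contributes the factor -1, so this product and the next have
      the opposite sign from the four before. This reverses the signs on the right hand side
      relative to \<open>certificate_exists\<close>.\<close>
    have s5: "q_sine \<tau> (z - L3) * q_sine \<tau> (z - L4) = Q*y*Z + 1/(Q*y*Z) - (r + 1/r)"
      by (subst sq[of _ _ "\<rho> - h" "1 + \<i> * lam + z
          - h"]) (simp_all add: p h defs Z_def qpow_add qpow_diff qh mult_ac)
    have s6: "q_sine \<tau> (R3 - z) * q_sine \<tau> (R4 - z) = Z/y + y/Z - (nu + 1/nu)"
      by (subst sq[of _ _ "h - (\<alpha> + \<rho>)" "\<i> * lam - z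
          - h"]) (simp_all add: p h defs Z_def qpow_add qpow_diff qh mult_ac)
    have qz2: "?q (z + 2) = Q\<^sup>2 * Z" by (simp add: qpow_add q2 Z_def)
    show "coeff_B \<tau> \<rho> \<beta> \<sigma> x * (q_sine \<tau> (z - L1) * q_sine \<tau> (z - L2)) * (q_sine \<tau> (z - L1
        - 2) * q_sine \<tau> (z - L2 - 2))
     + (coeff_C \<tau> \<alpha> \<rho> \<beta> \<sigma> x - eigenvalue \<tau> lam \<beta>) * (q_sine \<tau> (z - L1 - 2) * q_sine \<tau> (z - L2
         - 2)) * (q_sine \<tau> (R1 - 2 - z) * q_sine \<tau> (R2 - 2 - z))
     + coeff_D \<tau> \<alpha> \<rho> \<beta> \<sigma> x * (q_sine \<tau> (R1 - z) * q_sine \<tau> (R2 - z)) * (q_sine \<tau> (R1 - 2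
         - z) * q_sine \<tau> (R2 - 2 - z))
     = (k1 * ?q (z + 2) + k0 + k2 / ?q (z + 2)) * (q_sine \<tau> (z - L1 - 2) * q_sine \<tau> (z - L2
         - 2)) * (q_sine \<tau> (z - L3) * q_sine \<tau> (z - L4))
     - (k1 * ?q z + k0 + k2 / ?q z) * (q_sine \<tau> (R3 - z) * q_sine \<tau> (R4 - z)) * (q_sine \<tau> (R1 - 2
         - z) * q_sine \<tau> (R2 - 2 - z))"
      unfolding s1 s2 s3 s4 s5 s6 qz2 Z_def[symmetric] using K[OF Z]
      by (simp only: mult_minus_left mult_minus_right minus_minus diff_minus_eq_add)
  qed
qed

section \<open>Assembly of the difference equation\<close>

lemma norm_qpow: "norm (qpow \<tau> z) = exp (- 2 * pi * \<tau> * Im z)"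
  by (simp add: qpow_def)

lemma not_nonpos_Reals_diff:
  "(Im z = Im p \<Longrightarrow> Re p < Re z) \<Longrightarrow> z - p \<notin> \<real>\<^sub>\<le>\<^sub>0"
  by (auto simp: complex_nonpos_Reals_iff)

theorem theorem6p5:
  fixes \<tau> :: real and lam \<alpha> \<rho> \<beta> \<sigma> x :: complex
  assumes "- 1 / 2 < \<tau>" and "\<tau> < 0"
    and "generic_params \<tau> \<alpha> \<rho> \<beta> \<sigma> lam x"
  shows "coeff_B \<tau> \<rho> \<beta> \<sigma> x * psi \<tau> \<alpha> \<rho> \<beta> \<sigma> lam (x + 2)
           + coeff_C \<tau> \<alpha> \<rho> \<beta> \<sigma> x * psi \<tau> \<alpha> \<rho> \<beta> \<sigma> lam x
           + coeff_D \<tau> \<alpha> \<rho> \<beta> \<sigma> x * psi \<tau> \<alpha> \<rho> \<beta> \<sigma> lam (x - 2)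
         = eigenvalue \<tau> lam \<beta> * psi \<tau> \<alpha> \<rho> \<beta> \<sigma> lam x"
proof -
  note \<tau> = assms(2)
  define k where "k = - 2 * \<tau>"
  have k: "k > 0" using \<tau> by (simp add: k_def)
  obtain L1 L2 L3 L4 where L: "left_points \<tau> \<alpha> \<rho> \<beta> \<sigma> lam x = [L1, L2, L3, L4]"
      by (simp add: left_points_def)
  obtain R1 R2 R3 R4 where R: "right_points \<tau> \<alpha> \<rho> \<beta> \<sigma> lam x = [R1, R2, R3, R4]"
      by (simp add: right_points_def)
  have Lp: "left_points \<tau> \<alpha> \<rho> \<beta> \<sigma> lam (x + 2) = [L1 - 2, L2 - 2, L3, L4]"
    and Lm: "left_points \<tau> \<alpha> \<rho> \<beta> \<sigma> lam (x - 2) = [L1 + 2, L2 + 2, L3, L4]" using L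
        by (auto simp: left_points_def)
  have Rp: "right_points \<tau> \<alpha> \<rho> \<beta> \<sigma> lam (x + 2) = [R1 - 2, R2 - 2, R3, R4]"
    and Rm: "right_points \<tau> \<alpha> \<rho> \<beta> \<sigma> lam (x - 2) = [R1 + 2, R2 + 2, R3, R4]" using R
        by (auto simp: right_points_def)
  have dis: "{Im L1, Im L2, Im L3, Im L4} \<inter> {Im R1, Im R2, Im R3, Im R4} = {}"
    using assms(3) unfolding generic_params_def L R by auto
  \<comment> \<open>This contour serves \<open>x\<close>, \<open>x + 2\<close> and \<open>x - 2\<close>, and its translate
      by \<open>2\<close> stays in the domain of \<open>F\<close> below.\<close>
  obtain g where g: "deformation_of_imag_axis g"
    and sep: "separates g (\<Union>p\<in>{L1 + 2, L2 + 2, L3, L4}. left_ray p) (\<Union>p\<in>{R1 - 2, R2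
        - 2, R3, R4}. right_ray p)"
    by (rule contour_exists[of "{L1 + 2, L2 + 2, L3, L4}" "{R1 - 2, R2 - 2, R3, R4}"]) (use dis in auto)
  have sl: "Im (g t) = Im L1 \<Longrightarrow> Re L1 + 2 < Re (g t)" "Im (g t) = Im L2 \<Longrightarrow> Re L2 + 2 < Re (g t)"
    "Im (g t) = Im L3 \<Longrightarrow> Re L3 < Re (g t)" "Im (g t) = Im L4 \<Longrightarrow> Re L4 < Re (g t)"
    and sr: "Im (g t) = Im R1 \<Longrightarrow> Re (g t) + 2 < Re R1" "Im (g t) = Im R2 \<Longrightarrow> Re (g t) + 2 < Re R2"
    "Im (g t) = Im R3 \<Longrightarrow> Re (g t) < Re R3" "Im (g t) = Im R4 \<Longrightarrow> Re (g t) < Re R4" for t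
    using sep unfolding separates_iff by fastforce+
  let ?f = "\<lambda>x. psi_integrand \<tau> \<alpha> \<rho> \<beta> \<sigma> lam x"
  have psi: "has_line_integral (?f y) (psi \<tau> \<alpha> \<rho> \<beta> \<sigma> lam y) g" if "y \<in> {x, x + 2, x - 2}" for y
  proof (rule psi_has_line_integral[OF \<tau>])
    show "Im ` set (left_points \<tau> \<alpha> \<rho> \<beta> \<sigma> lam y) \<inter> Im ` set (right_points \<tau> \<alpha> \<rho> \<beta> \<sigma> lam y) = {}"
      using that dis by (auto simp: L R Lp Rp Lm Rm)
    show "admissible_contour \<tau> \<alpha> \<rho> \<beta> \<sigma> lam y g"
      unfolding admissible_contour_def separates_iff using that g sl sr
          by (fastforce simp: L R Lp Rp Lm Rm)
  qed
  have qx: "qpow \<tau> (2 * x) \<notin> {1, qpow \<tau> 2, qpow \<tau> (-2)}" using assms(3) by (simp add: generic_params_def)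
  let ?S = "q_sine \<tau>"
  obtain k1 k0 k2 where K: "\<And>z.
     coeff_B \<tau> \<rho> \<beta> \<sigma> x * (?S (z - L1) * ?S (z - L2)) * (?S (z - L1 - 2) * ?S (z - L2 - 2))
     + (coeff_C \<tau> \<alpha> \<rho> \<beta> \<sigma> x - eigenvalue \<tau> lam \<beta>) * (?S (z - L1 - 2) * ?S (z - L2 - 2)) * (?S (R1
         - 2 - z) * ?S (R2 - 2 - z))
     + coeff_D \<tau> \<alpha> \<rho> \<beta> \<sigma> x * (?S (R1 - z) * ?S (R2 - z)) * (?S (R1 - 2 - z) * ?S (R2 - 2 - z))
     = (k1 * qpow \<tau> (z + 2) + k0 + k2 / qpow \<tau> (z + 2)) * (?S (z - L1 - 2) * ?S (z - L2
         - 2)) * (?S (z - L3) * ?S (z - L4))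
     - (k1 * qpow \<tau> z + k0 + k2 / qpow \<tau> z) * (?S (R3 - z) * ?S (R4 - z)) * (?S (R1 - 2
         - z) * ?S (R2 - 2 - z))"
    using coeff_certificate[OF \<tau> qx L R] by blast
  define M where "M z = k1 * qpow \<tau> z + k0 + k2 / qpow \<tau> z" for z
  \<comment> \<open>At z each right factor exceeds the common product by one sine, at z + 2 each
    left factor does: these are the two sine products on the right of \<open>K\<close>. Both sums of
    initial points grow by 4, so the decay rate is that of the integrand.\<close>
  let ?ls = "[L1 + 2, L2 + 2, L3, L4]" and ?rs = "[R1, R2, R3 + 2, R4 + 2]"
  define F where "F z = M z * ray_product k ?ls ?rs z" for z
  have int0: "has_line_integral (\<lambda>z. F (z + 2) - F z) 0 g"
  proof -
    have hol: "F holomorphic_on ray_complement (set ?ls) (set ?rs)"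
    proof -
      have "M holomorphic_on A" for A
        unfolding M_def qpow_def by (intro holomorphic_intros) auto
      then show ?thesis unfolding F_def [abs_def] by (intro holomorphic_on_mult ray_product_holomorphic k)
    qed
    have "sum_list ?rs - sum_list ?ls = sum_list [R1, R2, R3, R4] - sum_list [L1, L2, L3, L4]" by simp
    also have "\<dots> = 4 + 4 / of_real k" unfolding k_def L[symmetric] R[symmetric]
        by (rule sum_list_points[OF \<tau>])
    finally have sum: "sum_list ?rs - sum_list ?ls = 4 + 4 / of_real k" .
    obtain C Y where CY: "\<And>z. \<bar>Re z\<bar> \<le> 2 \<Longrightarrow> Y \<le> \<bar>Im z\<bar> \<Longrightarrow> norm (ray_product k ?ls ?rs z)
        \<le> C * exp (- (pi * (k + 1)) * \<bar>Im z\<bar>)"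
    proof -
      have "length ?ls = 4" "length ?rs = 4" by simp_all
      from norm_ray_product_decay[OF k this sum] show ?thesis using that by blast
    qed
    define D where "D = norm k1 + norm k0 + norm k2"
    have M: "norm (M z) \<le> D * exp (pi * k * \<bar>Im z\<bar>)" for z
    proof -
      let ?e = "exp (pi * k * \<bar>Im z\<bar>)"
      have "\<bar>pi * k * Im z\<bar> = pi * k * \<bar>Im z\<bar>" using k by (simp add: abs_mult)
      then have b: "pi * k * Im z \<le> pi * k * \<bar>Im z\<bar>" "- (pi * k * Im z) \<le> pi * k * \<bar>Im z\<bar>" "0
          \<le> pi * k * \<bar>Im z\<bar>" by linarith+
      have n: "norm (qpow \<tau> z) = exp (pi * k * Im z)" unfolding norm_qpow by (simp add: k_def)
      have "norm (M z) \<le> norm (k1 * qpow \<tau> z) + norm k0 + norm (k2 / qpow \<tau> z)"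
        unfolding M_def by (rule order_trans[OF norm_triangle_ineq add_right_mono[OF norm_triangle_ineq]])
      also have "\<dots> = norm k1 * exp (pi * k * Im z) + norm k0 * 1 + norm k2 * exp (- (pi * k * Im z))"
        by (simp add: norm_mult norm_divide n exp_minus inverse_eq_divide)
      also have "\<dots> \<le> norm k1 * ?e + norm k0 * ?e + norm k2 * ?e"
        using b by (intro add_mono mult_left_mono) auto
      finally show ?thesis by (simp add: D_def distrib_right)
    qed
    have "norm (F z) \<le> D * C * exp (- pi * \<bar>Im z\<bar>)" if z: "\<bar>Re z\<bar> \<le> 2" "Y \<le> \<bar>Im z\<bar>" for z
    proof -
      have "norm (F z) \<le> (D * exp (pi * k * \<bar>Im z\<bar>)) * (C * exp (- (pi * (k + 1)) * \<bar>Im z\<bar>))"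
        unfolding F_def norm_mult using M CY[OF z]
            by (intro mult_mono) (auto intro: order_trans[OF norm_ge_zero])
      also have "\<dots> = D * C * (exp (pi * k * \<bar>Im z\<bar>) * exp (- (pi * (k + 1)) * \<bar>Im z\<bar>))"
          by (simp only: mult_ac)
      also have "exp (pi * k * \<bar>Im z\<bar>) * exp (- (pi * (k + 1)) * \<bar>Im z\<bar>) = exp (- pi * \<bar>Im z\<bar>)"
        unfolding exp_add[symmetric] by (simp add: algebra_simps)
      finally show ?thesis .
    qed
    note decay = this
    \<comment> \<open>For the translate the left conditions only improve. On the right, R1 and R2
      use the margin of g, while R3 and R4 have themselves been moved by 2.\<close>
    have "separates g (\<Union>p\<in>set ?ls. left_ray p) (\<Union>p\<in>set ?rs. right_ray p)"
      "separates (\<lambda>t. g t + 2) (\<Union>p\<in>set ?ls. left_ray p) (\<Union>p\<in>set ?rs. right_ray p)"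
      unfolding separates_iff using sl sr by fastforce+
    moreover have "Im ` set ?ls \<inter> Im ` set ?rs = {}" using dis by auto
    ultimately show ?thesis
      using contour_integral_independent(2)[OF finite_set finite_set _ hol pi_gt_zero, of Y "D * C"
          g] decay g by blast
  qed
  have rp: "?f y z = ray_product k (left_points \<tau> \<alpha> \<rho> \<beta> \<sigma> lam y) (right_points \<tau> \<alpha> \<rho> \<beta> \<sigma> lam y) z" for y z
    unfolding k_def by (rule psi_integrand_eq_ray_product[OF \<tau>])
  have eq: "coeff_B \<tau> \<rho> \<beta> \<sigma> x * ?f (x + 2) (g t) + (coeff_C \<tau> \<alpha> \<rho> \<beta> \<sigma> x - eigenvalue \<tau> lam \<beta>) * ?f x (g t)
      + coeff_D \<tau> \<alpha> \<rho> \<beta> \<sigma> x * ?f (x - 2) (g t) = F (g t + 2) - F (g t)" for t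
  proof -
    define z where "z = g t"
    have shift: "hgam k (w + 2) = ?S w * hgam k w" if "w \<notin> \<real>\<^sub>\<le>\<^sub>0" for w
      unfolding k_def using hgam_shift_q_sine[OF \<tau> that] .
    have up: "hgam k (z - p + 2) = ?S (z - p) * hgam k (z - p)" if "Im z = Im p \<Longrightarrow> Re p < Re z" for p
      using that by (intro shift not_nonpos_Reals_diff)
    have dn: "hgam k (p - z + 2) = ?S (p - z) * hgam k (p - z)" if "Im z = Im p \<Longrightarrow> Re z < Re p" for p
      using that by (intro shift not_nonpos_Reals_diff) auto
    have sl': "Im z = Im L1 \<Longrightarrow> Re L1 < Re z" "Im z = Im L2 \<Longrightarrow> Re L2 < Re z"
      and sr': "Im z = Im R1 \<Longrightarrow> Re z < Re R1" "Im z = Im R2 \<Longrightarrow> Re z < Re R2"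
      using sl(1,2)[of t] sr(1,2)[of t] unfolding z_def by fastforce+
    \<comment> \<open>The first two equations step up from L1 + 2 and L2 + 2 and rely on the margin
      of the contour; it keeps the arguments off the nonpositive reals.\<close>
    have l: "hgam k (z - L1) = ?S (z - L1 - 2) * hgam k (z - L1 - 2)" "hgam k (z - L2) = ?S (z - L2
        - 2) * hgam k (z - L2 - 2)"
      "hgam k (z - L1 + 2) = ?S (z - L1) * hgam k (z - L1)" "hgam k (z - L2 + 2) = ?S (z
          - L2) * hgam k (z - L2)"
      "hgam k (z - L3 + 2) = ?S (z - L3) * hgam k (z - L3)" "hgam k (z - L4 + 2) = ?S (z
          - L4) * hgam k (z - L4)"
      using up[of "L1 + 2"] up[of "L2 + 2"] up[OF sl'(1)] up[OF sl'(2)] up[of L3] up[of L4] sl[of t]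
          unfolding z_def[symmetric]
      by (simp_all add: algebra_simps)
    have r: "hgam k (R1 - z) = ?S (R1 - 2 - z) * hgam k (R1 - 2 - z)" "hgam k (R2 - z) = ?S (R2 - 2
        - z) * hgam k (R2 - 2 - z)"
      "hgam k (R1 - z + 2) = ?S (R1 - z) * hgam k (R1 - z)" "hgam k (R2 - z + 2) = ?S (R2
          - z) * hgam k (R2 - z)"
      "hgam k (R3 - z + 2) = ?S (R3 - z) * hgam k (R3 - z)" "hgam k (R4 - z + 2) = ?S (R4
          - z) * hgam k (R4 - z)"
      using dn[of "R1 - 2"] dn[of "R2 - 2"] dn[OF sr'(1)] dn[OF sr'(2)] dn[of R3] dn[of R4] sr[of t]
          unfolding z_def[symmetric]
      by (simp_all add: algebra_simps)
    have a: "z - (p - 2) = z - p + 2" "z - (p + 2) = z - p - 2" "p + 2 - z = p - z + 2"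
      "z + 2 - p = z - p + 2" "p - (z + 2) = p - 2 - z" "z - p - 2 + 2 = z - p" "p + 2 - 2 - z = p
          - z" for p
      by (simp_all add: algebra_simps)
    \<comment> \<open>Every product is reduced to the common one; what remains is \<open>K\<close>
      multiplied by that product.\<close>
    show ?thesis
      unfolding z_def[symmetric] rp F_def L R Lp Rp Lm Rm ray_product_def list.map prod_list.Cons
          prod_list.Nil mult_1_right a r(3-6) l(3-6) r(1,2) l(1,2)
      using K[of z, folded M_def] by algebra
  qed
  have "has_line_integral (\<lambda>z. coeff_B \<tau> \<rho> \<beta> \<sigma> x * ?f (x + 2) z + (coeff_C \<tau> \<alpha> \<rho> \<beta> \<sigma> x
      - eigenvalue \<tau> lam \<beta>) * ?f x z
      + coeff_D \<tau> \<alpha> \<rho> \<beta> \<sigma> x * ?f (x - 2) z)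
     (coeff_B \<tau> \<rho> \<beta> \<sigma> x * psi \<tau> \<alpha> \<rho> \<beta> \<sigma> lam (x + 2)
      + (coeff_C \<tau> \<alpha> \<rho> \<beta> \<sigma> x - eigenvalue \<tau> lam \<beta>) * psi \<tau> \<alpha> \<rho> \<beta> \<sigma> lam x
      + coeff_D \<tau> \<alpha> \<rho> \<beta> \<sigma> x * psi \<tau> \<alpha> \<rho> \<beta> \<sigma> lam (x - 2)) g"
    by (intro has_line_integral_add has_line_integral_cmult psi) auto
  from has_line_integral_unique[OF this int0 eq] show ?thesis by (simp add: algebra_simps)
qed

end
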